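(* Let $F$ be a field, and let $\Delta$ be a simplicial complex that is a near-cone, is sequentially Cohen-Macaulay over $F$, and has minimum facet cardinality $k$. Then $\Delta$ is $r$-EKR for every positive integer $r$ with $r\leq\frac{k}{2}$.
   Context: A (finite, abstract) simplicial complex $\Delta$ is a system of sets (faces) on a finite vertex set $V(\Delta)$, closed under taking subsets, such that every vertex lies in some face. A facet is a face maximal under inclusion. The dimension of a face $\sigma$ is $|\sigma|-1$. $f_r(\Delta)$ is the number of faces of cardinality $r$. For a face $\sigma$, $\operatorname{link}_\Delta\sigma=\{\tau : \tau\cup\sigma \text{ is a face of }\Delta,\ \tau\cap\sigma=\emptyset\}$; for a vertex $v$, $\operatorname{link}_\Delta v=\operatorname{link}_\Delta\{v\}$. A family of sets is intersecting if every pair of its members has non-empty intersection; it is an $r$-family if every member has cardinality $r$. $\Delta$ is $r$-EKR if every intersecting $r$-family $\mathcal{A}$ of faces of $\Delta$ satisfies $|\mathcal{A}|\leq\max_{v\in V(\Delta)}f_{r-1}(\operatorname{link}_\Delta v)$. $\Delta$ is a near-cone (with respect to an apex vertex $v\in V(\Delta)$) if for every face $\sigma$ and every $w\in\sigma$, the set $(\sigma\setminus\{w\})\cup\{v\}$ is also a face. $\Delta$ is Cohen-Macaulay over $F$ if $\tilde{H}_i(\operatorname{link}_\Delta\sigma;F)=0$ for all faces $\sigma$ of $\Delta$ (including $\sigma=\emptyset$) and all $i<\dim(\operatorname{link}_\Delta\sigma)$. The pure $d$-skeleton of $\Delta$ is the subcomplex generated by all faces of dimension exactly $d$ (i.e.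 consisting of all subsets of such faces). $\Delta$ is sequentially Cohen-Macaulay over $F$ if its pure $d$-skeleton is Cohen-Macaulay over $F$ for all $d\le\dim\Delta$. *)

theory Defs
  imports "HOL-Algebra.Algebra"
begin

text \<open>
  A complex is represented by its set of faces. Since every vertex lies in some face, the vertex
  set is the union of the faces. Dimensions and homological degrees are integers, so that the
  empty face sits in dimension \<open>-1\<close>.
\<close>

definition abstract_complex :: "'a set set \<Rightarrow> bool" where
  "abstract_complex \<Delta> \<longleftrightarrow> finite (\<Union>\<Delta>) \<and> (\<forall>\<sigma>\<in>\<Delta>. \<forall>\<tau>. \<tau> \<subseteq> \<sigma> \<longrightarrow> \<tau> \<in> \<Delta>)"

definition vertices :: "'a set set \<Rightarrow> 'a set" where
  "vertices \<Delta> = \<Union>\<Delta>"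

definition facets :: "'a set set \<Rightarrow> 'a set set" where
  "facets \<Delta> = {\<sigma>\<in>\<Delta>. \<forall>\<tau>\<in>\<Delta>. \<sigma> \<subseteq> \<tau> \<longrightarrow> \<tau> = \<sigma>}"

definition min_facet_card :: "'a set set \<Rightarrow> nat" where
  "min_facet_card \<Delta> = Min (card ` facets \<Delta>)"

definition face_dim :: "'a set \<Rightarrow> int" where
  "face_dim \<sigma> = int (card \<sigma>) - 1"

definition complex_dim :: "'a set set \<Rightarrow> int" where
  "complex_dim \<Delta> = Max (face_dim ` \<Delta>)"

text \<open>The index of \<open>face_number\<close> is the cardinality of the faces, not their dimension.\<close>

definition face_number :: "nat \<Rightarrow> 'a set set \<Rightarrow> nat" where
  "face_number r \<Delta> = card {\<sigma>\<in>\<Delta>. card \<sigma> = r}"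

definition face_link :: "'a set set \<Rightarrow> 'a set \<Rightarrow> 'a set set" where
  "face_link \<Delta> \<sigma> = {\<tau>. \<tau> \<union> \<sigma> \<in> \<Delta> \<and> \<tau> \<inter> \<sigma> = {}}"

definition intersecting_family :: "'a set set \<Rightarrow> bool" where
  "intersecting_family \<A> \<longleftrightarrow> (\<forall>\<sigma>\<in>\<A>. \<forall>\<tau>\<in>\<A>. \<sigma> \<inter> \<tau> \<noteq> {})"

text \<open>Meaningful for \<open>r \<ge> 1\<close> and complexes with at least one vertex.\<close>

definition EKR :: "nat \<Rightarrow> 'a set set \<Rightarrow> bool" where
  "EKR r \<Delta> \<longleftrightarrow>
     (\<forall>\<A>. \<A> \<subseteq> \<Delta> \<and> (\<forall>\<sigma>\<in>\<A>. card \<sigma> = r) \<and> intersecting_family \<A> \<longrightarrow>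
        card \<A> \<le> Max ((\<lambda>v. face_number (r - 1) (face_link \<Delta> {v})) ` vertices \<Delta>))"

definition near_cone :: "'a set set \<Rightarrow> 'a \<Rightarrow> bool" where
  "near_cone \<Delta> v \<longleftrightarrow> v \<in> vertices \<Delta> \<and> (\<forall>\<sigma>\<in>\<Delta>. \<forall>w\<in>\<sigma>. (\<sigma> - {w}) \<union> {v} \<in> \<Delta>)"

text \<open>
  Reduced simplicial homology with coefficients in a field. Every face is oriented by one fixed
  linear order on the type of vertices, which exists by the well-ordering theorem; up to
  isomorphism, homology does not depend on the choice of the order.
\<close>

definition vertex_order :: "'a rel" where
  "vertex_order = (SOME R. linear_order R)"

definition incidence_sign :: "'a \<Rightarrow> 'a set \<Rightarrow> 'f::field" where
  "incidence_sign v \<tau> = (- 1) ^ card {u\<in>\<tau>. u \<noteq> v \<and> (u, v) \<in> vertex_order}"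

definition face_chain_group :: "'a set set \<Rightarrow> int \<Rightarrow> ('a set \<Rightarrow> 'f::field) monoid" where
  "face_chain_group \<Delta> i =
     \<lparr>carrier = {c. \<forall>\<sigma>. c \<sigma> \<noteq> 0 \<longrightarrow> \<sigma> \<in> \<Delta> \<and> face_dim \<sigma> = i},
      monoid.mult = (\<lambda>c d \<sigma>. c \<sigma> + d \<sigma>), one = (\<lambda>_. 0)\<rparr>"

text \<open>
  A chain \<open>c\<close> stands for the formal sum of the oriented faces \<open>\<sigma>\<close> with coefficients \<open>c \<sigma>\<close>. The
  usual boundary of \<open>[v\<^sub>0, \<dots>, v\<^sub>n]\<close> is the sum of \<open>(-1)^j\<close> times the face omitting \<open>v\<^sub>j\<close>. Hence \<open>\<tau>\<close>
  receives a contribution from each \<open>\<tau> \<union> {v}\<close> with \<open>v \<notin> \<tau>\<close>, and \<open>j\<close> is the number of elements of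
  \<open>\<tau>\<close> that precede \<open>v\<close>. The empty face is included, so this is the augmented complex.
\<close>

definition face_boundary :: "'a set set \<Rightarrow> ('a set \<Rightarrow> 'f::field) \<Rightarrow> 'a set \<Rightarrow> 'f" where
  "face_boundary \<Delta> c \<tau> = (\<Sum>v\<in>vertices \<Delta> - \<tau>. incidence_sign v \<tau> * c (insert v \<tau>))"

text \<open>
  Cycles modulo boundaries. Only the additive group is recorded: whether a vector space vanishes
  depends on nothing else.
\<close>

definition reduced_face_homology ::
    "'a set set \<Rightarrow> int \<Rightarrow> ('a set \<Rightarrow> 'f::field) set monoid" where
  "reduced_face_homology \<Delta> i =
     (face_chain_group \<Delta> i)
       \<lparr>carrier := kernel (face_chain_group \<Delta> i) (face_chain_group \<Delta> (i - 1)) (face_boundary \<Delta>)\<rparr>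
     Mod (face_boundary \<Delta> ` carrier (face_chain_group \<Delta> (i + 1)))"

definition cohen_macaulay :: "'f::field itself \<Rightarrow> 'a set set \<Rightarrow> bool" where
  "cohen_macaulay F \<Delta> \<longleftrightarrow>
     (\<forall>\<sigma>\<in>\<Delta>. \<forall>i < complex_dim (face_link \<Delta> \<sigma>).
        trivial_group (reduced_face_homology (face_link \<Delta> \<sigma>) i :: ('a set \<Rightarrow> 'f) set monoid))"

definition pure_skeleton :: "int \<Rightarrow> 'a set set \<Rightarrow> 'a set set" where
  "pure_skeleton d \<Delta> = {\<tau>. \<exists>\<sigma>\<in>\<Delta>. face_dim \<sigma> = d \<and> \<tau> \<subseteq> \<sigma>}"

text \<open>For \<open>d < -1\<close> the pure skeleton has no faces and the condition is void.\<close>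

definition sequentially_cohen_macaulay :: "'f::field itself \<Rightarrow> 'a set set \<Rightarrow> bool" where
  "sequentially_cohen_macaulay F \<Delta> \<longleftrightarrow>
     (\<forall>d \<le> complex_dim \<Delta>. cohen_macaulay F (pure_skeleton d \<Delta>))"

end

theory Submission
  imports Defs "HOL-Computational_Algebra.Formal_Laurent_Series"
    "Jordan_Normal_Form.Determinant"
begin

text \<open>
  The proof is by exterior algebraic shifting. Let \<open>\<Gamma>\<close> consist of the faces of \<open>\<Delta>\<close> with at most
  \<open>2 r\<close> vertices. As \<open>2 r \<le> k\<close>, this is a pure skeleton of \<open>\<Delta>\<close>, hence Cohen-Macaulay. Contracting chains
  with sufficiently general linear forms \<open>\<theta> 0, \<theta> 1, \<dots>\<close> defines coordinates indexed by sets of natural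
  numbers. Replacing chains by their lexicographically leading coordinates turns an intersecting
  \<open>r\<close>-family into an intersecting family of the same size, and a choice of the forms that
  makes the leading sets as heavy as possible makes this family shifted. The leading sets of \<open>\<Gamma>\<close> are
  closed under subsets, and since \<open>\<Gamma>\<close> is Cohen-Macaulay they can be completed by initial segments up
  to cardinality \<open>2 r\<close>. Therefore the Erdos-Ko-Rado argument for shifted families bounds the family
  by the number of leading \<open>r\<close>-sets of \<open>\<Gamma>\<close> containing \<open>0\<close>. Their contractions with \<open>\<theta> 0\<close>, being
  cycles, are determined by their values on the faces with \<open>r - 1\<close> vertices that avoid a given vertex.
  If that vertex is the apex of the near-cone, these faces are exactly the faces of its link.
\<close>

section \<open>Shifted intersecting families\<close>

text \<open>The constant \<open>2 * r\<close> comes from the combinatorics: two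
  \<open>r\<close>-sets with disjoint traces on \<open>{..<t}\<close> are separated by shifting
  their common part into the free points of \<open>{..<t}\<close>, and inside a set of
  \<open>2 * r\<close> elements there are exactly enough of these. Shiftedness is arranged for the
  leading sets of the family; for those of \<Gamma>, closure under completion by
  \<open>{..<t}\<close> takes its place.

  The main obstacle is this completion. It says that a chain killed by
  \<open>\<theta> 0, ..., \<theta> (t - 1)\<close> is the contraction by these forms of another
  chain of \<Gamma>. In the star of a face with at least \<open>t\<close> vertices one multiplies by
  dual vectors. A chain need not live in one star, so it is resolved through links of faces, whose
  homology vanishes, until the pieces lie in stars of large faces.

  In place of forms with independent transcendental coefficients, the proof uses forms with finitely
  many nonzero minors and an extremal choice among them.\<close>

definition shifted :: "nat set set \<Rightarrow> bool" where
  "shifted B \<longleftrightarrow> (\<forall>S\<in>B. \<forall>p\<in>S. \<forall>q<p. q \<notin> S \<longrightarrow> insert q (S - {p}) \<in> B)"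

lemma shiftedD:
  "shifted B \<Longrightarrow> S \<in> B \<Longrightarrow> p \<in> S \<Longrightarrow> q < p \<Longrightarrow> q \<notin> S \<Longrightarrow> insert q (S - {p}) \<in> B"
  unfolding shifted_def by blast

lemma intersectingD: "intersecting_family B \<Longrightarrow> S \<in> B \<Longrightarrow> T \<in> B \<Longrightarrow> S \<inter> T \<noteq> {}"
  unfolding intersecting_family_def by blast

text \<open>A \<open>j\<close>-subset of \<open>{..<2 * j}\<close> and its complement are disjoint,
  so the family contains at most one set of each complementary pair.\<close>

lemma card_intersecting_half:
  assumes "j \<ge> 1" "B \<subseteq> {P. P \<subseteq> {..<2 * j} \<and> card P = j}" "intersecting_family B"
  shows "card B \<le> (2 * j - 1) choose (j - 1)"
proof -
  let ?U = "{P. P \<subseteq> {..<2 * j} \<and> card P = j}"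
  let ?C = "(\<lambda>P. {..<2 * j} - P) ` B"
  have fin: "finite ?U" by simp
  have finB: "finite B" using assms(2) fin by (rule finite_subset)
  have inj: "inj_on (\<lambda>P. {..<2 * j} - P) B"
  proof (rule inj_onI)
    fix P P' assume "P \<in> B" "P' \<in> B" and e: "{..<2 * j} - P = {..<2 * j} - P'"
    hence "P \<subseteq> {..<2 * j}" "P' \<subseteq> {..<2 * j}" using assms(2) by blast+
    thus "P = P'" using e double_diff[of _ "{..<2 * j}" "{..<2 * j}"] by (metis order_refl)
  qed
  have "?C \<subseteq> ?U"
  proof (rule image_subsetI)
    fix P assume "P \<in> B"
    hence "P \<subseteq> {..<2 * j}" "card P = j" using assms(2) by blast+
    thus "{..<2 * j} - P \<in> ?U" by (simp add: card_Diff_subset finite_subset)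
  qed
  moreover have "B \<inter> ?C = {}"
  proof (rule ccontr)
    assume "B \<inter> ?C \<noteq> {}"
    then obtain P where "P \<in> B" "{..<2 * j} - P \<in> B" by blast
    thus False using intersectingD[OF assms(3)] by blast
  qed
  ultimately have "card B + card ?C \<le> card ?U"
    using card_Un_disjoint[of B ?C] finB assms(2) card_mono[OF fin, of "B \<union> ?C"] by simp
  hence "2 * card B \<le> (2 * j) choose j"
    using card_image[OF inj] n_subsets[of "{..<2*j}" j] by simp
  also have "(2 * j) choose j = 2 * ((2 * j - 1) choose (j - 1))"
  proof -
    obtain i where i: "j = Suc i" using assms(1) by (cases j) auto
    have "(2 * i + 1) choose (Suc i) = (2 * i + 1) choose i"
      using binomial_symmetric[of i "2*i+1"] by simp
    thus ?thesis using i by simp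
  qed
  finally show ?thesis by simp
qed

text \<open>Frankl's induction: delete the largest element of the ground set.\<close>

lemma shifted_EKR:
  assumes "2 * j \<le> t" "j \<ge> 1" "B \<subseteq> {P. P \<subseteq> {..<t} \<and> card P = j}" "intersecting_family B" "shifted B"
  shows "card B \<le> (t - 1) choose (j - 1)"
  using assms
proof (induction t arbitrary: j B)
  case 0
  then show ?case by simp
next
  case (Suc t)
  show ?case
  proof (cases "2 * j = Suc t")
    case True
    then show ?thesis using card_intersecting_half[of j B] Suc.prems by simp
  next
    case False
    hence le: "2 * j \<le> t" using Suc.prems(1) by simp
    let ?B0 = "{P\<in>B. t \<notin> P}" and ?B1 = "{P\<in>B. t \<in> P}"
    let ?D = "(\<lambda>P. P - {t}) ` ?B1"
    have finP: "finite P" if "P \<in> B" for P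
      using that Suc.prems(3) finite_subset[of P "{..<Suc t}"] by auto
    have finB: "finite B"
      using Suc.prems(3) by (rule finite_subset) simp
    have cP: "card P = j" if "P \<in> B" for P using that Suc.prems(3) by blast
    have elt: "x \<le> t" if "P \<in> B" "x \<in> P" for P x
      using that Suc.prems(3) less_Suc_eq_le by blast
    have "card ?B0 \<le> (t - 1) choose (j - 1)"
    proof (rule Suc.IH[OF le Suc.prems(2)])
      show "?B0 \<subseteq> {P. P \<subseteq> {..<t} \<and> card P = j}"
        using cP elt by (auto simp: order_le_less)
      show "intersecting_family ?B0" using Suc.prems(4) by (auto simp: intersecting_family_def)
      show "shifted ?B0" using Suc.prems(5) elt unfolding shifted_def by (metis (no_types, lifting) DiffD1 insertE leD mem_Collect_eq)
    qed
    moreover have inj: "inj_on (\<lambda>P. P - {t}) ?B1"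
      by (intro inj_onI) blast
    hence "card ?B1 = card ?D" by (simp add: card_image)
    \<comment> \<open>\<open>j = 1\<close> is kept apart because the truncated \<open>j - 2\<close>
      would make the bound 1, whereas \<open>?D\<close> is then empty.\<close>
    moreover have "card ?D \<le> (if j = 1 then 0 else (t - 1) choose (j - 2))"
    proof -
      have sub: "?D \<subseteq> {P. P \<subseteq> {..<t} \<and> card P = j - 1}"
        using cP elt finP by (auto simp: order_le_less)
      have int: "intersecting_family ?D"
        unfolding intersecting_family_def
      proof clarsimp
        fix S T assume S: "S \<in> B" "t \<in> S" and T: "T \<in> B" "t \<in> T" and e: "(S - {t}) \<inter> (T - {t}) = {}"
        \<comment> \<open>Two members meeting only in \<open>t\<close> cover
          \<open>2 * j - 1\<close> points of the ground set, which is larger. Shifting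
          \<open>t\<close> in \<open>S\<close> to an uncovered point makes \<open>S\<close> disjoint
          from \<open>T\<close>.\<close>
        have "S \<inter> T = {t}" using e S T by blast
        hence "card (S \<union> T) = 2 * j - 1"
          using card_Un_Int[OF finP[OF S(1)] finP[OF T(1)]] cP S T by simp
        hence "card (S \<union> T) < card {..<Suc t}" using le Suc.prems(2) by simp
        then obtain x where x: "x \<in> {..<Suc t}" "x \<notin> S \<union> T"
          by (metis (no_types, lifting) card_mono finP S(1) T(1) finite_Un not_le subsetI)
        have "insert x (S - {t}) \<in> B"
          using shiftedD[OF Suc.prems(5) S, of x] x S by (cases "x = t") auto
        moreover have "insert x (S - {t}) \<inter> T = {}" using x e by blast
        ultimately show False using Suc.prems(4) T(1) by (auto dest: intersectingD)
      qed
      have sh: "shifted ?D"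
        unfolding shifted_def
      proof clarsimp
        fix S p q assume h: "S \<in> B" "t \<in> S" "p \<in> S" "p \<noteq> t" "q < p" "q \<in> S \<longrightarrow> q = t"
        have "p < t" using h elt[OF h(1,3)] by simp
        hence q: "q \<noteq> t" "q \<notin> S" using h by auto
        have "insert q (S - {p}) \<in> ?B1" using shiftedD[OF Suc.prems(5) h(1,3,5) q(2)] h by auto
        moreover have "insert q (S - {t} - {p}) = insert q (S - {p}) - {t}" using q by auto
        ultimately show "insert q (S - {t} - {p}) \<in> ?D" by blast
      qed
      show ?thesis
      proof (cases "j = 1")
        case True
        have "?D = {}"
        proof (rule ccontr)
          assume "?D \<noteq> {}"
          then obtain P where P: "P \<in> ?D" by blast
          hence "P \<subseteq> {..<t}" "card P = 0" using sub True by auto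
          hence "P = {}" using finite_subset[of P "{..<t}"] by simp
          thus False using intersectingD[OF int P P] by simp
        qed
        thus ?thesis by (simp only: card.empty)
      next
        case False
        have "card ?D \<le> (t - 1) choose (j - 1 - 1)"
          using Suc.IH[OF _ _ sub int sh] le False Suc.prems(2) by auto
        thus ?thesis using False by (simp add: numeral_2_eq_2)
      qed
    qed
    moreover have "card B = card ?B0 + card ?B1"
    proof -
      have "B = ?B0 \<union> ?B1" "?B0 \<inter> ?B1 = {}" by blast+
      thus ?thesis using card_Un_disjoint[of ?B0 ?B1] finB by simp
    qed
    moreover have "(t choose (j - 1)) = (t - 1 choose (j - 1)) + (if j = 1 then 0 else (t - 1) choose (j - 2))"
    proof -
      obtain s where s: "t = Suc s" using le Suc.prems(2) by (cases t) auto
      obtain i where i: "j = Suc i" using Suc.prems(2) by (cases j) auto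
      show ?thesis using s i by (cases i) auto
    qed
    ultimately show ?thesis by simp
  qed
qed

text \<open>Shifts are iterated, one element of \<open>Q'\<close> replacing one of \<open>Q\<close>
  each time. As all of \<open>Q'\<close> lies below all of \<open>Q\<close>, the remaining
  replacements stay legal.\<close>

lemma shifted_replace:
  assumes "shifted B" "finite Q" "P \<union> Q \<in> B" "P \<inter> Q = {}" "card Q' = card Q" "finite Q'"
    "\<forall>x\<in>Q'. \<forall>y\<in>Q. x < y" "P \<inter> Q' = {}"
  shows "P \<union> Q' \<in> B"
  using assms(2-)
proof (induction Q arbitrary: P Q' rule: finite_induct)
  case empty
  then show ?case by simp
next
  case (insert y Q)
  from insert have "card Q' \<noteq> 0" by simp
  then obtain x where x: "x \<in> Q'" by fastforce
  have ne: "x \<noteq> y" using insert.prems x by force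
  have xQ: "x \<notin> Q" using insert.prems x by force
  have "insert x ((P \<union> insert y Q) - {y}) \<in> B"
    using shiftedD[OF assms(1) insert.prems(1), of y x] insert.prems x xQ ne by auto
  also have "insert x ((P \<union> insert y Q) - {y}) = (insert x P) \<union> Q"
    using insert by auto
  finally have 1: "insert x P \<union> Q \<in> B" .
  have "insert x P \<union> (Q' - {x}) \<in> B"
    by (rule insert.IH[OF 1]) (use insert x xQ in auto)
  moreover have "insert x P \<union> (Q' - {x}) = P \<union> Q'" using x by blast
  ultimately show ?case by simp
qed

text \<open>The free part of such a set is a \<open>(j - 1)\<close>-subset of
  \<open>M - {x}\<close>. This turns the binomial bound for traces back into a number of actual
  \<open>r\<close>-sets, which can then be added over disjoint classes.\<close>

lemma card_star_subsets:
  assumes "finite R" "M \<subseteq> R" "0 < card M" "x \<in> M" "card M = r + j" "card R = 2 * r" "j \<ge> 1" "j \<le> r"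
  shows "card {S. S \<subseteq> R \<and> card S = r \<and> x \<in> S \<and> R - M \<subseteq> S} = (r + j - 1) choose (j - 1)"
proof -
  let ?P = "{P. P \<subseteq> M - {x} \<and> card P = j - 1}"
  have finM: "finite M" using assms by (auto intro: finite_subset)
  have cR: "card (R - M) = r - j"
    using assms finM by (simp add: card_Diff_subset)
  have "bij_betw (\<lambda>P. insert x P \<union> (R - M)) ?P {S. S \<subseteq> R \<and> card S = r \<and> x \<in> S \<and> R - M \<subseteq> S}"
  proof (rule bij_betwI[where g = "\<lambda>S. S \<inter> M - {x}"], goal_cases)
    case 1
    show ?case
    proof (rule Pi_I)
      fix P assume "P \<in> {P. P \<subseteq> M - {x} \<and> card P = j - 1}"
      hence P: "P \<subseteq> M - {x}" "card P = j - 1" by auto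
      have f: "finite P" using P finM by (auto intro: finite_subset)
      have "card (insert x P \<union> (R - M)) = card (insert x P) + card (R - M)"
        by (rule card_Un_disjoint) (use f P assms in auto)
      also have "card (insert x P) = j" using P f assms(7) by (subst card_insert_disjoint) auto
      finally have "card (insert x P \<union> (R - M)) = r" using cR assms by simp
      thus "insert x P \<union> (R - M) \<in> {S. S \<subseteq> R \<and> card S = r \<and> x \<in> S \<and> R - M \<subseteq> S}"
        using assms P by auto
    qed
  next
    case 2
    show ?case
    proof (rule Pi_I)
      fix S assume "S \<in> {S. S \<subseteq> R \<and> card S = r \<and> x \<in> S \<and> R - M \<subseteq> S}"
      hence S: "S \<subseteq> R" "x \<in> S" "R - M \<subseteq> S" "card S = r" by auto
      have f: "finite S" using S assms by (auto intro: finite_subset)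
      have "S = (S \<inter> M) \<union> (R - M)" using S by blast
      hence "card S = card (S \<inter> M) + card (R - M)"
        using card_Un_disjoint[of "S \<inter> M" "R - M"] f assms(1) by fastforce
      hence "card (S \<inter> M) = j" using cR S assms by simp
      thus "S \<inter> M - {x} \<in> {P. P \<subseteq> M - {x} \<and> card P = j - 1}"
        using S assms(4) by (auto simp: card_Diff_singleton_if)
    qed
  qed (use assms in auto)
  hence "card {S. S \<subseteq> R \<and> card S = r \<and> x \<in> S \<and> R - M \<subseteq> S} = card ?P"
    by (simp add: bij_betw_same_card)
  also have "\<dots> = (r + j - 1) choose (j - 1)"
    using n_subsets[of "M - {x}" "j - 1"] finM assms by simp
  finally show ?thesis .
qed

text \<open>All members of \<open>C\<close> contain \<open>R - {..<t}\<close>, so they are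
  determined by their traces on \<open>{..<t}\<close>. If the traces have \<open>j\<close> elements,
  counting gives \<open>t = r + j\<close>, hence \<open>2 * j \<le> t\<close>, and
  \<open>shifted_EKR\<close> applies to them.\<close>

lemma class_card_le:
  assumes B: "B \<subseteq> {S. card S = r}" "intersecting_family B" "shifted B"
    and R: "finite R" "card R = 2 * r" "{..<t} \<subseteq> R" "r \<ge> 1"
    and C: "C = {S\<in>B. S \<subseteq> R \<and> R - {..<t} \<subseteq> S}"
  shows "card C \<le> card {S. S \<subseteq> R \<and> card S = r \<and> 0 \<in> S \<and> R - {..<t} \<subseteq> S}"
proof (cases "C = {}")
  case False
  then obtain S0 where S0: "S0 \<in> B" "S0 \<subseteq> R" "R - {..<t} \<subseteq> S0" using C by blast
  let ?Q = "R - {..<t}"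
  define j where "j = r - card ?Q"
  have cQ: "card ?Q \<le> r" using card_mono[OF _ S0(3)] S0 B(1) R(1) by (auto intro: finite_subset)
  have "card R = t + card ?Q" using R by (metis card_Diff_subset card_lessThan card_mono finite_lessThan le_add_diff_inverse)
  hence t: "t = r + j" and cQ': "card ?Q = r - j" and jr: "j \<le> r" using R(2) cQ by (auto simp: j_def)
  \<comment> \<open>Disjoint traces leave exactly \<open>card ?Q\<close> points of
    \<open>{..<t}\<close> free. Shifting \<open>?Q\<close> into these points in the first member
    makes it disjoint from the second.\<close>
  have dis: "P \<inter> P' \<noteq> {}" if P: "P \<subseteq> {..<t}" "P' \<subseteq> {..<t}" "P \<union> ?Q \<in> B" "P' \<union> ?Q \<in> B" for P P'
  proof
    assume e: "P \<inter> P' = {}"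
    have fP: "finite P" "finite P'" using P finite_subset by auto
    have "card (P \<union> ?Q) = card P + card ?Q" "card (P' \<union> ?Q) = card P' + card ?Q"
      using P fP R(1) by (auto intro!: card_Un_disjoint)
    hence "card P = j" "card P' = j" using B(1) P cQ' jr by auto
    hence "card (P \<union> P') = 2 * j" using e fP by (simp add: card_Un_disjoint)
    hence "card ({..<t} - (P \<union> P')) = r - j"
      using t P fP by (subst card_Diff_subset) auto
    then obtain Q' where Q': "Q' = {..<t} - (P \<union> P')" "card Q' = card ?Q" using cQ' by simp
    have "P \<union> Q' \<in> B"
      by (rule shifted_replace[OF B(3) _ P(3)]) (use P Q' R(1) in auto)
    moreover have "(P \<union> Q') \<inter> (P' \<union> ?Q) = {}" using e P Q' by auto
    ultimately show False using intersectingD[OF B(2) _ P(4)] by blast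
  qed
  define D where "D = (\<lambda>S. S \<inter> {..<t}) ` C"
  have eq: "S = (S \<inter> {..<t}) \<union> ?Q" if "S \<in> C" for S using that C by blast
  have inj: "inj_on (\<lambda>S. S \<inter> {..<t}) C"
    by (rule inj_onI) (metis eq)
  have memD: "P \<in> D \<longleftrightarrow> P \<subseteq> {..<t} \<and> P \<union> ?Q \<in> B" for P
  proof
    assume "P \<in> D" 
    then obtain S where "S \<in> C" "P = S \<inter> {..<t}" unfolding D_def by blast
    thus "P \<subseteq> {..<t} \<and> P \<union> ?Q \<in> B" using eq[of S] C by auto
  next
    assume P: "P \<subseteq> {..<t} \<and> P \<union> ?Q \<in> B"
    hence "P \<union> ?Q \<in> C" using C R by auto
    moreover have "P = (P \<union> ?Q) \<inter> {..<t}" using P by auto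
    ultimately show "P \<in> D" unfolding D_def by blast
  qed
  have intD: "intersecting_family D" unfolding intersecting_family_def
    by (intro ballI dis) (simp_all only: memD)
  have S0D: "S0 \<inter> {..<t} \<in> D" using S0 C unfolding D_def by blast
  have subD: "D \<subseteq> {P. P \<subseteq> {..<t} \<and> card P = j}"
  proof
    fix P assume P: "P \<in> D"
    hence "card (P \<union> ?Q) = card P + card ?Q"
      using R(1) memD[of P] by (intro card_Un_disjoint) (auto intro: finite_subset)
    thus "P \<in> {P. P \<subseteq> {..<t} \<and> card P = j}" using P memD[of P] B(1) cQ' jr by auto
  qed
  have j: "j \<ge> 1"
  proof (rule ccontr)
    assume "\<not> j \<ge> 1"
    hence "card (S0 \<inter> {..<t}) = 0" using subsetD[OF subD S0D] by (simp add: not_le)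
    hence "S0 \<inter> {..<t} = {}" by simp
    thus False using intersectingD[OF intD S0D S0D] by simp
  qed
  have shD: "shifted D" unfolding shifted_def
  proof (intro ballI allI impI)
    fix P p q assume h: "P \<in> D" "p \<in> P" "q < p" "q \<notin> P"
    have pt: "p < t" using h memD by auto
    have "insert q ((P \<union> ?Q) - {p}) \<in> B"
      using shiftedD[OF B(3), of "P \<union> ?Q" p q] h memD[of P] pt by auto
    also have "insert q ((P \<union> ?Q) - {p}) = insert q (P - {p}) \<union> ?Q" using pt by auto
    finally show "insert q (P - {p}) \<in> D" using h memD pt by auto
  qed
  have "card C = card D" unfolding D_def by (rule card_image[OF inj, symmetric])
  also have "\<dots> \<le> (r + j - 1) choose (j - 1)"
    using shifted_EKR[OF _ j subD intD shD] t jr by simp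
  also have "\<dots> = card {S. S \<subseteq> R \<and> card S = r \<and> 0 \<in> S \<and> R - {..<t} \<subseteq> S}"
    by (rule card_star_subsets[symmetric]) (use R t j jr in auto)
  finally show ?thesis .
qed simp

text \<open>
  The members of \<open>B\<close> are grouped by the \<open>2 r\<close>-set \<open>{..<t} \<union> S\<close> with \<open>t\<close> as large as possible; in
  each group the Erdos-Ko-Rado bound for shifted families applies to the traces on \<open>{..<t}\<close>.
\<close>

lemma shifted_intersecting_card_le:
  assumes B: "B \<subseteq> {S. S \<subseteq> {..<n} \<and> card S = r}" "intersecting_family B" "shifted B"
    and G: "\<And>S T. S \<in> G \<Longrightarrow> T \<subseteq> S \<Longrightarrow> T \<in> G" "G \<subseteq> Pow {..<n}"
    and pure: "\<And>S t. S \<in> B \<Longrightarrow> t \<le> n \<Longrightarrow> card ({..<t} \<union> S) \<le> 2 * r \<Longrightarrow> {..<t} \<union> S \<in> G"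
    and r: "r \<ge> 1" "2 * r \<le> n"
  shows "card B \<le> card {S\<in>G. card S = r \<and> 0 \<in> S}"
proof -
  have finB: "finite B" using B(1) by (rule finite_subset) simp
  define mex :: "nat set \<Rightarrow> nat" where "mex R = (LEAST x. x \<notin> R)" for R
  have mex: "{..<mex R} \<subseteq> R" "mex R \<notin> R" if "finite R" for R
  proof -
    show "mex R \<notin> R" unfolding mex_def
      by (rule LeastI_ex) (rule ex_new_if_finite[OF infinite_UNIV_nat that])
    show "{..<mex R} \<subseteq> R" unfolding mex_def using not_less_Least by blast
  qed
  have key: "\<exists>R. finite R \<and> R \<subseteq> {..<n} \<and> card R = 2 * r \<and> S \<subseteq> R \<and> R - {..<mex R} \<subseteq> S \<and> R \<in> G"
    if S: "S \<in> B" for S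
  proof -
    have fS: "finite S" "S \<subseteq> {..<n}" "card S = r" using S B(1) finite_subset by auto
    let ?T = "{t. t \<le> n \<and> card ({..<t} \<union> S) \<le> 2 * r}"
    \<comment> \<open>Increasing \<open>t\<close> by one adds at most one element, so the largest
      admissible \<open>t\<close> gives cardinality exactly \<open>2 * r\<close> and is itself
      missing. It is thus recovered from \<open>?R\<close> as \<open>mex ?R\<close>.\<close>
    define t where "t = Max ?T"
    have "0 \<in> ?T" using fS by auto
    moreover have "finite ?T" by simp
    ultimately have t: "t \<in> ?T" and tm: "\<And>s. s \<in> ?T \<Longrightarrow> s \<le> t"
      unfolding t_def by (metis (no_types, lifting) Max_in empty_iff, metis (no_types, lifting) Max_ge)
    let ?R = "{..<t} \<union> S"
    have RG: "?R \<in> G" using pure[OF S] t by blast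
    have cR: "card ?R = 2 * r" and mx: "t = mex ?R"
    proof -
      have "card ?R = 2 * r \<and> t \<notin> ?R"
      proof (cases "t = n")
        case True
        hence "?R = {..<n}" using fS by auto
        thus ?thesis using t r fS True by auto
      next
        case False
        hence "Suc t \<le> n" using t by simp
        hence "card ({..<Suc t} \<union> S) > 2 * r" using tm[of "Suc t"] by (auto simp del: lessThan_Suc simp: not_le[symmetric])
        moreover have "{..<Suc t} \<union> S = insert t ?R" by auto
        ultimately have "card (insert t ?R) > 2 * r" by simp
        moreover have "card ?R \<le> 2 * r" using t by blast
        moreover have "finite ?R" using fS(1) by (rule finite_UnI[OF finite_lessThan])
        moreover from this have "card (insert t ?R) = (if t \<in> ?R then card ?R else Suc (card ?R))"
          by (rule card_insert_if)
        ultimately show ?thesis by (cases "t \<in> ?R") simp_all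
      qed
      moreover from this have "mex ?R = t" unfolding mex_def
        by (intro Least_equality) (simp, meson UnI1 leI lessThan_iff)
      ultimately show "card ?R = 2 * r" "t = mex ?R" by simp_all
    qed
    show ?thesis
    proof (intro exI[of _ ?R] conjI)
      show "?R \<subseteq> {..<n}" using fS(2) t by auto
      show "?R - {..<mex ?R} \<subseteq> S" unfolding mx[symmetric] by blast
    qed (use RG cR fS(1) in simp_all)
  qed
  define \<R> where "\<R> = {R. R \<in> G \<and> card R = 2 * r}"
  have finR: "finite R" if "R \<in> \<R>" for R using that G(2) finite_subset[of R "{..<n}"] unfolding \<R>_def by auto
  have fin\<R>: "finite \<R>" unfolding \<R>_def by (rule finite_subset[of _ "Pow {..<n}"]) (use G(2) in auto)
  define C where "C R = {S\<in>B. S \<subseteq> R \<and> R - {..<mex R} \<subseteq> S}" for R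
  define N where "N R = {S. S \<subseteq> R \<and> card S = r \<and> 0 \<in> S \<and> R - {..<mex R} \<subseteq> S}" for R
  have "B \<subseteq> (\<Union>R\<in>\<R>. C R)"
  proof
    fix S assume S: "S \<in> B"
    from key[OF S] obtain R where "R \<in> \<R>" "S \<subseteq> R" "R - {..<mex R} \<subseteq> S"
      unfolding \<R>_def by (elim exE conjE) simp
    thus "S \<in> (\<Union>R\<in>\<R>. C R)" using S unfolding C_def by (intro UN_I[of R]) simp_all
  qed
  hence "card B \<le> card (\<Union>R\<in>\<R>. C R)"
    using fin\<R> finB by (intro card_mono finite_UN_I) (auto simp: C_def)
  also have "\<dots> \<le> (\<Sum>R\<in>\<R>. card (C R))" by (rule card_UN_le[OF fin\<R>])
  also have "\<dots> \<le> (\<Sum>R\<in>\<R>. card (N R))"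
  proof (rule sum_mono)
    fix R assume R: "R \<in> \<R>"
    show "card (C R) \<le> card (N R)" unfolding N_def
      by (rule class_card_le[OF _ B(2,3) finR[OF R] _ mex(1)[OF finR[OF R]] r(1) C_def])
        (use R B(1) in \<open>auto simp: \<R>_def\<close>)
  qed
  also have "\<dots> = card (\<Union>R\<in>\<R>. N R)"
  proof (rule card_UN_disjoint[symmetric, OF fin\<R>])
    show "\<forall>R\<in>\<R>. finite (N R)" 
    proof
      fix R assume "R \<in> \<R>"
      hence "finite (Pow R)" using finR by simp
      thus "finite (N R)" by (rule rev_finite_subset) (auto simp: N_def)
    qed
    \<comment> \<open>A common member \<open>S\<close> gives
      \<open>R = {..<mex R} \<union> S\<close> and likewise for \<open>R'\<close>, so the two are
      nested; equal cardinality makes them equal.\<close>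
    show "\<forall>R\<in>\<R>. \<forall>R'\<in>\<R>. R \<noteq> R' \<longrightarrow> N R \<inter> N R' = {}"
    proof (intro ballI impI, rule ccontr)
      fix R R' assume h: "R \<in> \<R>" "R' \<in> \<R>" "R \<noteq> R'" "N R \<inter> N R' \<noteq> {}"
      then obtain S where S: "S \<in> N R" "S \<in> N R'" by blast
      have eq: "R = {..<mex R} \<union> S" "R' = {..<mex R'} \<union> S"
        using S mex(1)[OF finR[OF h(1)]] mex(1)[OF finR[OF h(2)]] unfolding N_def by blast+
      have "R \<subseteq> R' \<or> R' \<subseteq> R" 
        using eq Un_mono[of "{..<mex R}" "{..<mex R'}" S S] Un_mono[of "{..<mex R'}" "{..<mex R}" S S]
        by (cases "mex R \<le> mex R'") auto
      hence "R = R'"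
        using card_subset_eq[OF finR[OF h(1)], of R'] card_subset_eq[OF finR[OF h(2)], of R] h(1,2)
        unfolding \<R>_def by auto
      thus False using h by simp
    qed
  qed
  also have "\<dots> \<le> card {S\<in>G. card S = r \<and> 0 \<in> S}"
  proof (rule card_mono)
    show "finite {S\<in>G. card S = r \<and> 0 \<in> S}"
      by (rule finite_subset[of _ "Pow {..<n}"]) (use G(2) in auto)
    show "(\<Union>R\<in>\<R>. N R) \<subseteq> {S\<in>G. card S = r \<and> 0 \<in> S}"
      unfolding N_def \<R>_def by (auto intro: G(1))
  qed
  finally show ?thesis .
qed

section \<open>Exterior multiplication and contraction\<close>

lemma linear_vertex_order: "linear_order (vertex_order :: 'a rel)"
  unfolding vertex_order_def
proof (rule someI_ex)
  obtain r :: "'a rel" where "well_order_on UNIV r" using well_order_on by blast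
  thus "\<exists>r :: 'a rel. linear_order r" unfolding well_order_on_def by blast
qed

lemma vertex_order_total: "u \<noteq> v \<Longrightarrow> (u, v) \<in> vertex_order \<longleftrightarrow> (v, u) \<notin> vertex_order"
  using linear_vertex_order
  unfolding linear_order_on_def partial_order_on_def total_on_def antisym_def by (metis UNIV_I)

lemma incidence_sign_Un:
  assumes "finite S" "finite T" "S \<inter> T = {}"
  shows "incidence_sign v (S \<union> T) = (incidence_sign v S * incidence_sign v T :: 'f::field)"
proof -
  have "{u \<in> S \<union> T. u \<noteq> v \<and> (u, v) \<in> vertex_order} =
      {u \<in> S. u \<noteq> v \<and> (u, v) \<in> vertex_order} \<union> {u \<in> T. u \<noteq> v \<and> (u, v) \<in> vertex_order}" by auto
  moreover have "card \<dots> = card {u \<in> S. u \<noteq> v \<and> (u, v) \<in> vertex_order} + card {u \<in> T. u \<noteq> v \<and> (u, v) \<in> vertex_order}"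
    by (rule card_Un_disjoint) (use assms in auto)
  ultimately show ?thesis unfolding incidence_sign_def by (simp add: power_add)
qed

lemma incidence_sign_empty [simp]: "incidence_sign v {} = (1 :: 'f::field)"
  by (simp add: incidence_sign_def)

lemma incidence_sign_square [simp]: "incidence_sign v T * incidence_sign v T = (1 :: 'f::field)"
  by (simp add: incidence_sign_def flip: power_add mult_2)

lemma incidence_sign_square' [simp]:
  "incidence_sign v T * (incidence_sign v T * x) = (x :: 'f::field)"
  by (simp only: mult.assoc[symmetric] incidence_sign_square mult_1_left)

lemma incidence_sign_nonzero [simp]: "incidence_sign v T \<noteq> (0 :: 'f::field)"
  by (simp add: incidence_sign_def)

definition pair_sign :: "'a \<Rightarrow> 'a \<Rightarrow> 'f::field" where
  "pair_sign v w = incidence_sign v {w}"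

lemma incidence_sign_insert:
  assumes "finite T" "w \<notin> T"
  shows "incidence_sign v (insert w T) = (incidence_sign v T * pair_sign v w :: 'f::field)"
  using incidence_sign_Un[of T "{w}" v] assms by (simp add: pair_sign_def)

lemma pair_sign_swap:
  assumes "v \<noteq> w"
  shows "pair_sign v w = (- pair_sign w v :: 'f::field)"
proof -
  have eq: "{u \<in> {b}. u \<noteq> a \<and> (u, a) \<in> vertex_order} = (if (b, a) \<in> vertex_order then {b} else {})"
    if "a \<noteq> b" for a b :: 'a using that by auto
  show ?thesis using vertex_order_total[OF assms] assms
    unfolding pair_sign_def incidence_sign_def eq[OF assms] eq[OF assms[symmetric]] by simp
qed

text \<open>The sign that sorts \<open>A\<close> followed by \<open>B\<close>: a factor -1 for each
  pair whose element of \<open>B\<close> precedes that of \<open>A\<close>. It is the sign in the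
  exterior product.\<close>

definition join_sign :: "'a set \<Rightarrow> 'a set \<Rightarrow> 'f::field" where
  "join_sign A B = (\<Prod>a\<in>A. incidence_sign a B)"

definition wedge :: "('a set \<Rightarrow> 'f::field) \<Rightarrow> ('a set \<Rightarrow> 'f) \<Rightarrow> 'a set \<Rightarrow> 'f" where
  "wedge x y R = (\<Sum>S\<in>Pow R. join_sign S (R - S) * x S * y (R - S))"

text \<open>Chains are indexed by cardinality, so that degrees are natural numbers. Closure of
  \<open>C\<close> under subsets is not built in, because leading sets are also taken for a mere
  family of faces.\<close>

definition face_chains :: "'a set set \<Rightarrow> nat \<Rightarrow> ('a set \<Rightarrow> 'f::field) set" where
  "face_chains C p = {c. \<forall>S. c S \<noteq> 0 \<longrightarrow> S \<in> C \<and> card S = p}"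

definition basis_chain :: "'a set \<Rightarrow> 'a set \<Rightarrow> 'f::field" where
  "basis_chain \<sigma> = (\<lambda>S. if S = \<sigma> then 1 else 0)"

lemma chains_mono: "c \<in> face_chains C p \<Longrightarrow> C \<subseteq> Y \<Longrightarrow> c \<in> face_chains Y p"
  unfolding face_chains_def by blast

lemma chains_zero [simp]: "(\<lambda>_. 0) \<in> face_chains C p"
  unfolding face_chains_def by simp

lemma chains_add: "c \<in> face_chains C p \<Longrightarrow> d \<in> face_chains C p \<Longrightarrow> (\<lambda>S. c S + d S) \<in> face_chains C p"
  unfolding face_chains_def
proof clarsimp
  fix S assume h: "\<forall>S. c S \<noteq> 0 \<longrightarrow> S \<in> C \<and> card S = p" "\<forall>S. d S \<noteq> 0 \<longrightarrow> S \<in> C \<and> card S = p"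
    and "c S + d S \<noteq> 0"
  hence "c S \<noteq> 0 \<or> d S \<noteq> 0" by auto
  thus "S \<in> C \<and> card S = p" using h by blast
qed

lemma chains_scale: "c \<in> face_chains C p \<Longrightarrow> (\<lambda>S. a * c S) \<in> face_chains C p"
  unfolding face_chains_def by auto

lemma chains_uminus: "c \<in> face_chains C p \<Longrightarrow> (\<lambda>S. - c S) \<in> face_chains C p"
  unfolding face_chains_def by auto

lemma chains_diff: "c \<in> face_chains C p \<Longrightarrow> d \<in> face_chains C p \<Longrightarrow> (\<lambda>S. c S - d S) \<in> face_chains C p"
  using chains_add[of c C p "\<lambda>S. - d S"] chains_uminus[of d C p] by simp

lemma chains_sum: "(\<And>j. j \<in> J \<Longrightarrow> c j \<in> face_chains C p) \<Longrightarrow> (\<lambda>S. \<Sum>j\<in>J. a j * c j S) \<in> face_chains C p"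
  by (induction J rule: infinite_finite_induct) (auto intro!: chains_add chains_scale)

lemma basis_chain_chains: "\<sigma> \<in> C \<Longrightarrow> card \<sigma> = p \<Longrightarrow> basis_chain \<sigma> \<in> face_chains C p"
  unfolding face_chains_def basis_chain_def by auto

lemma chains_zeroI: "c \<in> face_chains C p \<Longrightarrow> (\<And>S. S \<in> C \<Longrightarrow> card S = p \<Longrightarrow> c S = 0) \<Longrightarrow> c = (\<lambda>_. 0)"
  unfolding face_chains_def by blast

text \<open>Here \<open>v\<close> stands to the right of \<open>S\<close>, whereas
  \<open>incidence_sign v S\<close> looks at the pairs from the side of \<open>v\<close>; reversing
  a pair costs -1 for every element of \<open>S\<close>.\<close>

lemma join_sign_insert_right:
  assumes "finite S" "finite T" "v \<notin> S" "v \<notin> T"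
  shows "join_sign S (insert v T) = (join_sign S T * ((-1) ^ card S * incidence_sign v S) :: 'f::field)"
proof -
  have "(\<Prod>a\<in>S. pair_sign a v) = ((-1) ^ card S * incidence_sign v S :: 'f)"
    using assms(1,3)
    by (induction S rule: finite_induct)
      (auto simp: incidence_sign_insert pair_sign_swap[of _ v])
  thus ?thesis unfolding join_sign_def using assms by (simp add: incidence_sign_insert prod.distrib)
qed

lemma join_sign_insert_left:
  assumes "finite S" "v \<notin> S"
  shows "join_sign (insert v S) T = (incidence_sign v T * join_sign S T :: 'f::field)"
  unfolding join_sign_def using assms by simp

lemma wedge_linear_right:
  "wedge x (\<lambda>S. \<Sum>j\<in>J. a j * y j S) R = (\<Sum>j\<in>J. a j * wedge x (y j) R)"
  unfolding wedge_def sum_distrib_left by (subst sum.swap) (simp add: mult_ac)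

lemma wedge_zero_right [simp]: "wedge x (\<lambda>_. 0) = (\<lambda>_. 0)"
  by (rule ext) (simp add: wedge_def)

lemma wedge_zero_left [simp]: "wedge (\<lambda>_. 0) x = (\<lambda>_. 0)"
  by (rule ext) (simp add: wedge_def)

lemma wedge_unit: "y \<in> face_chains (Pow V) p \<Longrightarrow> finite V \<Longrightarrow> wedge (\<lambda>S. if S = {} then a else 0) y = (\<lambda>R. a * y R)"
proof (rule ext)
  fix R assume y: "y \<in> face_chains (Pow V) p" "finite V"
  show "wedge (\<lambda>S. if S = {} then a else 0) y R = a * y R"
  proof (cases "finite R")
    case True
    have "wedge (\<lambda>S. if S = {} then a else 0) y R = (\<Sum>S\<in>Pow R. if S = {} then a * y R else 0)"
      unfolding wedge_def by (rule sum.cong) (auto simp: join_sign_def)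
    also have "\<dots> = a * y R" using True by (subst sum.delta) auto
    finally show ?thesis .
  next
    case False
    hence "y R = 0" using y unfolding face_chains_def by (auto dest: finite_subset)
    thus ?thesis using False by (simp add: wedge_def)
  qed
qed

lemma wedge_chains:
  assumes "x \<in> face_chains C p" "y \<in> face_chains Y q" "\<And>S T. S \<in> C \<Longrightarrow> T \<in> Y \<Longrightarrow> S \<union> T \<in> Z"
  shows "wedge x y \<in> face_chains Z (p + q)"
  unfolding face_chains_def
proof clarsimp
  fix R assume nz: "wedge x y R \<noteq> 0"
  hence fin: "finite R" unfolding wedge_def by (metis finite_Pow_iff sum.infinite)
  from nz obtain S where S: "S \<subseteq> R" "x S \<noteq> 0" "y (R - S) \<noteq> 0"
    unfolding wedge_def by (metis (no_types, lifting) PowD mult_eq_0_iff sum.neutral)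
  have "S \<union> (R - S) = R" using S by blast
  moreover have "card R = card S + card (R - S)"
    using S fin by (metis card_Diff_subset card_mono finite_subset le_add_diff_inverse)
  ultimately show "R \<in> Z \<and> card R = p + q" using S(2,3) assms(1,2) assms(3)[of S "R - S"] unfolding face_chains_def by fastforce
qed

section \<open>Contraction of chains by linear forms\<close>

locale vertex_set =
  fixes V :: "'a set"
  assumes finite_V: "finite V"
begin

definition ctr :: "('a \<Rightarrow> 'f::field) \<Rightarrow> ('a set \<Rightarrow> 'f) \<Rightarrow> 'a set \<Rightarrow> 'f" where
  "ctr f c T = (if T \<subseteq> V then \<Sum>v\<in>V - T. incidence_sign v T * f v * c (insert v T) else 0)"

primrec ctrs :: "(nat \<Rightarrow> 'a \<Rightarrow> 'f::field) \<Rightarrow> nat list \<Rightarrow> ('a set \<Rightarrow> 'f) \<Rightarrow> 'a set \<Rightarrow> 'f" where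
  "ctrs \<theta> [] c = c"
| "ctrs \<theta> (x # xs) c = ctrs \<theta> xs (ctr (\<theta> x) c)"

lemma ctr_sum: "ctr f (\<lambda>S. \<Sum>j\<in>J. a j * c j S) = (\<lambda>S. \<Sum>j\<in>J. a j * ctr f (c j) S)"
proof (rule ext)
  fix S
  show "ctr f (\<lambda>S. \<Sum>j\<in>J. a j * c j S) S = (\<Sum>j\<in>J. a j * ctr f (c j) S)"
    unfolding ctr_def by (auto simp: sum_distrib_left mult_ac intro: sum.swap)
qed

lemma ctr_diff: "ctr f (\<lambda>S. c S - d S) = (\<lambda>S. ctr f c S - ctr f d S)"
  unfolding ctr_def by (auto simp: right_diff_distrib sum_subtractf fun_eq_iff)

lemma ctr_scale: "ctr f (\<lambda>S. a * c S) = (\<lambda>S. a * ctr f c S)"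
  unfolding ctr_def by (auto simp: sum_distrib_left mult_ac fun_eq_iff)

lemma ctr_zero [simp]: "ctr f (\<lambda>_. 0) = (\<lambda>_. 0)"
  unfolding ctr_def by auto

lemma ctr_form: "ctr (\<lambda>v. f v + t * g v) c S = ctr f c S + t * ctr g c S"
  unfolding ctr_def by (auto simp: distrib_left distrib_right sum.distrib sum_distrib_left mult_ac)

lemma ctr_anticommute: "ctr f (ctr g c) = (\<lambda>S. - ctr g (ctr f c) S)"
proof (rule ext)
  fix T
  show "ctr f (ctr g c) T = - ctr g (ctr f c) T"
  proof (cases "T \<subseteq> V")
    case True
    have fT: "finite T" using True finite_V finite_subset by blast
    have e: "ctr f (ctr g c) T = (\<Sum>v\<in>V - T. \<Sum>w\<in>V - T. if v = w then 0 else
        incidence_sign v T * f v * (incidence_sign w T * pair_sign w v) * g w * c (insert v (insert w T)))"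
      for f g :: "'a \<Rightarrow> 'b" and c
    proof -
      have "ctr f (ctr g c) T = (\<Sum>v\<in>V - T. \<Sum>w\<in>V - insert v T. 
        incidence_sign v T * f v * (incidence_sign w T * pair_sign w v) * g w * c (insert v (insert w T)))"
        using True fT by (simp add: ctr_def sum_distrib_left incidence_sign_insert mult_ac insert_commute)
      also have "\<dots> = (\<Sum>v\<in>V - T. \<Sum>w\<in>V - T. if v = w then 0 else
        incidence_sign v T * f v * (incidence_sign w T * pair_sign w v) * g w * c (insert v (insert w T)))"
        by (intro sum.cong sum.mono_neutral_cong_left) (use finite_V in auto)
      finally show ?thesis .
    qed
    show ?thesis unfolding e sum_negf[symmetric]
    proof (subst sum.swap, intro sum.cong refl, goal_cases)
      case (1 w v)
      show ?case using pair_sign_swap[of w v, where 'f = 'b]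
        by (cases "v = w") (simp_all add: insert_commute mult_ac)
    qed
  qed (simp add: ctr_def)
qed

text \<open>Anticommutation only yields that twice this chain vanishes, which says nothing in
  characteristic 2. So the terms are cancelled directly, \<open>(v, w)\<close> against
  \<open>(w, v)\<close>, with the vertex order selecting one pair of each kind.\<close>

lemma ctr_ctr_self [simp]: "ctr f (ctr f c) = (\<lambda>_. 0)"
proof (rule ext)
  fix T
  show "ctr f (ctr f c) T = 0"
  proof (cases "T \<subseteq> V")
    case True
    have fT: "finite T" using True finite_V finite_subset by blast
    define h where "h = (\<lambda>(v, w). incidence_sign v T * f v * (incidence_sign w T * pair_sign w v) * f w * c (insert v (insert w T)))"
    define P where "P = (SIGMA v:V - T. V - insert v T)"
    have fP: "finite P" unfolding P_def using finite_V by simp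
    have "ctr f (ctr f c) T = sum h P"
      using True fT finite_V
      by (simp add: ctr_def sum_distrib_left incidence_sign_insert mult_ac insert_commute sum.Sigma h_def P_def)
    also have "\<dots> = sum h {p \<in> P. p \<in> vertex_order} + sum h {p \<in> P. p \<notin> vertex_order}"
      using fP by (subst sum.union_disjoint[symmetric]) (auto intro!: sum.cong)
    finally have eq: "ctr f (ctr f c) T = sum h {p \<in> P. p \<in> vertex_order} + sum h {p \<in> P. p \<notin> vertex_order}" .
    have sw: "prod.swap p \<in> P \<and> (prod.swap p \<in> vertex_order \<longleftrightarrow> p \<notin> vertex_order)" if "p \<in> P" for p
      using that vertex_order_total[of "snd p" "fst p"] unfolding P_def by auto
    have "sum h {p \<in> P. p \<notin> vertex_order} = (\<Sum>p\<in>{p \<in> P. p \<in> vertex_order}. - h p)"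
    proof (rule sum.reindex_bij_witness[of _ prod.swap prod.swap])
      fix p assume "p \<in> {p \<in> P. p \<notin> vertex_order}"
      then obtain v w where "p = (v, w)" "v \<noteq> w" unfolding P_def by auto
      thus "- h (prod.swap p) = h p" 
        using pair_sign_swap[of w v, where 'f = 'b] unfolding h_def by (simp add: insert_commute mult_ac)
    qed (use sw in auto)
    thus ?thesis unfolding eq by (simp add: sum_negf)
  qed (simp add: ctr_def)
qed

lemma ctr_chains:
  assumes "c \<in> face_chains C (Suc p)" "\<And>S T. S \<in> C \<Longrightarrow> T \<subseteq> S \<Longrightarrow> T \<in> C"
  shows "ctr f c \<in> face_chains C p"
  unfolding face_chains_def
proof clarsimp
  fix T assume nz: "ctr f c T \<noteq> 0"
  hence T: "T \<subseteq> V" by (cases "T \<subseteq> V") (simp_all add: ctr_def)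
  hence "(\<Sum>v\<in>V - T. incidence_sign v T * f v * c (insert v T)) \<noteq> 0" using nz by (simp add: ctr_def)
  then obtain v where v: "v \<in> V - T" "c (insert v T) \<noteq> 0"
    by (rule sum.not_neutral_contains_not_neutral) simp
  have "finite T" using T finite_V finite_subset by blast
  thus "T \<in> C \<and> card T = p" using v assms unfolding face_chains_def by fastforce
qed

lemma ctr_chains_0:
  assumes "c \<in> face_chains C 0" "C \<subseteq> Pow V"
  shows "ctr f c = (\<lambda>_. 0)"
proof -
  have "c (insert v T) = 0" for v T
  proof (rule ccontr)
    assume "c (insert v T) \<noteq> 0"
    hence "insert v T \<subseteq> V" "card (insert v T) = 0" using assms unfolding face_chains_def by auto
    thus False using finite_V finite_subset[of "insert v T" V] by auto
  qed
  thus ?thesis by (auto simp: ctr_def)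
qed

text \<open>The graded Leibniz rule. Expanding the right side also produces terms with
  \<open>v\<close> in \<open>T\<close>, where \<open>v\<close> occurs in both factors;
  \<open>cancel\<close> matches those of one summand with those of the other by moving
  \<open>v\<close> into \<open>S\<close>.\<close>

lemma ctr_wedge:
  assumes x: "x \<in> face_chains (Pow V) p" and y: "y \<in> face_chains (Pow V) q"
  shows "ctr f (wedge x y) = (\<lambda>T. wedge (ctr f x) y T + (-1) ^ p * wedge x (ctr f y) T)"
proof (rule ext)
  fix T
  show "ctr f (wedge x y) T = wedge (ctr f x) y T + (-1) ^ p * wedge x (ctr f y) T"
  proof (cases "T \<subseteq> V")
    case False
    have z: "z S = 0" if "z \<in> face_chains (Pow V) i" "\<not> S \<subseteq> V" for z :: "'a set \<Rightarrow> 'b" and S i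
      using that unfolding face_chains_def by auto
    have cz: "ctr f z S = 0" if "\<not> S \<subseteq> V" for z S using that unfolding ctr_def by auto
    have "\<not> S \<subseteq> V \<or> \<not> T - S \<subseteq> V" for S using False by blast
    hence "wedge (ctr f x) y T = 0" "wedge x (ctr f y) T = 0"
      unfolding wedge_def using z[OF x] z[OF y] cz by (intro sum.neutral; metis mult_zero_left mult_zero_right)+
    thus ?thesis using cz[OF False] by simp
  next
    case True
    have fT: "finite T" using True finite_V finite_subset by blast
    have fS: "finite S" if "S \<subseteq> T" for S using that fT finite_subset by blast
    define A where "A = (\<lambda>S v. join_sign S (T - S) * (incidence_sign v S * f v * x (insert v S)) * y (T - S))"
    define B where "B = (\<lambda>S v. (-1) ^ p * (join_sign S (T - S) * x S * (incidence_sign v (T - S) * f v * y (insert v (T - S)))))"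
    have "wedge (ctr f x) y T = (\<Sum>S\<in>Pow T. \<Sum>v\<in>V - S. A S v)"
      unfolding wedge_def A_def
    proof (rule sum.cong[OF refl])
      fix S assume "S \<in> Pow T"
      hence "S \<subseteq> V" using True by blast
      thus "join_sign S (T - S) * ctr f x S * y (T - S) = (\<Sum>v\<in>V - S. join_sign S (T - S) * (incidence_sign v S * f v * x (insert v S)) * y (T - S))"
        by (simp add: ctr_def sum_distrib_left sum_distrib_right)
    qed
    also have "\<dots> = (\<Sum>S\<in>Pow T. \<Sum>v\<in>V - T. A S v) + (\<Sum>S\<in>Pow T. \<Sum>v\<in>T - S. A S v)"
      unfolding sum.distrib[symmetric]
    proof (rule sum.cong[OF refl])
      fix S assume "S \<in> Pow T"
      hence "V - S = (V - T) \<union> (T - S)" using True by blast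
      thus "sum (A S) (V - S) = sum (A S) (V - T) + sum (A S) (T - S)"
        using finite_V fT by (simp add: sum.union_disjoint Int_Diff disjoint_iff)
    qed
    finally have 1: "wedge (ctr f x) y T = \<dots>" .
    have "(-1) ^ p * wedge x (ctr f y) T = (\<Sum>S\<in>Pow T. \<Sum>v\<in>V - (T - S). B S v)"
      unfolding wedge_def B_def sum_distrib_left
    proof (rule sum.cong[OF refl])
      fix S assume "S \<in> Pow T"
      hence "T - S \<subseteq> V" using True by blast
      thus "(-1) ^ p * (join_sign S (T - S) * x S * ctr f y (T - S)) = (\<Sum>v\<in>V - (T - S). (-1) ^ p * (join_sign S (T - S) * x S * (incidence_sign v (T - S) * f v * y (insert v (T - S)))))"
        by (simp add: ctr_def sum_distrib_left)
    qed
    also have "\<dots> = (\<Sum>S\<in>Pow T. \<Sum>v\<in>V - T. B S v) + (\<Sum>S\<in>Pow T. \<Sum>v\<in>S. B S v)"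
      unfolding sum.distrib[symmetric]
    proof (rule sum.cong[OF refl])
      fix S assume S: "S \<in> Pow T"
      hence "V - (T - S) = (V - T) \<union> S" using True by blast
      moreover have "(V - T) \<inter> S = {}" using S by blast
      ultimately show "sum (B S) (V - (T - S)) = sum (B S) (V - T) + sum (B S) S"
        using finite_V fS S by (simp add: sum.union_disjoint)
    qed
    finally have 2: "(-1) ^ p * wedge x (ctr f y) T = \<dots>" .
    have cancel: "(\<Sum>S\<in>Pow T. \<Sum>v\<in>T - S. A S v) = - (\<Sum>S\<in>Pow T. \<Sum>v\<in>S. B S v)"
    proof -
      have "(\<Sum>(S, v)\<in>(SIGMA S:Pow T. T - S). A S v) = (\<Sum>(S, v)\<in>(SIGMA S:Pow T. S). - B S v)"
      proof (rule sum.reindex_bij_witness[of _ "\<lambda>(S, v). (S - {v}, v)" "\<lambda>(S, v). (insert v S, v)"])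
        fix a assume a: "a \<in> (SIGMA S:Pow T. T - S)"
        obtain S v where Sv: "a = (S, v)" "S \<subseteq> T" "v \<in> T" "v \<notin> S" using a by auto
        let ?Q = "T - insert v S"
        have Q: "T - S = insert v ?Q" "v \<notin> ?Q" "finite ?Q" using Sv fT by auto
        have px: "x (insert v S) = 0 \<or> p = Suc (card S)" using x Sv fS unfolding face_chains_def by force
        show "(case case a of (S, v) \<Rightarrow> (insert v S, v) of (S, v) \<Rightarrow> - B S v) = (case a of (S, v) \<Rightarrow> A S v)"
          using px
        proof
          assume "p = Suc (card S)"
          moreover have "A S v = join_sign S ?Q * ((-1) ^ card S * incidence_sign v S) *
              (incidence_sign v S * f v * x (insert v S)) * y (insert v ?Q)"
            unfolding A_def Q(1) join_sign_insert_right[OF fS[OF Sv(2)] Q(3) Sv(4) Q(2)] ..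
          moreover have "B (insert v S) v = (-1) ^ p * (incidence_sign v ?Q * join_sign S ?Q * x (insert v S) *
              (incidence_sign v ?Q * f v * y (insert v ?Q)))"
            unfolding B_def join_sign_insert_left[OF fS[OF Sv(2)] Sv(4)] ..
          ultimately show ?thesis unfolding Sv(1) by (simp add: mult_ac)
        qed (simp add: Sv(1) A_def B_def)
      qed auto
      moreover have "(\<Sum>S\<in>Pow T. \<Sum>v\<in>T - S. A S v) = (\<Sum>(S, v)\<in>(SIGMA S:Pow T. T - S). A S v)"
        by (rule sum.Sigma) (use fT in auto)
      moreover have "(\<Sum>S\<in>Pow T. \<Sum>v\<in>S. - B S v) = (\<Sum>(S, v)\<in>(SIGMA S:Pow T. S). - B S v)"
        by (rule sum.Sigma) (use fT fS in auto)
      ultimately show ?thesis by (simp only: sum_negf)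
    qed
    have "ctr f (wedge x y) T = (\<Sum>v\<in>V - T. \<Sum>S\<in>Pow T. A S v + B S v)"
      unfolding ctr_def using True
    proof (simp, intro sum.cong[OF refl])
      fix v assume v: "v \<in> V - T"
      have "wedge x y (insert v T) = (\<Sum>S\<in>Pow T. join_sign S (insert v T - S) * x S * y (insert v T - S)) +
          (\<Sum>S\<in>Pow T. join_sign (insert v S) (insert v T - insert v S) * x (insert v S) * y (insert v T - insert v S))"
      proof -
        have "inj_on (insert v) (Pow T)" using v by (intro inj_onI) (metis DiffD2 PowD insert_ident subsetD)
        moreover have "Pow T \<inter> insert v ` Pow T = {}" using v by auto
        ultimately show ?thesis unfolding wedge_def Pow_insert using fT
          by (simp only: sum.union_disjoint finite_Pow_iff finite_imageI sum.reindex comp_def)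
      qed
      moreover have "incidence_sign v T * f v * (join_sign S (insert v T - S) * x S * y (insert v T - S)) = B S v"
        if S: "S \<in> Pow T" for S
      proof -
        have e: "insert v T - S = insert v (T - S)" "v \<notin> T - S" "v \<notin> S" "finite (T - S)" "finite S"
          using v S fT fS by auto
        have "T = S \<union> (T - S)" using S by blast
        hence sg: "incidence_sign v T = (incidence_sign v S * incidence_sign v (T - S) :: 'b)"
          using incidence_sign_Un[OF e(5,4), of v] by (metis Diff_disjoint)
        have px: "x S = 0 \<or> p = card S" using x unfolding face_chains_def by force
        show ?thesis unfolding B_def e(1) sg join_sign_insert_right[OF e(5,4,3,2)] using px by (auto simp: mult_ac)
      qed
      moreover have "incidence_sign v T * f v * (join_sign (insert v S) (insert v T - insert v S) * x (insert v S) * y (insert v T - insert v S)) = A S v"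
        if S: "S \<in> Pow T" for S
      proof -
        have e: "insert v T - insert v S = T - S" "v \<notin> S" "finite (T - S)" "finite S"
          using v S fT fS by auto
        have "T = S \<union> (T - S)" using S by blast
        hence sg: "incidence_sign v T = (incidence_sign v S * incidence_sign v (T - S) :: 'b)"
          using incidence_sign_Un[OF e(4,3), of v] by (metis Diff_disjoint)
        show ?thesis unfolding A_def e(1) sg join_sign_insert_left[OF e(4,2)] by (simp add: mult_ac)
      qed
      ultimately show "incidence_sign v T * f v * wedge x y (insert v T) = (\<Sum>S\<in>Pow T. A S v + B S v)"
        by (simp add: distrib_left sum_distrib_left sum.distrib)
    qed
    also have "\<dots> = (\<Sum>S\<in>Pow T. \<Sum>v\<in>V - T. A S v) + (\<Sum>S\<in>Pow T. \<Sum>v\<in>V - T. B S v)"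
      by (subst sum.swap) (simp add: sum.distrib)
    also have "\<dots> = wedge (ctr f x) y T + (-1) ^ p * wedge x (ctr f y) T"
      unfolding 1 2 cancel by simp
    finally show ?thesis .
  qed
qed

section \<open>Iterated contractions and coordinates\<close>

text \<open>A definition cannot quantify over index types. Sums over sets of vertices suffice to
  exchange \<open>L\<close> with the boundary \<open>bd\<close>.\<close>

definition linear_map :: "(('a set \<Rightarrow> 'f::field) \<Rightarrow> 'a set \<Rightarrow> 'f) \<Rightarrow> bool" where
  "linear_map L \<longleftrightarrow> (\<forall>(J :: 'a set) a c.
     L (\<lambda>S. \<Sum>j\<in>J. a j * c j S) = (\<lambda>S. \<Sum>j\<in>J. a j * L (c j) S))"

lemma linear_map_ctr: "linear_map (ctr f)"
  unfolding linear_map_def by (simp add: ctr_sum)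

lemma ctrs_sum: "ctrs \<theta> xs (\<lambda>S. \<Sum>j\<in>J. a j * c j S) = (\<lambda>S. \<Sum>j\<in>J. a j * ctrs \<theta> xs (c j) S)"
  by (induction xs arbitrary: c) (simp_all add: ctr_sum)

lemma linear_map_ctrs: "linear_map (ctrs \<theta> xs)"
  unfolding linear_map_def by (simp add: ctrs_sum)

lemma ctrs_zero [simp]: "ctrs \<theta> xs (\<lambda>_. 0) = (\<lambda>_. 0)"
  by (induction xs) simp_all

lemma ctrs_scale: "ctrs \<theta> xs (\<lambda>S. a * c S) = (\<lambda>S. a * ctrs \<theta> xs c S)"
  by (induction xs arbitrary: c) (simp_all add: ctr_scale)

lemma ctrs_append: "ctrs \<theta> (xs @ ys) c = ctrs \<theta> ys (ctrs \<theta> xs c)"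
  by (induction xs arbitrary: c) simp_all

lemma ctrs_ctr: "ctrs \<theta> xs (ctr f c) = (\<lambda>S. (-1) ^ length xs * ctr f (ctrs \<theta> xs c) S)"
proof (induction xs arbitrary: c)
  case (Cons x xs)
  have "ctr (\<theta> x) (ctr f c) = (\<lambda>S. (-1) * ctr f (ctr (\<theta> x) c) S)"
    by (subst ctr_anticommute) simp
  thus ?case by (simp only: ctrs.simps ctrs_scale Cons.IH) simp
qed simp

lemma ctrs_chains:
  assumes "c \<in> face_chains C (p + length xs)" "\<And>S T. S \<in> C \<Longrightarrow> T \<subseteq> S \<Longrightarrow> T \<in> C"
  shows "ctrs \<theta> xs c \<in> face_chains C p"
  using assms(1)
proof (induction xs arbitrary: c)
  case (Cons x xs)
  hence "ctr (\<theta> x) c \<in> face_chains C (p + length xs)" by (intro ctr_chains[OF _ assms(2)]) auto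
  thus ?case using Cons.IH by simp
qed simp

lemma ctrs_ctr_mem: "x \<in> set xs \<Longrightarrow> ctrs \<theta> xs (ctr (\<theta> x) c) = (\<lambda>_. 0)"
proof (induction xs arbitrary: c)
  case (Cons y xs)
  show ?case
  proof (cases "x = y")
    case False
    hence "x \<in> set xs" using Cons.prems by simp
    moreover have "ctr (\<theta> y) (ctr (\<theta> x) c) = (\<lambda>S. (-1) * ctr (\<theta> x) (ctr (\<theta> y) c) S)"
      by (subst ctr_anticommute) simp
    ultimately show ?thesis by (simp only: ctrs.simps ctrs_scale Cons.IH) simp
  qed simp
qed simp

lemma ctr_ctrs_mem: "x \<in> set xs \<Longrightarrow> ctr (\<theta> x) (ctrs \<theta> xs c) = (\<lambda>_. 0)"
  using ctrs_ctr_mem[of x xs \<theta> c] unfolding ctrs_ctr by (simp add: fun_eq_iff)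

lemma ctrs_move_to_front:
  "\<exists>e\<in>{1, -1}. \<forall>c. ctrs \<theta> (ys @ x # zs) c = (\<lambda>S. e * ctrs \<theta> (x # ys @ zs) c S)"
proof (rule bexI[of _ "(-1) ^ length ys"])
  have "((-1) ^ length ys * (-1) ^ length ys :: 'b) = 1" by (simp flip: power_add mult_2)
  thus "\<forall>c. ctrs \<theta> (ys @ x # zs) c = (\<lambda>S. (-1) ^ length ys * ctrs \<theta> (x # ys @ zs) c S)"
    by (simp only: ctrs_append append.simps ctrs.simps ctrs_ctr[where xs = ys] ctrs_scale)
      (simp add: mult.assoc[symmetric])
  show "(-1) ^ length ys \<in> {1, -1 :: 'b}" by (cases "even (length ys)") simp_all
qed

text \<open>One sign serves all chains, so reordering the contractions respects linear relations
  between chains. Its value is left open because later arguments only ask what vanishes.\<close>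

lemma ctrs_perm:
  assumes "distinct xs" "distinct ys" "set xs = set ys"
  shows "\<exists>e\<in>{1, -1}. \<forall>c. ctrs \<theta> xs c = (\<lambda>S. e * ctrs \<theta> ys c S)"
  using assms
proof (induction xs arbitrary: ys)
  case Nil
  then show ?case by (auto intro!: bexI[of _ 1])
next
  case (Cons x xs)
  then obtain us vs where ys: "ys = us @ x # vs" by (metis in_set_conv_decomp list.set_intros(1))
  hence "set xs = set (us @ vs)" "distinct xs" "distinct (us @ vs)" using Cons.prems by auto
  then obtain e where e: "e \<in> {1, -1}" "\<And>c. ctrs \<theta> xs c = (\<lambda>S. e * ctrs \<theta> (us @ vs) c S)"
    using Cons.IH[of "us @ vs"] by blast
  obtain e' where e': "e' \<in> {1, -1}" "\<And>c. ctrs \<theta> ys c = (\<lambda>S. e' * ctrs \<theta> (x # us @ vs) c S)"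
    using ctrs_move_to_front[of \<theta> us x vs] unfolding ys by blast
  have "e' * e' = 1" using e'(1) by auto
  hence "ctrs \<theta> (x # xs) c = (\<lambda>S. (e * e') * ctrs \<theta> ys c S)" for c
    unfolding e'(2) ctrs.simps e(2) by (simp add: mult.assoc) (simp flip: mult.assoc)
  moreover have "e * e' \<in> {1, -1}" using e(1) e'(1) by auto
  ultimately show ?case by blast
qed

text \<open>If the forms indexed by \<open>{..<card V}\<close> are a basis of the dual space, these
  are, up to sign, the coefficients of \<open>c\<close> in the basis of the exterior algebra dual to
  their products. Sorting fixes one sign for each set.\<close>

definition crd :: "(nat \<Rightarrow> 'a \<Rightarrow> 'f::field) \<Rightarrow> nat set \<Rightarrow> ('a set \<Rightarrow> 'f) \<Rightarrow> 'f" where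
  "crd \<theta> S c = ctrs \<theta> (sorted_list_of_set S) c {}"

lemma crd_insert:
  assumes "finite S" "x \<notin> S"
  shows "\<exists>e\<in>{1, -1}. \<forall>c. crd \<theta> (insert x S) c = e * crd \<theta> S (ctr (\<theta> x) c)"
proof -
  define l where "l = sorted_list_of_set (insert x S)"
  have "distinct (sorted_list_of_set T) \<and> set (sorted_list_of_set T) = T" if "finite T" for T :: "nat set"
    using that by simp
  hence l: "distinct l" "set l = insert x S" using assms unfolding l_def by (meson finite_insert)+
  have r: "distinct (x # sorted_list_of_set S)" "set (x # sorted_list_of_set S) = insert x S"
    using assms by simp_all
  obtain e where e: "e \<in> {1, -1}" "\<forall>c. ctrs \<theta> l c = (\<lambda>T. e * ctrs \<theta> (x # sorted_list_of_set S) c T)"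
    using ctrs_perm[OF l(1) r(1), of \<theta>] l(2) r(2) by metis
  show ?thesis
  proof (rule bexI[OF _ e(1)], rule allI)
    fix c
    show "crd \<theta> (insert x S) c = e * crd \<theta> S (ctr (\<theta> x) c)"
      unfolding crd_def l_def[symmetric] by (simp only: e(2) ctrs.simps)
  qed
qed

lemma crd_ctr_mem: "finite S \<Longrightarrow> x \<in> S \<Longrightarrow> crd \<theta> S (ctr (\<theta> x) c) = 0"
  unfolding crd_def by (simp add: ctrs_ctr_mem)

lemma crd_ctrs_perm:
  assumes "distinct xs"
  shows "\<exists>e\<in>{1, -1}. \<forall>c. crd \<theta> (set xs) c = e * ctrs \<theta> xs c {}"
  using ctrs_perm[of "sorted_list_of_set (set xs)" xs \<theta>] assms unfolding crd_def by fastforce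

lemma crd_ctrs:
  assumes "finite S" "distinct xs" "S \<inter> set xs = {}"
  shows "\<exists>e\<in>{1, -1}. \<forall>c. crd \<theta> (S \<union> set xs) c = e * crd \<theta> S (ctrs \<theta> xs c)"
proof -
  let ?ys = "xs @ sorted_list_of_set S"
  have "distinct ?ys" "set ?ys = S \<union> set xs" using assms by auto
  thus ?thesis using crd_ctrs_perm[of ?ys \<theta>] by (simp add: ctrs_append crd_def)
qed

lemma crd_sum: "crd \<theta> S (\<lambda>T. \<Sum>j\<in>J. a j * c j T) = (\<Sum>j\<in>J. a j * crd \<theta> S (c j))"
  unfolding crd_def ctrs_sum ..

lemma crd_zero [simp]: "crd \<theta> S (\<lambda>_. 0) = 0"
  unfolding crd_def by simp

text \<open>
  Up to sign, \<open>ctrs \<theta> [0..<j] (basis_chain \<sigma>) {}\<close> is the minor of the first \<open>j\<close> forms on the columns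
  in \<open>\<sigma>\<close>.
\<close>

definition general :: "(nat \<Rightarrow> 'a \<Rightarrow> 'f::field) \<Rightarrow> bool" where
  "general \<theta> \<longleftrightarrow> (\<forall>\<sigma>\<subseteq>V. ctrs \<theta> [0..<card \<sigma>] (basis_chain \<sigma>) {} \<noteq> 0)"

lemma unit_chainI:
  assumes "c \<in> face_chains (Pow V) 0"
  shows "c = (\<lambda>S. if S = {} then c {} else 0)"
proof (rule ext)
  fix S
  show "c S = (if S = {} then c {} else 0)"
    using assms finite_subset[OF _ finite_V, of S] unfolding face_chains_def by (cases "c S = 0") auto
qed

section \<open>Dual vectors and sections of contractions\<close>

text \<open>Cramer's rule: contracting the simplex on \<open>b + 1\<close> vertices of
  \<open>\<sigma>\<close> by the first \<open>b\<close> forms gives a vector that they all kill and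
  on which \<open>\<theta> b\<close> takes a minor as value. Generality makes this minor nonzero, so
  one can divide by it.\<close>

lemma exists_dual_vectors:
  assumes \<theta>: "general \<theta>" and \<sigma>: "\<sigma> \<subseteq> V" "b < card \<sigma>"
  shows "\<exists>u\<in>face_chains (Pow \<sigma>) 1. (\<forall>a<b. ctr (\<theta> a) u = (\<lambda>_. 0)) \<and>
    ctr (\<theta> b) u = (\<lambda>S. if S = {} then 1 else 0)"
proof -
  obtain \<tau> where \<tau>: "\<tau> \<subseteq> \<sigma>" "card \<tau> = Suc b"
    using obtain_subset_with_card_n[of "Suc b" \<sigma>] \<sigma>(2) by (metis Suc_leI)
  define u where "u = ctrs \<theta> [0..<b] (basis_chain \<tau>)"
  define k where "k = ctr (\<theta> b) u {}"
  have "ctrs \<theta> [0..<card \<tau>] (basis_chain \<tau>) {} = k"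
    unfolding \<tau>(2) k_def u_def by (simp add: ctrs_append)
  hence k: "k \<noteq> 0" using \<theta> \<tau> \<sigma> unfolding general_def by (metis subset_trans)
  have u: "u \<in> face_chains (Pow \<sigma>) 1" unfolding u_def
    by (rule ctrs_chains) (use \<tau> in \<open>auto intro!: basis_chain_chains\<close>)
  have "ctr (\<theta> b) u \<in> face_chains (Pow \<sigma>) 0"
    by (rule ctr_chains) (use u in auto)
  hence "ctr (\<theta> b) u \<in> face_chains (Pow V) 0" by (rule chains_mono) (use \<sigma> in auto)
  hence ku: "ctr (\<theta> b) u = (\<lambda>S. if S = {} then k else 0)"
    unfolding k_def by (rule unit_chainI)
  show ?thesis
  proof (rule bexI[of _ "\<lambda>S. (1 / k) * u S"], intro conjI allI impI)
    show "ctr (\<theta> a) (\<lambda>S. 1 / k * u S) = (\<lambda>_. 0)" if "a < b" for a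
    proof -
      have "ctr (\<theta> a) u = (\<lambda>_. 0)" unfolding u_def by (rule ctr_ctrs_mem) (use that in simp)
      thus ?thesis unfolding ctr_scale by simp
    qed
    show "ctr (\<theta> b) (\<lambda>S. 1 / k * u S) = (\<lambda>S. if S = {} then 1 else 0)"
      unfolding ctr_scale ku using k by auto
    show "(\<lambda>S. 1 / k * u S) \<in> face_chains (Pow \<sigma>) 1" by (rule chains_scale[OF u])
  qed
qed

lemma foldr_wedge_chains:
  assumes "\<And>b. b \<in> set bs \<Longrightarrow> U b \<in> face_chains (Pow \<sigma>) 1" "c \<in> face_chains C s"
  shows "foldr (\<lambda>b. wedge (U b)) bs c \<in> face_chains {S \<union> T |S T. S \<subseteq> \<sigma> \<and> T \<in> C} (s + length bs)"
  using assms(1)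
proof (induction bs)
  case Nil
  show ?case by (simp, rule chains_mono[OF assms(2)]) blast
next
  case (Cons b bs)
  have "wedge (U b) (foldr (\<lambda>b. wedge (U b)) bs c)
      \<in> face_chains {S \<union> T |S T. S \<subseteq> \<sigma> \<and> T \<in> C} (1 + (s + length bs))"
  proof (rule wedge_chains)
    fix S R assume "S \<in> Pow \<sigma>" "R \<in> {S \<union> T |S T. S \<subseteq> \<sigma> \<and> T \<in> C}"
    then obtain S' T where "S \<subseteq> \<sigma>" "R = S' \<union> T" "S' \<subseteq> \<sigma>" "T \<in> C" by blast
    thus "S \<union> R \<in> {S \<union> T |S T. S \<subseteq> \<sigma> \<and> T \<in> C}"
      by (intro CollectI exI[of _ "S \<union> S'"] exI[of _ T]) auto
  qed (use Cons in auto)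
  thus ?case by simp
qed

text \<open>The vectors are dual only in the triangular sense, so the order matters. Contracting by
  the smallest form first strips off its own vector; the other Leibniz term vanishes since that form
  kills all later vectors and \<open>c\<close>.\<close>

lemma ctrs_foldr_wedge:
  assumes U: "\<And>b. b \<in> set bs \<Longrightarrow> U b \<in> face_chains (Pow V) 1"
    and less: "\<And>a b. b \<in> set bs \<Longrightarrow> a < b \<Longrightarrow> ctr (\<theta> a) (U b) = (\<lambda>_. 0)"
    and eq: "\<And>b. b \<in> set bs \<Longrightarrow> ctr (\<theta> b) (U b) = (\<lambda>S. if S = {} then 1 else 0)"
    and bs: "sorted_wrt (<) bs" and c: "c \<in> face_chains (Pow V) s" "\<And>b. b \<in> set bs \<Longrightarrow> ctr (\<theta> b) c = (\<lambda>_. 0)"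
  shows "ctrs \<theta> bs (foldr (\<lambda>b. wedge (U b)) bs c) = c \<and>
    (\<forall>a. ctr (\<theta> a) c = (\<lambda>_. 0) \<longrightarrow> (\<forall>b\<in>set bs. a < b) \<longrightarrow>
      ctr (\<theta> a) (foldr (\<lambda>b. wedge (U b)) bs c) = (\<lambda>_. 0))"
  using assms(1-4) c(2)
proof (induction bs)
  case (Cons b bs)
  let ?x = "foldr (\<lambda>b. wedge (U b)) bs c"
  have IH: "ctrs \<theta> bs ?x = c" "\<And>a. ctr (\<theta> a) c = (\<lambda>_. 0) \<Longrightarrow> \<forall>b\<in>set bs. a < b \<Longrightarrow> ctr (\<theta> a) ?x = (\<lambda>_. 0)"
    using Cons by auto
  have "?x \<in> face_chains {S \<union> T |S T. S \<subseteq> V \<and> T \<in> Pow V} (s + length bs)"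
    by (rule foldr_wedge_chains) (use Cons.prems(1) c in auto)
  hence x: "?x \<in> face_chains (Pow V) (s + length bs)" by (rule chains_mono) auto
  have Ub: "U b \<in> face_chains (Pow V) 1" using Cons.prems(1) by simp
  have "ctr (\<theta> a) (wedge (U b) ?x) = (\<lambda>_. 0)" if "ctr (\<theta> a) c = (\<lambda>_. 0)" "\<forall>b\<in>set (b # bs). a < b" for a
    unfolding ctr_wedge[OF Ub x] using IH(2)[OF that(1)] that(2) Cons.prems(2)[of b a] by simp
  moreover have "ctr (\<theta> b) (wedge (U b) ?x) = ?x"
    unfolding ctr_wedge[OF Ub x] using IH(2)[of b] Cons.prems(3)[of b] Cons.prems(4,5) wedge_unit[OF x finite_V, of 1] by simp
  ultimately show ?case using IH(1) by simp
qed simp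

text \<open>
  In the star of a face with at least \<open>i\<close> vertices, contraction by \<open>i\<close> general forms has a linear
  section: multiplication by vectors of that face which are dual to the forms.
\<close>

lemma exists_section:
  fixes \<theta> :: "nat \<Rightarrow> 'a \<Rightarrow> 'f::field"
  assumes \<theta>: "general \<theta>" and \<sigma>: "\<sigma> \<subseteq> V" "i \<le> card \<sigma>"
  shows "\<exists>L. linear_map L \<and>
    (\<forall>C D s. \<forall>c\<in>face_chains C s. (\<forall>S\<subseteq>\<sigma>. \<forall>T\<in>C. S \<union> T \<in> D) \<longrightarrow> L c \<in> face_chains D (s + i)) \<and>
    (\<forall>s. \<forall>c\<in>face_chains (Pow V) s. (\<forall>a<i. ctr (\<theta> a) c = (\<lambda>_. 0)) \<longrightarrow> ctrs \<theta> [0..<i] (L c) = c)"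
proof -
  have "\<forall>b. \<exists>u. b < i \<longrightarrow> u \<in> face_chains (Pow \<sigma>) 1 \<and> (\<forall>a<b. ctr (\<theta> a) u = (\<lambda>_. 0)) \<and>
      ctr (\<theta> b) u = (\<lambda>S. if S = {} then 1 else 0)"
    using exists_dual_vectors[OF \<theta> \<sigma>(1)] \<sigma>(2) less_le_trans by blast
  then obtain U where U: "\<And>b. b < i \<Longrightarrow> U b \<in> face_chains (Pow \<sigma>) 1"
    "\<And>a b. b < i \<Longrightarrow> a < b \<Longrightarrow> ctr (\<theta> a) (U b) = (\<lambda>_. 0)"
    "\<And>b. b < i \<Longrightarrow> ctr (\<theta> b) (U b) = (\<lambda>S. if S = {} then 1 else 0)" by metis
  have UV: "U b \<in> face_chains (Pow V) 1" if "b < i" for b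
    using chains_mono[OF U(1)[OF that], of "Pow V"] \<sigma>(1) by blast
  define L where "L = foldr (\<lambda>b. wedge (U b)) [0..<i]"
  show ?thesis
  proof (intro exI[of _ L] conjI allI ballI impI)
    have "foldr (\<lambda>b. wedge (U b)) bs (\<lambda>S. \<Sum>j\<in>J. a j * c j S) =
        (\<lambda>S. \<Sum>j\<in>J. a j * foldr (\<lambda>b. wedge (U b)) bs (c j) S)" for bs and J :: "'a set" and a c
    proof (induction bs)
      case (Cons b bs)
      show ?case by (simp add: Cons.IH) (rule ext, rule wedge_linear_right)
    qed simp
    thus "linear_map L" unfolding L_def linear_map_def by blast
  next
    fix C D s and c :: "'a set \<Rightarrow> 'f" assume c: "c \<in> face_chains C s" and D: "\<forall>S\<subseteq>\<sigma>. \<forall>T\<in>C. S \<union> T \<in> D"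
    have "L c \<in> face_chains {S \<union> T |S T. S \<subseteq> \<sigma> \<and> T \<in> C} (s + length [0..<i])"
      unfolding L_def by (rule foldr_wedge_chains[OF U(1) c]) simp
    moreover have "{S \<union> T |S T. S \<subseteq> \<sigma> \<and> T \<in> C} \<subseteq> D" using D by blast
    ultimately have "L c \<in> face_chains D (s + length [0..<i])" by (rule chains_mono)
    thus "L c \<in> face_chains D (s + i)" by simp
  next
    fix c :: "'a set \<Rightarrow> 'f" and s assume c: "c \<in> face_chains (Pow V) s" "\<forall>a<i. ctr (\<theta> a) c = (\<lambda>_. 0)"
    have "ctrs \<theta> [0..<i] (L c) = c \<and>
      (\<forall>a. ctr (\<theta> a) c = (\<lambda>_. 0) \<longrightarrow> (\<forall>b\<in>set [0..<i]. a < b) \<longrightarrow> ctr (\<theta> a) (L c) = (\<lambda>_. 0))"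
      unfolding L_def
    proof (rule ctrs_foldr_wedge)
      show "sorted_wrt (<) [0..<i]" by (rule sorted_wrt_upt)
      show "c \<in> face_chains (Pow V) s" by (rule c)
    qed (use UV U(2,3) c(2) in simp_all)
    thus "ctrs \<theta> [0..<i] (L c) = c" ..
  qed
qed

text \<open>The section over the full simplex lifts \<open>c\<close> to sets with more than
  \<open>card V\<close> vertices. The lift is therefore zero, and \<open>c\<close> is its
  contraction.\<close>

lemma ctr_all_zero:
  assumes \<theta>: "general \<theta>" and c: "c \<in> face_chains (Pow V) (Suc p)" "\<forall>a<card V. ctr (\<theta> a) c = (\<lambda>_. 0)"
  shows "c = (\<lambda>_. 0)"
proof -
  obtain L where L: "\<forall>C D s. \<forall>c\<in>face_chains C s. (\<forall>S\<subseteq>V. \<forall>T\<in>C. S \<union> T \<in> D) \<longrightarrow> L c \<in> face_chains D (s + card V)"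
    "\<forall>s. \<forall>c\<in>face_chains (Pow V) s. (\<forall>a<card V. ctr (\<theta> a) c = (\<lambda>_. 0)) \<longrightarrow> ctrs \<theta> [0..<card V] (L c) = c"
    using exists_section[OF \<theta> order_refl order_refl] by blast
  have "L c \<in> face_chains (Pow V) (Suc p + card V)" by (rule L(1)[rule_format, OF c(1)]) auto
  hence "L c = (\<lambda>_. 0)"
  proof (rule chains_zeroI)
    fix S assume "S \<in> Pow V" "card S = Suc p + card V"
    thus "L c S = 0" using card_mono[OF finite_V, of S] by simp
  qed
  thus ?thesis using L(2)[rule_format, OF c(1)] c(2) by simp
qed

text \<open>Each coordinate of \<open>ctr (\<theta> a) c\<close> is zero or, up to sign, a
  coordinate of \<open>c\<close> one degree higher. By induction all contractions of
  \<open>c\<close> vanish, and \<open>ctr_all_zero\<close> applies.\<close>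

lemma crd_eq_0_imp_zero:
  assumes \<theta>: "general \<theta>"
  shows "c \<in> face_chains (Pow V) p \<Longrightarrow> (\<And>S. S \<subseteq> {..<card V} \<Longrightarrow> card S = p \<Longrightarrow> crd \<theta> S c = 0) \<Longrightarrow> c = (\<lambda>_. 0)"
proof (induction p arbitrary: c)
  case 0
  have "c {} = 0" using "0.prems"(2)[of "{}"] by (simp add: crd_def)
  thus ?case using unit_chainI[OF "0.prems"(1)] by (metis (full_types))
next
  case (Suc p)
  show ?case
  proof (rule ctr_all_zero[OF \<theta> Suc.prems(1)], intro allI impI)
    fix a assume a: "a < card V"
    show "ctr (\<theta> a) c = (\<lambda>_. 0)"
    proof (rule Suc.IH)
      show "ctr (\<theta> a) c \<in> face_chains (Pow V) p" by (rule ctr_chains[OF Suc.prems(1)]) auto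
      fix S :: "nat set" assume S: "S \<subseteq> {..<card V}" "card S = p"
      have fS: "finite S" using S finite_subset by blast
      show "crd \<theta> S (ctr (\<theta> a) c) = 0"
      proof (cases "a \<in> S")
        case False
        obtain e where "e \<in> {1, -1}" "crd \<theta> (insert a S) c = e * crd \<theta> S (ctr (\<theta> a) c)"
          using crd_insert[OF fS False, of \<theta>] by blast
        moreover have "crd \<theta> (insert a S) c = 0"
          by (rule Suc.prems(2)) (use S a fS False in auto)
        ultimately show ?thesis by auto
      qed (simp add: crd_ctr_mem fS)
    qed
  qed
qed

section \<open>Lifting along general contractions in Cohen-Macaulay complexes\<close>

text \<open>
  A bichain of type \<open>(k, s)\<close> relative to \<open>\<sigma>\<close> assigns to each face \<open>\<rho>\<close> of the link of \<open>\<sigma>\<close> with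
  \<open>k\<close> vertices a chain of \<open>s\<close>-sets in the star of \<open>\<rho> \<union> \<sigma>\<close>. Simplicial boundary acts on \<open>\<rho>\<close>, the
  general forms act on the values.
\<close>

definition bichains :: "'a set set \<Rightarrow> 'a set \<Rightarrow> nat \<Rightarrow> nat \<Rightarrow> ('a set \<Rightarrow> 'a set \<Rightarrow> 'f::field) set" where
  "bichains \<Gamma> \<sigma> k s =
     {w. \<forall>\<rho> \<tau>. w \<rho> \<tau> \<noteq> 0 \<longrightarrow> \<rho> \<inter> \<sigma> = {} \<and> \<rho> \<union> \<sigma> \<union> \<tau> \<in> \<Gamma> \<and> card \<rho> = k \<and> card \<tau> = s}"

definition bd :: "('a set \<Rightarrow> 'a set \<Rightarrow> 'f::field) \<Rightarrow> 'a set \<Rightarrow> 'a set \<Rightarrow> 'f" where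
  "bd w = (\<lambda>\<rho> \<tau>. ctr (\<lambda>_. 1) (\<lambda>\<rho>. w \<rho> \<tau>) \<rho>)"

lemma linear_map_zero: "linear_map L \<Longrightarrow> L (\<lambda>_. 0) = (\<lambda>_. 0)"
  using linear_map_def[THEN iffD1, rule_format, of L "\<lambda>_. 0" "\<lambda>_ _. 0" "{}"] by simp

lemma linear_map_bd:
  assumes "linear_map L"
  shows "L (bd w \<rho>) = bd (\<lambda>\<rho>. L (w \<rho>)) \<rho>"
proof (cases "\<rho> \<subseteq> V")
  case True
  have "bd w \<rho> = (\<lambda>\<tau>. \<Sum>v\<in>V - \<rho>. incidence_sign v \<rho> * w (insert v \<rho>) \<tau>)" for w :: "'a set \<Rightarrow> 'a set \<Rightarrow> 'b"
    using True by (simp add: bd_def ctr_def)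
  thus ?thesis using assms unfolding linear_map_def by simp
next
  case False
  hence "bd w \<rho> = (\<lambda>_. 0)" for w :: "'a set \<Rightarrow> 'a set \<Rightarrow> 'b"
    by (simp add: bd_def ctr_def)
  thus ?thesis using linear_map_zero[OF assms] by simp
qed

lemma bd_bd: "bd (bd w) = (\<lambda>_ _. 0)"
  unfolding bd_def by simp

lemma bichains_D:
  assumes "w \<in> bichains \<Gamma> \<sigma> k s"
  shows "w \<rho> \<in> face_chains {\<tau>. \<rho> \<union> \<sigma> \<union> \<tau> \<in> \<Gamma>} s"
    and "(\<lambda>\<rho>. w \<rho> \<tau>) \<in> face_chains {\<rho>. \<rho> \<inter> \<sigma> = {} \<and> \<rho> \<union> \<sigma> \<union> \<tau> \<in> \<Gamma>} k"
    and "\<rho> \<inter> \<sigma> \<noteq> {} \<or> card \<rho> \<noteq> k \<Longrightarrow> w \<rho> = (\<lambda>_. 0)"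
    and "card \<tau> \<noteq> s \<Longrightarrow> w \<rho> \<tau> = 0"
proof -
  have h: "w \<rho> \<tau> \<noteq> 0 \<Longrightarrow> \<rho> \<inter> \<sigma> = {} \<and> \<rho> \<union> \<sigma> \<union> \<tau> \<in> \<Gamma> \<and> card \<rho> = k \<and> card \<tau> = s" for \<rho> \<tau>
    using assms unfolding bichains_def by blast
  show "w \<rho> \<in> face_chains {\<tau>. \<rho> \<union> \<sigma> \<union> \<tau> \<in> \<Gamma>} s"
    and "(\<lambda>\<rho>. w \<rho> \<tau>) \<in> face_chains {\<rho>. \<rho> \<inter> \<sigma> = {} \<and> \<rho> \<union> \<sigma> \<union> \<tau> \<in> \<Gamma>} k"
    and "card \<tau> \<noteq> s \<Longrightarrow> w \<rho> \<tau> = 0"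
    using h unfolding face_chains_def by blast+
  show "w \<rho> = (\<lambda>_. 0)" if "\<rho> \<inter> \<sigma> \<noteq> {} \<or> card \<rho> \<noteq> k"
    by (rule ext) (use h that in blast)
qed

lemma bichainsI:
  assumes "\<And>\<rho>. \<rho> \<inter> \<sigma> = {} \<Longrightarrow> card \<rho> = k \<Longrightarrow> w \<rho> \<in> face_chains {\<tau>. \<rho> \<union> \<sigma> \<union> \<tau> \<in> \<Gamma>} s"
    "\<And>\<rho>. \<rho> \<inter> \<sigma> \<noteq> {} \<or> card \<rho> \<noteq> k \<Longrightarrow> w \<rho> = (\<lambda>_. 0)"
  shows "w \<in> bichains \<Gamma> \<sigma> k s"
  unfolding bichains_def
proof (intro CollectI allI impI)
  fix \<rho> \<tau> assume nz: "w \<rho> \<tau> \<noteq> 0"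
  hence "\<rho> \<inter> \<sigma> = {}" "card \<rho> = k" using assms(2)[of \<rho>] by metis+
  thus "\<rho> \<inter> \<sigma> = {} \<and> \<rho> \<union> \<sigma> \<union> \<tau> \<in> \<Gamma> \<and> card \<rho> = k \<and> card \<tau> = s"
    using assms(1)[of \<rho>] nz unfolding face_chains_def by auto
qed

lemma bichains_map:
  assumes w: "w \<in> bichains \<Gamma> \<sigma> k s"
    and L: "\<And>\<rho> c. c \<in> face_chains {\<tau>. \<rho> \<union> \<sigma> \<union> \<tau> \<in> \<Gamma>} s \<Longrightarrow> L c \<in> face_chains {\<tau>. \<rho> \<union> \<sigma> \<union> \<tau> \<in> \<Gamma>} s'"
    and L0: "L (\<lambda>_. 0) = (\<lambda>_. 0)"
  shows "(\<lambda>\<rho>. L (w \<rho>)) \<in> bichains \<Gamma> \<sigma> k s'"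
  by (rule bichainsI) (simp_all add: L bichains_D[OF w] L0)

lemma bd_bichains:
  assumes "w \<in> bichains \<Gamma> \<sigma> (Suc k) s" "\<And>S T. S \<in> \<Gamma> \<Longrightarrow> T \<subseteq> S \<Longrightarrow> T \<in> \<Gamma>"
  shows "bd w \<in> bichains \<Gamma> \<sigma> k s"
  unfolding bichains_def
proof (intro CollectI allI impI)
  fix \<rho> \<tau> assume nz: "bd w \<rho> \<tau> \<noteq> 0"
  have "ctr (\<lambda>_. 1) (\<lambda>\<rho>. w \<rho> \<tau>) \<in> face_chains {\<rho>. \<rho> \<inter> \<sigma> = {} \<and> \<rho> \<union> \<sigma> \<union> \<tau> \<in> \<Gamma>} k"
  proof (rule ctr_chains[OF bichains_D(2)[OF assms(1)]], elim CollectE conjE, intro CollectI conjI)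
    fix S T assume ST: "S \<inter> \<sigma> = {}" "S \<union> \<sigma> \<union> \<tau> \<in> \<Gamma>" "T \<subseteq> S"
    show "T \<inter> \<sigma> = {}" using ST by blast
    show "T \<union> \<sigma> \<union> \<tau> \<in> \<Gamma>" by (rule assms(2)[OF ST(2)]) (use ST in blast)
  qed
  moreover have "card \<tau> = s" 
  proof (rule ccontr)
    assume "card \<tau> \<noteq> s"
    hence "(\<lambda>\<rho>. w \<rho> \<tau>) = (\<lambda>_. 0)" using bichains_D(4)[OF assms(1)] by auto
    thus False using nz by (simp add: bd_def)
  qed
  ultimately show "\<rho> \<inter> \<sigma> = {} \<and> \<rho> \<union> \<sigma> \<union> \<tau> \<in> \<Gamma> \<and> card \<rho> = k \<and> card \<tau> = s"
    using nz unfolding bd_def face_chains_def by blast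
qed

lemma bichains_diff:
  assumes "w \<in> bichains \<Gamma> \<sigma> k s" "w' \<in> bichains \<Gamma> \<sigma> k s"
  shows "(\<lambda>\<rho> \<tau>. w \<rho> \<tau> - w' \<rho> \<tau>) \<in> bichains \<Gamma> \<sigma> k s"
  by (rule bichainsI) (simp_all add: bichains_D[OF assms(1)] bichains_D[OF assms(2)] chains_diff)

text \<open>Adding \<open>x\<close> contracts a complex that is closed under inserting \<open>x\<close>.\<close>

lemma cone_exact:
  fixes z :: "'a set \<Rightarrow> 'f::field"
  assumes z: "z \<in> face_chains C k" "ctr (\<lambda>_. 1) z = (\<lambda>_. 0)"
    and C: "C \<subseteq> Pow V" "\<And>S. S \<in> C \<Longrightarrow> insert x S \<in> C" "x \<in> V"
  shows "\<exists>b\<in>face_chains C (Suc k). ctr (\<lambda>_. 1) b = z"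
proof (rule bexI)
  let ?e = "basis_chain {x} :: 'a set \<Rightarrow> 'f"
  have e: "?e \<in> face_chains (Pow V) 1" using C(3) by (intro basis_chain_chains) auto
  have z': "z \<in> face_chains (Pow V) k" by (rule chains_mono[OF z(1) C(1)])
  have e0: "ctr (\<lambda>_. 1) ?e \<in> face_chains (Pow V) 0" using e by (intro ctr_chains) auto
  have "ctr (\<lambda>_. 1) ?e {} = (\<Sum>v\<in>V. if v = x then 1 else 0 :: 'f)"
    unfolding ctr_def basis_chain_def by (auto intro!: sum.cong)
  hence e1: "ctr (\<lambda>_. 1) ?e {} = (1 :: 'f)" using C(3) finite_V by simp
  have "ctr (\<lambda>_. 1) ?e = (\<lambda>S. if S = {} then 1 else 0 :: 'f)"
    by (rule unit_chainI[OF e0, unfolded e1])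
  thus "ctr (\<lambda>_. 1) (wedge ?e z) = z"
    unfolding ctr_wedge[OF e z'] z(2) using wedge_unit[OF z' finite_V, of 1] by simp
  have "wedge ?e z \<in> face_chains C (1 + k)"
    by (rule wedge_chains[OF basis_chain_chains[of _ "{{x}}"] z(1)]) (use C(2) in auto)
  thus "wedge ?e z \<in> face_chains C (Suc k)" by simp
qed

text \<open>Vanishing homology of links, stated by cardinalities. If all facets of
  \<open>\<Gamma>\<close> have \<open>m\<close> vertices, those of the link of
  \<open>\<sigma>\<close> have \<open>m - card \<sigma>\<close>, and the inequality selects the
  degrees below the dimension of the link.\<close>

definition exact_links :: "'f::field itself \<Rightarrow> 'a set set \<Rightarrow> nat \<Rightarrow> bool" where
  "exact_links F \<Gamma> m \<longleftrightarrow> (\<forall>\<sigma>\<in>\<Gamma>. \<forall>k. \<forall>z\<in>face_chains (face_link \<Gamma> \<sigma>) k. Suc k + card \<sigma> \<le> m \<longrightarrow>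
     ctr (\<lambda>_. 1 :: 'f) z = (\<lambda>_. 0) \<longrightarrow> (\<exists>b\<in>face_chains (face_link \<Gamma> \<sigma>) (Suc k). ctr (\<lambda>_. 1) b = z))"

text \<open>For each \<open>\<tau>\<close> this is exactness of an ordinary complex of sets
  \<open>\<rho>\<close>. If \<open>\<tau> \<subseteq> \<sigma>\<close>, that complex is the link of
  \<open>\<sigma>\<close>. Otherwise a vertex of \<open>\<tau>\<close> outside
  \<open>\<sigma>\<close> can be added to every \<open>\<rho>\<close>, so the complex is a cone,
  acyclic in every degree.\<close>

lemma bd_exact:
  fixes d :: "'a set \<Rightarrow> 'a set \<Rightarrow> 'f::field"
  assumes ex: "exact_links TYPE('f) \<Gamma> m"
    and \<Gamma>: "\<Gamma> \<subseteq> Pow V" "\<And>S T. S \<in> \<Gamma> \<Longrightarrow> T \<subseteq> S \<Longrightarrow> T \<in> \<Gamma>" "\<sigma> \<in> \<Gamma>"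
    and d: "d \<in> bichains \<Gamma> \<sigma> k s" "bd d = (\<lambda>_ _. 0)" and m: "s \<le> card \<sigma> \<Longrightarrow> Suc k + card \<sigma> \<le> m"
  shows "\<exists>b\<in>bichains \<Gamma> \<sigma> (Suc k) s. bd b = d"
proof -
  have "\<exists>b. b \<in> face_chains {\<rho>. \<rho> \<inter> \<sigma> = {} \<and> \<rho> \<union> \<sigma> \<union> \<tau> \<in> \<Gamma>} (Suc k) \<and> ctr (\<lambda>_. 1) b = (\<lambda>\<rho>. d \<rho> \<tau>) \<and>
      (card \<tau> \<noteq> s \<longrightarrow> b = (\<lambda>_. 0))" for \<tau>
  proof (cases "card \<tau> = s")
    case False
    hence "(\<lambda>\<rho>. d \<rho> \<tau>) = (\<lambda>_. 0)" using bichains_D(4)[OF d(1)] by auto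
    thus ?thesis by (intro exI[of _ "\<lambda>_. 0"]) simp
  next
    case True
    let ?C = "{\<rho>. \<rho> \<inter> \<sigma> = {} \<and> \<rho> \<union> \<sigma> \<union> \<tau> \<in> \<Gamma>}"
    have dt: "(\<lambda>\<rho>. d \<rho> \<tau>) \<in> face_chains ?C k" by (rule bichains_D(2)[OF d(1)])
    have d0: "ctr (\<lambda>_. 1) (\<lambda>\<rho>. d \<rho> \<tau>) = (\<lambda>_. 0)" using d(2) unfolding bd_def by (metis (no_types))
    have CV: "?C \<subseteq> Pow V" using \<Gamma>(1) by blast
    have "\<exists>b\<in>face_chains ?C (Suc k). ctr (\<lambda>_. 1) b = (\<lambda>\<rho>. d \<rho> \<tau>)"
    proof (cases "\<tau> \<subseteq> \<sigma>")
      case True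
      hence C: "?C = face_link \<Gamma> \<sigma>" unfolding face_link_def by (auto simp: Un_absorb2 sup_assoc)
      have "finite \<sigma>" using \<Gamma>(1,3) finite_V finite_subset by blast
      hence "s \<le> card \<sigma>" using True \<open>card \<tau> = s\<close> card_mono by blast
      thus ?thesis using ex \<Gamma>(3) dt d0 m unfolding C exact_links_def by blast
    next
      case False
      then obtain x where x: "x \<in> \<tau>" "x \<notin> \<sigma>" by blast
      show ?thesis
      proof (cases "x \<in> V")
        case True
        show ?thesis
        proof (rule cone_exact[OF dt d0 CV _ True])
          fix S assume "S \<in> ?C"
          moreover have "insert x S \<union> \<sigma> \<union> \<tau> = S \<union> \<sigma> \<union> \<tau>" using x by blast
          ultimately show "insert x S \<in> ?C" using x by auto
        qed
      next
        case False
        hence "?C = {}" using x \<Gamma>(1) by blast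
        hence "(\<lambda>\<rho>. d \<rho> \<tau>) = (\<lambda>_. 0)" 
          by (intro chains_zeroI[OF dt]) blast
        thus ?thesis by (intro bexI[of _ "\<lambda>_. 0"]) simp_all
      qed
    qed
    thus ?thesis using True by blast
  qed
  hence "\<forall>\<tau>. \<exists>b. b \<in> face_chains {\<rho>. \<rho> \<inter> \<sigma> = {} \<and> \<rho> \<union> \<sigma> \<union> \<tau> \<in> \<Gamma>} (Suc k) \<and>
      ctr (\<lambda>_. 1) b = (\<lambda>\<rho>. d \<rho> \<tau>) \<and> (card \<tau> \<noteq> s \<longrightarrow> b = (\<lambda>_. 0))" by (rule allI)
  from choice[OF this] obtain B where B': "\<forall>\<tau>. B \<tau> \<in> face_chains {\<rho>. \<rho> \<inter> \<sigma> = {} \<and> \<rho> \<union> \<sigma> \<union> \<tau> \<in> \<Gamma>} (Suc k) \<and>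
      ctr (\<lambda>_. 1) (B \<tau>) = (\<lambda>\<rho>. d \<rho> \<tau>) \<and> (card \<tau> \<noteq> s \<longrightarrow> B \<tau> = (\<lambda>_. 0))"
    by (elim exE)
  hence B: "\<And>\<tau>. B \<tau> \<in> face_chains {\<rho>. \<rho> \<inter> \<sigma> = {} \<and> \<rho> \<union> \<sigma> \<union> \<tau> \<in> \<Gamma>} (Suc k)"
    "\<And>\<tau>. ctr (\<lambda>_. 1) (B \<tau>) = (\<lambda>\<rho>. d \<rho> \<tau>)" "\<And>\<tau>. card \<tau> \<noteq> s \<Longrightarrow> B \<tau> = (\<lambda>_. 0)"
    by simp_all
  show ?thesis
  proof (rule bexI[of _ "\<lambda>\<rho> \<tau>. B \<tau> \<rho>"])
    show "bd (\<lambda>\<rho> \<tau>. B \<tau> \<rho>) = d" unfolding bd_def using B(2) by simp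
    show "(\<lambda>\<rho> \<tau>. B \<tau> \<rho>) \<in> bichains \<Gamma> \<sigma> (Suc k) s"
      unfolding bichains_def
    proof (intro CollectI allI impI)
      fix \<rho> \<tau> assume nz: "B \<tau> \<rho> \<noteq> 0"
      hence "card \<tau> = s" using B(3)[of \<tau>] by (metis (no_types))
      thus "\<rho> \<inter> \<sigma> = {} \<and> \<rho> \<union> \<sigma> \<union> \<tau> \<in> \<Gamma> \<and> card \<rho> = Suc k \<and> card \<tau> = s"
        using B(1)[of \<tau>] nz unfolding face_chains_def by blast
    qed
  qed
qed

text \<open>
  If \<open>\<sigma>\<close> has at least \<open>i\<close> vertices, there is a section. Otherwise write \<open>w\<close> first as a contraction
  by \<open>i - 1\<close> forms and then as a boundary of \<open>b\<close>; after correcting \<open>b\<close> so that all forms kill it,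
  lift its values separately, each in the star of the larger face \<open>\<rho> \<union> \<sigma>\<close>.
\<close>

lemma bichain_lift:
  fixes w :: "'a set \<Rightarrow> 'a set \<Rightarrow> 'f::field"
  assumes ex: "exact_links TYPE('f) \<Gamma> m"
    and \<Gamma>: "\<Gamma> \<subseteq> Pow V" "\<And>S T. S \<in> \<Gamma> \<Longrightarrow> T \<subseteq> S \<Longrightarrow> T \<in> \<Gamma>" and \<theta>: "general \<theta>"
  shows "\<sigma> \<in> \<Gamma> \<Longrightarrow> w \<in> bichains \<Gamma> \<sigma> k s \<Longrightarrow> bd w = (\<lambda>_ _. 0) \<Longrightarrow>
    (\<And>a \<rho>. a < i \<Longrightarrow> ctr (\<theta> a) (w \<rho>) = (\<lambda>_. 0)) \<Longrightarrow> k + s + i \<le> m \<Longrightarrow>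
    \<exists>w'\<in>bichains \<Gamma> \<sigma> k (s + i). bd w' = (\<lambda>_ _. 0) \<and> (\<forall>\<rho>. ctrs \<theta> [0..<i] (w' \<rho>) = w \<rho>)"
proof (induction i arbitrary: \<sigma> k s w)
  case 0
  thus ?case by (intro bexI[of _ w]) auto
next
  case (Suc i)
  note IHi = Suc.IH
  have down: "S \<in> {\<tau>. \<rho> \<union> \<tau> \<in> \<Gamma>} \<Longrightarrow> T \<subseteq> S \<Longrightarrow> T \<in> {\<tau>. \<rho> \<union> \<tau> \<in> \<Gamma>}" for S T \<rho>
    using \<Gamma>(2)[of "\<rho> \<union> S" "\<rho> \<union> T"] by blast
  show ?case using Suc.prems
  \<comment> \<open>The local lifts below take place in stars of larger faces. The measure drops as
    \<open>\<sigma>\<close> grows, and when it is 0 there is a section.\<close>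
  proof (induction "Suc i - card \<sigma>" arbitrary: \<sigma> k s w rule: less_induct)
    case less
    note IHc = less.hyps
    have \<sigma>V: "\<sigma> \<subseteq> V" using less.prems(1) \<Gamma>(1) by blast
    have f\<sigma>: "finite \<sigma>" using \<sigma>V finite_V finite_subset by blast
    show ?case
    proof (cases "Suc i \<le> card \<sigma>")
      case True
      obtain L :: "('a set \<Rightarrow> 'f) \<Rightarrow> 'a set \<Rightarrow> 'f" where L: "linear_map L"
        "\<forall>C D s. \<forall>c\<in>face_chains C s. (\<forall>S\<subseteq>\<sigma>. \<forall>T\<in>C. S \<union> T \<in> D) \<longrightarrow> L c \<in> face_chains D (s + Suc i)"
        "\<forall>s. \<forall>c\<in>face_chains (Pow V) s. (\<forall>a<Suc i. ctr (\<theta> a) c = (\<lambda>_. 0)) \<longrightarrow> ctrs \<theta> [0..<Suc i] (L c) = c"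
        using exists_section[OF \<theta> \<sigma>V True] by blast
      have L0: "L (\<lambda>_. 0) = (\<lambda>_. 0)" by (rule linear_map_zero[OF L(1)])
      show ?thesis
      proof (rule bexI[of _ "\<lambda>\<rho>. L (w \<rho>)"], intro conjI allI)
        have "bd (\<lambda>\<rho>. L (w \<rho>)) \<rho> = (\<lambda>_. 0)" for \<rho>
          unfolding linear_map_bd[OF L(1), symmetric] less.prems(3) by (rule L0)
        thus "bd (\<lambda>\<rho>. L (w \<rho>)) = (\<lambda>_ _. 0)" by (rule ext)
        show "ctrs \<theta> [0..<Suc i] (L (w \<rho>)) = w \<rho>" for \<rho>
        proof (rule L(3)[rule_format])
          show "w \<rho> \<in> face_chains (Pow V) s"
            by (rule chains_mono[OF bichains_D(1)[OF less.prems(2)]]) (use \<Gamma>(1) in blast)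
        qed (use less.prems(4) in blast)
        show "(\<lambda>\<rho>. L (w \<rho>)) \<in> bichains \<Gamma> \<sigma> k (s + Suc i)"
        proof (rule bichains_map[where L = L, OF less.prems(2) _ L0])
          fix \<rho> and c :: "'a set \<Rightarrow> 'f" assume "c \<in> face_chains {\<tau>. \<rho> \<union> \<sigma> \<union> \<tau> \<in> \<Gamma>} s"
          thus "L c \<in> face_chains {\<tau>. \<rho> \<union> \<sigma> \<union> \<tau> \<in> \<Gamma>} (s + Suc i)"
          proof (rule L(2)[rule_format])
            fix S T assume S: "S \<subseteq> \<sigma>" and T: "T \<in> {\<tau>. \<rho> \<union> \<sigma> \<union> \<tau> \<in> \<Gamma>}"
            have "\<rho> \<union> \<sigma> \<union> (S \<union> T) = \<rho> \<union> \<sigma> \<union> T" using S by blast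
            thus "S \<union> T \<in> {\<tau>. \<rho> \<union> \<sigma> \<union> \<tau> \<in> \<Gamma>}" using T by simp
          qed
        qed
      qed
    next
      case False
      hence c\<sigma>: "card \<sigma> \<le> i" by simp
      \<comment> \<open>The chain \<open>b\<close> built below is killed by the first
        \<open>i\<close> forms, but perhaps not by \<open>\<theta> i\<close>. The assumption
        \<open>correct\<close> supplies the chain that repairs this; it is proved afterwards by
        induction on \<open>s\<close>, with \<open>main\<close> used in both cases.\<close>
      have main: "\<exists>w'\<in>bichains \<Gamma> \<sigma> k (s + Suc i). bd w' = (\<lambda>_ _. 0) \<and> (\<forall>\<rho>. ctrs \<theta> [0..<Suc i] (w' \<rho>) = w \<rho>)"
        if w: "w \<in> bichains \<Gamma> \<sigma> k s" "bd w = (\<lambda>_ _. 0)" "\<And>a \<rho>. a < Suc i \<Longrightarrow> ctr (\<theta> a) (w \<rho>) = (\<lambda>_. 0)" "k + s + Suc i \<le> m"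
          and correct: "\<And>b. b \<in> bichains \<Gamma> \<sigma> (Suc k) s \<Longrightarrow> bd b = w \<Longrightarrow> (\<And>a \<rho>. a < i \<Longrightarrow> ctr (\<theta> a) (b \<rho>) = (\<lambda>_. 0)) \<Longrightarrow>
            \<exists>z\<in>bichains \<Gamma> \<sigma> (Suc k) s. bd z = (\<lambda>_ _. 0) \<and> (\<forall>\<rho>. ctr (\<theta> i) (z \<rho>) = ctr (\<theta> i) (b \<rho>)) \<and>
            (\<forall>a<i. \<forall>\<rho>. ctr (\<theta> a) (z \<rho>) = (\<lambda>_. 0))" for k s w
      proof -
        have "\<exists>d\<in>bichains \<Gamma> \<sigma> k (s + i). bd d = (\<lambda>_ _. 0) \<and> (\<forall>\<rho>. ctrs \<theta> [0..<i] (d \<rho>) = w \<rho>)"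
          by (rule IHi[OF less.prems(1) w(1,2)]) (use w(3,4) in simp_all)
        then obtain d where d: "d \<in> bichains \<Gamma> \<sigma> k (s + i)" "bd d = (\<lambda>_ _. 0)" "\<And>\<rho>. ctrs \<theta> [0..<i] (d \<rho>) = w \<rho>" by blast
        \<comment> \<open>This degree is within the range of \<open>exact_links\<close> because
          \<open>card \<sigma> \<le> i\<close> and \<open>k + s + Suc i \<le> m\<close>.\<close>
        have "\<exists>b\<in>bichains \<Gamma> \<sigma> (Suc k) (s + i). bd b = d"
          by (rule bd_exact[OF ex \<Gamma>(1) _ less.prems(1) d(1,2)]) (use \<Gamma>(2) c\<sigma> w(4) in auto)
        then obtain b0 where b0: "b0 \<in> bichains \<Gamma> \<sigma> (Suc k) (s + i)" "bd b0 = d" by blast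
        define b where "b = (\<lambda>\<rho>. ctrs \<theta> [0..<i] (b0 \<rho>))"
        have b: "b \<in> bichains \<Gamma> \<sigma> (Suc k) s"
          unfolding b_def by (rule bichains_map[where L = "ctrs \<theta> [0..<i]", OF b0(1)]) (rule ctrs_chains[OF _ down], simp_all)
        have bdb: "bd b = w"
          unfolding b_def by (rule ext) (simp only: linear_map_bd[OF linear_map_ctrs, symmetric] b0(2) d(3))
        have bk: "ctr (\<theta> a) (b \<rho>) = (\<lambda>_. 0)" if "a < i" for a \<rho>
          unfolding b_def by (rule ctr_ctrs_mem) (use that in simp)
        obtain z where z: "z \<in> bichains \<Gamma> \<sigma> (Suc k) s" "bd z = (\<lambda>_ _. 0)" "\<And>\<rho>. ctr (\<theta> i) (z \<rho>) = ctr (\<theta> i) (b \<rho>)"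
            "\<And>a \<rho>. a < i \<Longrightarrow> ctr (\<theta> a) (z \<rho>) = (\<lambda>_. 0)"
          using correct[OF b bdb bk] by blast
        define e where "e = (\<lambda>\<rho> \<tau>. b \<rho> \<tau> - z \<rho> \<tau>)"
        have e: "e \<in> bichains \<Gamma> \<sigma> (Suc k) s" unfolding e_def by (rule bichains_diff[OF b z(1)])
        have "bd e = (\<lambda>\<rho> \<tau>. bd b \<rho> \<tau> - bd z \<rho> \<tau>)" unfolding e_def bd_def ctr_diff ..
        hence bde: "bd e = w" unfolding bdb z(2) by simp
        have ek: "ctr (\<theta> a) (e \<rho>) = (\<lambda>_. 0)" if "a < Suc i" for a \<rho>
          unfolding e_def ctr_diff using that bk[of a \<rho>] z(3)[of \<rho>] z(4)[of a \<rho>] by (cases "a = i") simp_all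
        have "\<exists>c. (\<rho> \<inter> \<sigma> \<noteq> {} \<or> card \<rho> \<noteq> Suc k \<longrightarrow> c = (\<lambda>_. 0)) \<and>
            c \<in> face_chains {\<tau>. \<rho> \<union> \<sigma> \<union> \<tau> \<in> \<Gamma>} (s + Suc i) \<and> ctrs \<theta> [0..<Suc i] c = e \<rho>" for \<rho>
        proof (cases "e \<rho> = (\<lambda>_. 0)")
          case True
          show ?thesis by (rule exI[of _ "\<lambda>_. 0"]) (simp only: True ctrs_zero chains_zero, simp)
        next
          case False
          then obtain \<tau> where "e \<rho> \<tau> \<noteq> 0" by auto
          hence \<rho>: "\<rho> \<inter> \<sigma> = {}" "\<rho> \<union> \<sigma> \<union> \<tau> \<in> \<Gamma>" "card \<rho> = Suc k" using e unfolding bichains_def by blast+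
          have \<rho>\<sigma>: "\<rho> \<union> \<sigma> \<in> \<Gamma>" by (rule \<Gamma>(2)[OF \<rho>(2)]) blast
          have "card (\<rho> \<union> \<sigma>) = Suc k + card \<sigma>"
            using card_Un_disjoint[OF _ f\<sigma> \<rho>(1)] \<rho>(3) card.infinite[of \<rho>] by fastforce
          hence lt: "Suc i - card (\<rho> \<union> \<sigma>) < Suc i - card \<sigma>" using c\<sigma> by simp
          \<comment> \<open>A single value of \<open>e\<close> becomes a bichain of type
            \<open>(0, s)\<close> relative to the larger face
            \<open>\<rho> \<union> \<sigma>\<close>. Its boundary is zero for reasons of degree, so
            the induction on the measure applies.\<close>
          define w0 where "w0 = (\<lambda>\<rho>' :: 'a set. if \<rho>' = {} then e \<rho> else (\<lambda>_. 0))"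
          have w0: "w0 \<in> bichains \<Gamma> (\<rho> \<union> \<sigma>) 0 s"
          proof (rule bichainsI)
            fix \<rho>' :: "'a set" assume "\<rho>' \<inter> (\<rho> \<union> \<sigma>) = {}" "card \<rho>' = 0"
            show "w0 \<rho>' \<in> face_chains {\<tau>. \<rho>' \<union> (\<rho> \<union> \<sigma>) \<union> \<tau> \<in> \<Gamma>} s"
              unfolding w0_def using bichains_D(1)[OF e, of \<rho>] by (cases "\<rho>' = {}") simp_all
          qed (auto simp: w0_def)
          have "bd w0 = (\<lambda>_ _. 0)"
          proof (intro ext)
            fix \<rho>' \<tau>
            have "(\<lambda>\<rho>. w0 \<rho> \<tau>) \<in> face_chains (Pow V) 0"
              by (rule chains_mono[OF bichains_D(2)[OF w0]]) (use \<Gamma>(1) in blast)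
            from ctr_chains_0[OF this order_refl] show "bd w0 \<rho>' \<tau> = 0" unfolding bd_def by simp
          qed
          hence "\<exists>w'\<in>bichains \<Gamma> (\<rho> \<union> \<sigma>) 0 (s + Suc i). bd w' = (\<lambda>_ _. 0) \<and> (\<forall>\<rho>. ctrs \<theta> [0..<Suc i] (w' \<rho>) = w0 \<rho>)"
          proof (rule IHc[OF lt \<rho>\<sigma> w0])
            show "ctr (\<theta> a) (w0 \<rho>') = (\<lambda>_. 0)" if "a < Suc i" for a \<rho>'
              unfolding w0_def using ek[OF that, of \<rho>] by (cases "\<rho>' = {}") simp_all
          qed (use w(4) in simp)
          then obtain w' where w': "w' \<in> bichains \<Gamma> (\<rho> \<union> \<sigma>) 0 (s + Suc i)" "ctrs \<theta> [0..<Suc i] (w' {}) = w0 {}" by blast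
          have "w' {} \<in> face_chains {\<tau>. \<rho> \<union> \<sigma> \<union> \<tau> \<in> \<Gamma>} (s + Suc i)"
            using bichains_D(1)[OF w'(1), of "{}"] by (simp only: Un_empty_left)
          moreover have "w0 {} = e \<rho>" by (simp add: w0_def)
          ultimately show ?thesis using w'(2) \<rho>(1,3) by (intro exI[of _ "w' {}"]) (simp only:, simp)
        qed
        then obtain B where B: "\<And>\<rho>. \<rho> \<inter> \<sigma> \<noteq> {} \<or> card \<rho> \<noteq> Suc k \<Longrightarrow> B \<rho> = (\<lambda>_. 0)"
            "\<And>\<rho>. B \<rho> \<in> face_chains {\<tau>. \<rho> \<union> \<sigma> \<union> \<tau> \<in> \<Gamma>} (s + Suc i)" "\<And>\<rho>. ctrs \<theta> [0..<Suc i] (B \<rho>) = e \<rho>" by metis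
        have "B \<in> bichains \<Gamma> \<sigma> (Suc k) (s + Suc i)" by (rule bichainsI) (use B in blast)+
        hence "bd B \<in> bichains \<Gamma> \<sigma> k (s + Suc i)" by (rule bd_bichains[OF _ \<Gamma>(2)])
        moreover have "ctrs \<theta> [0..<Suc i] (bd B \<rho>) = w \<rho>" for \<rho>
          unfolding linear_map_bd[OF linear_map_ctrs] B(3) bde[symmetric] ..
        ultimately show ?thesis using bd_bd[of B] by blast
      qed
      show ?thesis using less.prems(2-5)
      proof (induction s arbitrary: k w)
        case (0 k w)
        show ?case
        proof (rule main[OF "0.prems"])
          fix b :: "'a set \<Rightarrow> 'a set \<Rightarrow> 'f" assume b: "b \<in> bichains \<Gamma> \<sigma> (Suc k) 0"
          have "ctr (\<theta> i) (b \<rho>) = (\<lambda>_. 0)" for \<rho>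
            by (rule ctr_chains_0[OF bichains_D(1)[OF b]]) (use \<Gamma>(1) in blast)
          thus "\<exists>z\<in>bichains \<Gamma> \<sigma> (Suc k) 0. bd z = (\<lambda>_ _. 0) \<and> (\<forall>\<rho>. ctr (\<theta> i) (z \<rho>) = ctr (\<theta> i) (b \<rho>)) \<and>
            (\<forall>a<i. \<forall>\<rho>. ctr (\<theta> a) (z \<rho>) = (\<lambda>_. 0))"
            by (intro bexI[of _ "\<lambda>_ _. 0"]) (simp_all add: bichains_def bd_def)
        qed
      next
        case (Suc s k w)
        show ?case
        proof (rule main[OF Suc.prems])
          fix b :: "'a set \<Rightarrow> 'a set \<Rightarrow> 'f"
          assume b: "b \<in> bichains \<Gamma> \<sigma> (Suc k) (Suc s)" "bd b = w" "\<And>a \<rho>. a < i \<Longrightarrow> ctr (\<theta> a) (b \<rho>) = (\<lambda>_. 0)"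
          \<comment> \<open>The defect of \<open>b\<close> with respect to
            \<open>\<theta> i\<close>. It is a cycle, it is killed by all \<open>Suc i\<close>
            forms, and it has one vertex less in \<open>\<tau>\<close> and one more in
            \<open>\<rho>\<close> than \<open>w\<close>. So the bound by \<open>m\<close> is
            unchanged and the induction on \<open>s\<close> lifts it.\<close>
          define y where "y = (\<lambda>\<rho>. ctr (\<theta> i) (b \<rho>))"
          have y: "y \<in> bichains \<Gamma> \<sigma> (Suc k) s"
            unfolding y_def by (rule bichains_map[where L = "ctr (\<theta> i)", OF b(1)]) (rule ctr_chains[OF _ down], simp_all)
          have "bd y = (\<lambda>_ _. 0)"
            unfolding y_def by (rule ext) (simp only: linear_map_bd[OF linear_map_ctr, symmetric] b(2) Suc.prems(3) lessI)
          hence "\<exists>z\<in>bichains \<Gamma> \<sigma> (Suc k) (s + Suc i). bd z = (\<lambda>_ _. 0) \<and> (\<forall>\<rho>. ctrs \<theta> [0..<Suc i] (z \<rho>) = y \<rho>)"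
          proof (rule Suc.IH[OF y])
            show "ctr (\<theta> a) (y \<rho>) = (\<lambda>_. 0)" if "a < Suc i" for a \<rho>
            proof (cases "a = i")
              case False
              hence "ctr (\<theta> a) (b \<rho>) = (\<lambda>_. 0)" using that b(3) by simp
              thus ?thesis unfolding y_def by (subst ctr_anticommute) simp
            qed (simp add: y_def)
          qed (use Suc.prems(4) in simp)
          then obtain z' where z': "z' \<in> bichains \<Gamma> \<sigma> (Suc k) (s + Suc i)" "bd z' = (\<lambda>_ _. 0)"
            "\<And>\<rho>. ctrs \<theta> [0..<Suc i] (z' \<rho>) = y \<rho>" by blast
          define z where "z = (\<lambda>\<rho>. ctrs \<theta> [0..<i] (z' \<rho>))"
          have "z \<in> bichains \<Gamma> \<sigma> (Suc k) (Suc s)"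
            unfolding z_def by (rule bichains_map[where L = "ctrs \<theta> [0..<i]", OF z'(1)]) (rule ctrs_chains[OF _ down], simp_all)
          moreover have "bd z = (\<lambda>_ _. 0)"
            unfolding z_def by (rule ext) (simp only: linear_map_bd[OF linear_map_ctrs, symmetric] z'(2) ctrs_zero)
          moreover have "ctr (\<theta> i) (z \<rho>) = ctr (\<theta> i) (b \<rho>)" for \<rho>
            using z'(3)[of \<rho>] unfolding z_def y_def by (simp add: ctrs_append)
          moreover have "ctr (\<theta> a) (z \<rho>) = (\<lambda>_. 0)" if "a < i" for a \<rho>
            unfolding z_def by (rule ctr_ctrs_mem) (use that in simp)
          ultimately show "\<exists>z\<in>bichains \<Gamma> \<sigma> (Suc k) (Suc s). bd z = (\<lambda>_ _. 0) \<and> (\<forall>\<rho>. ctr (\<theta> i) (z \<rho>) = ctr (\<theta> i) (b \<rho>)) \<and>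
            (\<forall>a<i. \<forall>\<rho>. ctr (\<theta> a) (z \<rho>) = (\<lambda>_. 0))" by blast
        qed
      qed
    qed
  qed
qed

text \<open>A chain is a bichain of type \<open>(0, s)\<close> relative to the empty face, and such
  a bichain has boundary zero. Other types and other \<open>\<sigma>\<close> arise inside the
  induction.\<close>

lemma contraction_lift:
  fixes c :: "'a set \<Rightarrow> 'f::field"
  assumes ex: "exact_links TYPE('f) \<Gamma> m"
    and \<Gamma>: "\<Gamma> \<subseteq> Pow V" "\<And>S T. S \<in> \<Gamma> \<Longrightarrow> T \<subseteq> S \<Longrightarrow> T \<in> \<Gamma>" and \<theta>: "general \<theta>"
    and c: "c \<in> face_chains \<Gamma> s" "\<And>a. a < i \<Longrightarrow> ctr (\<theta> a) c = (\<lambda>_. 0)" "s + i \<le> m"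
  shows "\<exists>w\<in>face_chains \<Gamma> (s + i). ctrs \<theta> [0..<i] w = c"
proof (cases "{} \<in> \<Gamma>")
  case False
  hence "\<Gamma> = {}" using \<Gamma>(2) by blast
  hence "c = (\<lambda>_. 0)" by (intro chains_zeroI[OF c(1)]) blast
  thus ?thesis by (intro bexI[of _ "\<lambda>_. 0"]) simp_all
next
  case True
  define w where "w = (\<lambda>\<rho> :: 'a set. if \<rho> = {} then c else (\<lambda>_. 0))"
  have w: "w \<in> bichains \<Gamma> {} 0 s"
  proof (rule bichainsI)
    fix \<rho> :: "'a set"
    show "w \<rho> \<in> face_chains {\<tau>. \<rho> \<union> {} \<union> \<tau> \<in> \<Gamma>} s"
      unfolding w_def using c(1) by (cases "\<rho> = {}") simp_all
  next
    fix \<rho> :: "'a set" assume "\<rho> \<inter> {} \<noteq> {} \<or> card \<rho> \<noteq> 0"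
    thus "w \<rho> = (\<lambda>_. 0)" unfolding w_def by auto
  qed
  have bdw: "bd w = (\<lambda>_ _. 0)"
  proof (intro ext)
    fix \<rho>' \<tau>
    have "(\<lambda>\<rho>. w \<rho> \<tau>) \<in> face_chains (Pow V) 0"
      by (rule chains_mono[OF bichains_D(2)[OF w]]) (use \<Gamma>(1) in blast)
    from ctr_chains_0[OF this order_refl] show "bd w \<rho>' \<tau> = 0" unfolding bd_def by simp
  qed
  have wk: "ctr (\<theta> a) (w \<rho>) = (\<lambda>_. 0)" if "a < i" for a \<rho>
    unfolding w_def using c(2)[OF that] by (cases "\<rho> = {}") simp_all
  have "\<exists>w'\<in>bichains \<Gamma> {} 0 (s + i). bd w' = (\<lambda>_ _. 0) \<and> (\<forall>\<rho>. ctrs \<theta> [0..<i] (w' \<rho>) = w \<rho>)"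
    by (rule bichain_lift[OF ex \<Gamma>(1) _ \<theta> True w bdw wk]) (use c(3) \<Gamma>(2) in auto)
  then obtain w' where w': "w' \<in> bichains \<Gamma> {} 0 (s + i)" "ctrs \<theta> [0..<i] (w' {}) = w {}" by blast
  have "w' {} \<in> face_chains \<Gamma> (s + i)" using bichains_D(1)[OF w'(1), of "{}"] by simp
  thus ?thesis using w'(2) by (intro bexI[of _ "w' {}"]) (simp_all add: w_def)
qed

end

section \<open>Leading sets\<close>

lemma underdetermined_system:
  fixes M :: "'e \<Rightarrow> 'j \<Rightarrow> 'f::field"
  assumes "finite E" "finite J" "card E < card J"
  shows "\<exists>a. (\<exists>j\<in>J. a j \<noteq> 0) \<and> (\<forall>e\<in>E. (\<Sum>j\<in>J. M e j * a j) = 0)"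
  using assms
proof (induction E arbitrary: J M rule: finite_induct)
  case empty
  then obtain j where "j \<in> J" by (cases "J = {}") auto
  thus ?case by (intro exI[of _ "\<lambda>_. 1"]) auto
next
  case (insert e E)
  show ?case
  proof (cases "\<forall>j\<in>J. M e j = 0")
    case True
    have "card E < card J" using insert by simp
    then obtain a where a: "\<exists>j\<in>J. a j \<noteq> 0" "\<forall>e\<in>E. (\<Sum>j\<in>J. M e j * a j) = 0"
      using insert.IH[OF insert.prems(1), of M] by blast
    have "(\<Sum>j\<in>J. M e j * a j) = 0" using True by simp
    thus ?thesis using a by (intro exI[of _ a]) simp
  next
    case False
    then obtain i where i: "i \<in> J" "M e i \<noteq> 0" by blast
    let ?J = "J - {i}"
    have "card E < card ?J" using insert i by simp
    \<comment> \<open>Gaussian elimination: equation \<open>e\<close> removes the unknown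
      \<open>i\<close> from the other equations, and \<open>x\<close> below solves equation
      \<open>e\<close> for it.\<close>
    then obtain a where a: "\<exists>j\<in>?J. a j \<noteq> 0" "\<forall>e'\<in>E. (\<Sum>j\<in>?J. (M e' j - M e' i * M e j / M e i) * a j) = 0"
      using insert.IH[of ?J "\<lambda>e' j. M e' j - M e' i * M e j / M e i"] insert.prems(1) by blast
    define x where "x = - (\<Sum>j\<in>?J. M e j * a j) / M e i"
    define b where "b = a(i := x)"
    have sum_b: "(\<Sum>j\<in>J. M e' j * b j) = M e' i * x + (\<Sum>j\<in>?J. M e' j * a j)" for e'
    proof -
      have "(\<Sum>j\<in>J. M e' j * b j) = M e' i * b i + (\<Sum>j\<in>?J. M e' j * b j)"
        by (rule sum.remove[OF insert.prems(1) i(1)])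
      moreover have "(\<Sum>j\<in>?J. M e' j * b j) = (\<Sum>j\<in>?J. M e' j * a j)"
        by (rule sum.cong) (auto simp: b_def)
      ultimately show ?thesis by (simp add: b_def)
    qed
    have "(\<Sum>j\<in>J. M e j * b j) = 0" unfolding sum_b x_def using i(2) by simp
    moreover have "(\<Sum>j\<in>J. M e' j * b j) = 0" if "e' \<in> E" for e'
    proof -
      have "0 = (\<Sum>j\<in>?J. M e' j * a j - (M e' i / M e i) * (M e j * a j))"
        using a(2) that by (simp add: left_diff_distrib mult.assoc)
      also have "\<dots> = (\<Sum>j\<in>?J. M e' j * a j) - (M e' i / M e i) * (\<Sum>j\<in>?J. M e j * a j)"
        by (simp add: sum_subtractf sum_distrib_left)
      finally show ?thesis unfolding sum_b x_def by simp
    qed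
    moreover have "\<exists>j\<in>J. b j \<noteq> 0"
    proof -
      obtain j where "j \<in> ?J" "a j \<noteq> 0" using a(1) by blast
      thus ?thesis by (intro bexI[of _ j]) (auto simp: b_def)
    qed
    ultimately show ?thesis by (intro exI[of _ b]) simp
  qed
qed

text \<open>The determinant of \<open>M0 + t M1\<close> is a polynomial in \<open>t\<close> that does not vanish at \<open>0\<close>.\<close>

lemma finite_singular_parameters:
  fixes M0 M1 :: "'j \<Rightarrow> 'j \<Rightarrow> 'f::field"
  assumes J: "finite J" and inj: "\<And>a. \<forall>e\<in>J. (\<Sum>j\<in>J. M0 e j * a j) = 0 \<Longrightarrow> \<forall>j\<in>J. a j = 0"
  shows "finite {t. \<exists>a. (\<forall>e\<in>J. (\<Sum>j\<in>J. (M0 e j + t * M1 e j) * a j) = 0) \<and> (\<exists>j\<in>J. a j \<noteq> 0)}"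
proof -
  define N where "N = card J"
  obtain f where f: "bij_betw f {0..<N} J" using ex_bij_betw_nat_finite[OF J] unfolding N_def by blast
  have fJ: "f i \<in> J" if "i < N" for i using f that unfolding bij_betw_def by auto
  define A where "A = (\<lambda>t. mat N N (\<lambda>(i, j). M0 (f i) (f j) + t * M1 (f i) (f j)))"
  define P where "P = mat N N (\<lambda>(i, j). [:M0 (f i) (f j), M1 (f i) (f j):])"
  have det: "det (A t) = poly (det P) t" for t
  proof -
    interpret h: comm_ring_hom "\<lambda>p. poly p t" by unfold_locales auto
    have "map_mat (\<lambda>p. poly p t) P = A t" unfolding P_def A_def by (rule eq_matI) auto
    thus ?thesis using h.hom_det[of P] by simp
  qed
  have A: "A t \<in> carrier_mat N N" for t unfolding A_def by simp
  have mult: "(A t *\<^sub>v vec N b) $ i = (\<Sum>j\<in>J. (M0 (f i) j + t * M1 (f i) j) * a j)"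
    if "i < N" "\<And>j. j < N \<Longrightarrow> b j = a (f j)" for t i a b
  proof -
    have "(A t *\<^sub>v vec N b) $ i = (\<Sum>j\<in>{0..<N}. (M0 (f i) (f j) + t * M1 (f i) (f j)) * a (f j))"
      using that unfolding A_def by (auto simp: scalar_prod_def intro!: sum.cong)
    also have "\<dots> = (\<Sum>j\<in>J. (M0 (f i) j + t * M1 (f i) j) * a j)"
      by (rule sum.reindex_bij_betw[OF f])
    finally show ?thesis .
  qed
  have "det (A 0) \<noteq> 0"
  proof
    assume "det (A 0) = 0"
    then obtain v where v: "v \<in> carrier_vec N" "v \<noteq> 0\<^sub>v N" "A 0 *\<^sub>v v = 0\<^sub>v N"
      using det_0_iff_vec_prod_zero_field[OF A] by blast
    define a where "a = (\<lambda>j. v $ the_inv_into {0..<N} f j)"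
    have af: "v $ j = a (f j)" if "j < N" for j
      unfolding a_def using the_inv_into_f_f[of f "{0..<N}" j] f that by (simp add: bij_betw_def)
    have vv: "v = vec N (\<lambda>j. v $ j)" using v(1) by auto
    have "(\<Sum>j\<in>J. M0 e j * a j) = 0" if "e \<in> J" for e
    proof -
      have "e \<in> f ` {0..<N}" using that f unfolding bij_betw_def by blast
      then obtain i where i: "i < N" "e = f i" by auto
      have "(A 0 *\<^sub>v vec N (\<lambda>j. v $ j)) $ i = (\<Sum>j\<in>J. (M0 (f i) j + 0 * M1 (f i) j) * a j)"
        by (rule mult[where a = a and b = "\<lambda>j. v $ j", OF i(1)]) (rule af)
      thus ?thesis using v(3) i vv by simp
    qed
    hence "\<forall>j\<in>J. a j = 0" using inj by blast
    hence "v = 0\<^sub>v N" using v(1) af fJ by (intro eq_vecI) auto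
    thus False using v(2) by simp
  qed
  hence "det P \<noteq> 0" using det[of 0] by auto
  hence "finite {t. poly (det P) t = 0}" by (rule poly_roots_finite)
  moreover have "det (A t) = 0" if a: "\<forall>e\<in>J. (\<Sum>j\<in>J. (M0 e j + t * M1 e j) * a j) = 0" "j \<in> J" "a j \<noteq> 0" for t a j
  proof -
    let ?v = "vec N (\<lambda>j. a (f j))"
    have "j \<in> f ` {0..<N}" using a(2) f unfolding bij_betw_def by blast
    then obtain i where i: "i < N" "j = f i" by auto
    have "?v \<noteq> 0\<^sub>v N"
    proof
      assume "?v = 0\<^sub>v N"
      hence "?v $ i = 0\<^sub>v N $ i" by simp
      thus False using i a(3) by simp
    qed
    moreover have "A t *\<^sub>v ?v = 0\<^sub>v N"
    proof (rule eq_vecI)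
      fix i assume "i < dim_vec (0\<^sub>v N :: 'f vec)"
      hence i: "i < N" by simp
      thus "(A t *\<^sub>v ?v) $ i = 0\<^sub>v N $ i" 
        using mult[where a = a and b = "\<lambda>j. a (f j)" and t = t, OF i] a(1) fJ[OF i] by simp
    qed (simp add: A_def)
    moreover have "?v \<in> carrier_vec N" by simp
    ultimately show ?thesis unfolding det_0_iff_vec_prod_zero_field[OF A] by blast
  qed
  ultimately show ?thesis
    by (elim finite_subset[rotated]) (auto simp: det[symmetric])
qed

section \<open>Weights and leading sets\<close>

context vertex_set
begin

text \<open>
  The weight orders the subsets of \<open>{..<card V}\<close> lexicographically, the sets with small elements
  being the heavy ones.
\<close>

definition wt :: "nat set \<Rightarrow> nat" where
  "wt S = (\<Sum>i\<in>S. 2 ^ (card V - i))"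

lemma wt_insert: "finite S \<Longrightarrow> x \<notin> S \<Longrightarrow> wt (insert x S) = 2 ^ (card V - x) + wt S"
  unfolding wt_def by simp

lemma wt_Un: "finite S \<Longrightarrow> finite T \<Longrightarrow> S \<inter> T = {} \<Longrightarrow> wt (S \<union> T) = wt S + wt T"
  unfolding wt_def by (rule sum.union_disjoint)

lemma wt_mono: "finite T \<Longrightarrow> S \<subseteq> T \<Longrightarrow> wt S \<le> wt T"
  unfolding wt_def by (rule sum_mono2) auto

lemma wt_inj:
  assumes "S \<subseteq> {..<card V}" "T \<subseteq> {..<card V}" "wt S = wt T"
  shows "S = T"
proof -
  have e: "wt S = set_encode ((\<lambda>i. card V - i) ` S)" if "S \<subseteq> {..<card V}" for S
  proof -
    have "inj_on (\<lambda>i. card V - i) S" using that by (intro inj_onI) (auto dest!: subsetD)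
    thus ?thesis unfolding wt_def set_encode_def by (simp add: sum.reindex)
  qed
  have "finite S" "finite T" using assms finite_subset by blast+
  hence "(\<lambda>i. card V - i) ` S = (\<lambda>i. card V - i) ` T"
    using assms(3) unfolding e[OF assms(1)] e[OF assms(2)] by (simp add: set_encode_eq)
  moreover have "inj_on (\<lambda>i. card V - i) {..<card V}" by (rule inj_onI) auto
  ultimately show ?thesis using inj_on_image_eq_iff assms(1,2) by blast
qed

text \<open>Elements beyond \<open>x\<close> contribute distinct smaller powers of 2, whose sum
  stays below the contribution of \<open>x\<close>. This is why the smallest element in which two
  sets differ decides their order.\<close>

lemma wt_less_pow:
  assumes "T \<subseteq> {..<card V}" "\<And>i. i \<in> T \<Longrightarrow> x < i"
  shows "wt T < 2 ^ (card V - x)"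
proof -
  have inj: "inj_on (\<lambda>i. card V - i) T" using assms(1) by (intro inj_onI) (auto dest!: subsetD)
  have "wt T = (\<Sum>j\<in>(\<lambda>i. card V - i) ` T. 2 ^ j)" unfolding wt_def by (simp add: sum.reindex[OF inj])
  also have "\<dots> \<le> (\<Sum>j\<in>{q. q < card V - x}. 2 ^ j)"
  proof (rule sum_mono2)
    show "(\<lambda>i. card V - i) ` T \<subseteq> {q. q < card V - x}"
    proof (rule image_subsetI)
      fix i assume "i \<in> T"
      hence "i < card V" "x < i" using assms by auto
      thus "card V - i \<in> {q. q < card V - x}" by simp
    qed
  qed simp_all
  also have "\<dots> < 2 ^ (card V - x)" unfolding mask_eq_sum_exp_nat[symmetric] by simp
  finally show ?thesis .
qed

lemma wt_less_of_small_element: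
  assumes "T \<subseteq> {..<card V}" "T \<inter> {..<t} = {}" "finite R" "x \<in> R" "x < t"
  shows "wt T < wt R"
proof -
  have "x < i" if "i \<in> T" for i
    using assms(2,5) that by (meson disjoint_iff lessThan_iff less_le_trans not_le)
  hence "wt T < 2 ^ (card V - x)" by (rule wt_less_pow[OF assms(1)])
  also have "\<dots> \<le> wt R" using wt_mono[OF assms(3), of "{x}"] assms(4) by (simp add: wt_def)
  finally show ?thesis .
qed

text \<open>Below a missing \<open>x < t\<close> the set \<open>R\<close> has at most the elements
  of \<open>{..<x}\<close>, and beyond \<open>x\<close> it weighs less than \<open>x\<close>
  alone.\<close>

lemma wt_initial_segment:
  assumes "R \<subseteq> {..<card V}" "\<not> {..<t} \<subseteq> R" "{..<t} \<subseteq> S" "finite S"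
  shows "wt R < wt S"
proof -
  obtain x where x: "x < t" "x \<notin> R" using assms(2) by blast
  have fR: "finite R" using assms(1) finite_subset by blast
  have "R = (R \<inter> {..<x}) \<union> (R \<inter> {x<..})" using x(2) by (auto simp: not_less le_less)
  hence "wt R = wt (R \<inter> {..<x}) + wt (R \<inter> {x<..})"
    using fR by (metis Int_lower1 wt_Un finite_subset Int_commute disjoint_iff IntE lessThan_iff greaterThan_iff less_asym)
  also have "\<dots> < wt {..<x} + 2 ^ (card V - x)"
    by (intro add_le_less_mono wt_mono wt_less_pow) (use assms(1) in auto)
  also have "\<dots> = wt {..x}"
    using wt_insert[of "{..<x}" x] by (simp add: lessThan_Suc flip: lessThan_Suc_atMost)
  also have "\<dots> \<le> wt S" by (rule wt_mono[OF assms(4)]) (use x assms(3) in auto)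
  finally show ?thesis .
qed

text \<open>For a complex \<open>C\<close> and generic forms these are the faces of its exterior
  shifting, described by chains rather than by the quotient of the exterior algebra. The description
  by chains also applies to a family of sets.\<close>

definition leads :: "(nat \<Rightarrow> 'a \<Rightarrow> 'f::field) \<Rightarrow> 'a set set \<Rightarrow> nat \<Rightarrow> nat set set" where
  "leads \<theta> C p = {S. S \<subseteq> {..<card V} \<and> card S = p \<and>
     (\<exists>c\<in>face_chains C p. crd \<theta> S c \<noteq> 0 \<and>
       (\<forall>T\<subseteq>{..<card V}. card T = p \<longrightarrow> wt S < wt T \<longrightarrow> crd \<theta> T c = 0))}"

lemma finite_leads: "finite (leads \<theta> C p)"
  by (rule finite_subset[of _ "Pow {..<card V}"]) (auto simp: leads_def)

lemma exists_lead:
  assumes "c \<in> face_chains C p" "S \<subseteq> {..<card V}" "card S = p" "crd \<theta> S c \<noteq> 0"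
  shows "\<exists>T\<in>leads \<theta> C p. wt S \<le> wt T \<and> crd \<theta> T c \<noteq> 0"
proof -
  let ?Q = "{T. T \<subseteq> {..<card V} \<and> card T = p \<and> crd \<theta> T c \<noteq> 0}"
  have fin: "finite (wt ` ?Q)" by (rule finite_imageI, rule finite_subset[of _ "Pow {..<card V}"]) auto
  have S: "S \<in> ?Q" using assms by simp
  have "Max (wt ` ?Q) \<in> wt ` ?Q" by (rule Max_in[OF fin]) (use S in blast)
  then obtain T where T: "T \<in> ?Q" "wt T = Max (wt ` ?Q)" by (metis (no_types, lifting) imageE)
  have mx: "wt U \<le> wt T" if "U \<in> ?Q" for U unfolding T(2) using Max_ge[OF fin imageI[OF that]] .
  have "T \<in> leads \<theta> C p" unfolding leads_def
  proof (intro CollectI conjI bexI[of _ c] allI impI)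
    fix U assume "U \<subseteq> {..<card V}" "card U = p" "wt T < wt U"
    thus "crd \<theta> U c = 0" using mx[of U] by (intro ccontr[of "crd \<theta> U c = 0"]) auto
  qed (use T assms(1) in auto)
  thus ?thesis using mx[OF S] T(1) by blast
qed

text \<open>With fewer leading sets than members of \<open>C\<close>, some nonzero chain on
  \<open>C\<close> would have coordinate 0 at every leading set; but its heaviest nonzero coordinate
  is at one of them.\<close>

lemma card_le_card_leads:
  assumes \<theta>: "general \<theta>" and C: "C \<subseteq> Pow V" "\<And>\<sigma>. \<sigma> \<in> C \<Longrightarrow> card \<sigma> = p"
  shows "card C \<le> card (leads \<theta> C p)"
proof (rule ccontr)
  assume "\<not> ?thesis"
  hence lt: "card (leads \<theta> C p) < card C" by simp
  have finC: "finite C" using C(1) finite_V by (auto intro: finite_subset)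
  obtain a where a: "\<exists>\<sigma>\<in>C. a \<sigma> \<noteq> 0" "\<forall>S\<in>leads \<theta> C p. (\<Sum>\<sigma>\<in>C. crd \<theta> S (basis_chain \<sigma>) * a \<sigma>) = 0"
    using underdetermined_system[OF finite_leads finC lt, of "\<lambda>S \<sigma>. crd \<theta> S (basis_chain \<sigma>)"] by blast
  define c where "c = (\<lambda>S. \<Sum>\<sigma>\<in>C. a \<sigma> * basis_chain \<sigma> S)"
  have c: "c \<in> face_chains C p" unfolding c_def by (rule chains_sum) (use C(2) in \<open>auto intro: basis_chain_chains\<close>)
  have crd_c: "crd \<theta> S c = (\<Sum>\<sigma>\<in>C. crd \<theta> S (basis_chain \<sigma>) * a \<sigma>)" for S
    unfolding c_def crd_sum by (simp add: mult.commute)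
  have "c = (\<lambda>_. 0)"
  proof (rule crd_eq_0_imp_zero[OF \<theta> chains_mono[OF c C(1)]], rule ccontr)
    fix S assume "S \<subseteq> {..<card V}" "card S = p" "crd \<theta> S c \<noteq> 0"
    then obtain T where "T \<in> leads \<theta> C p" "crd \<theta> T c \<noteq> 0" using exists_lead[OF c] by blast
    thus False using a(2) crd_c by simp
  qed
  moreover obtain \<sigma> where \<sigma>: "\<sigma> \<in> C" "a \<sigma> \<noteq> 0" using a(1) by blast
  have "c \<sigma> = (\<Sum>\<tau>\<in>C. if \<tau> = \<sigma> then a \<sigma> else 0)" unfolding c_def basis_chain_def by (rule sum.cong) auto
  hence "c \<sigma> = a \<sigma>" using finC \<sigma>(1) by simp
  ultimately show False using \<sigma>(2) by simp
qed

lemma ctr_chains_pred: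
  assumes "c \<in> face_chains C p" "C \<subseteq> Pow V" "\<And>S T. S \<in> C \<Longrightarrow> T \<subseteq> S \<Longrightarrow> T \<in> C"
  shows "ctr f c \<in> face_chains C (p - 1)"
proof (cases p)
  case 0
  thus ?thesis using ctr_chains_0[OF _ assms(2), of c f] assms(1) by simp
next
  case (Suc q)
  thus ?thesis using ctr_chains[of c C q f] assms(1,3) by simp
qed

text \<open>Up to sign, \<open>ctr (\<theta> x) c\<close> has at \<open>T\<close> the coordinate of
  \<open>c\<close> at \<open>insert x T\<close>, or 0 if \<open>x\<close> is in \<open>T\<close>.
  Adding \<open>x\<close> raises all weights equally, so the contraction leads at
  \<open>S - {x}\<close>.\<close>

lemma leads_remove:
  assumes C: "C \<subseteq> Pow V" "\<And>S T. S \<in> C \<Longrightarrow> T \<subseteq> S \<Longrightarrow> T \<in> C"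
    and S: "S \<in> leads \<theta> C p" "x \<in> S"
  shows "S - {x} \<in> leads \<theta> C (p - 1)"
proof -
  obtain c where Sn: "S \<subseteq> {..<card V}" "card S = p" and c': "c \<in> face_chains C p" "crd \<theta> S c \<noteq> 0"
    "\<forall>T\<subseteq>{..<card V}. card T = p \<longrightarrow> wt S < wt T \<longrightarrow> crd \<theta> T c = 0"
    using S(1) unfolding leads_def by blast
  have "finite S" using Sn(1) finite_subset by blast
  note c = Sn this c'(1,2) c'(3)[rule_format]
  have p: "p \<ge> 1" using c(2,3) S(2) by (metis One_nat_def Suc_leI card_gt_0_iff empty_iff)
  show ?thesis unfolding leads_def
  proof (intro CollectI conjI bexI[of _ "ctr (\<theta> x) c"] allI impI)
    show "S - {x} \<subseteq> {..<card V}" using c(1) by blast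
    show "card (S - {x}) = p - 1" using c(2,3) S(2) by simp
    show "ctr (\<theta> x) c \<in> face_chains C (p - 1)" by (rule ctr_chains_pred[OF c(4) C])
    obtain e where e: "crd \<theta> (insert x (S - {x})) c = e * crd \<theta> (S - {x}) (ctr (\<theta> x) c)"
      using crd_insert[of "S - {x}" x \<theta>] c(3) by blast
    thus "crd \<theta> (S - {x}) (ctr (\<theta> x) c) \<noteq> 0" using c(5) S(2) by (auto simp: insert_absorb)
    fix T assume T: "T \<subseteq> {..<card V}" "card T = p - 1" "wt (S - {x}) < wt T"
    have fT: "finite T" using T(1) finite_subset by blast
    show "crd \<theta> T (ctr (\<theta> x) c) = 0"
    proof (cases "x \<in> T")
      case False
      obtain e where e: "e \<in> {1, -1}" "crd \<theta> (insert x T) c = e * crd \<theta> T (ctr (\<theta> x) c)"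
        using crd_insert[OF fT False, of \<theta>] by blast
      have "wt S < wt (insert x T)"
        using T(3) wt_insert[OF fT False] wt_insert[of "S - {x}" x] c(3) S(2) by (simp add: insert_absorb)
      moreover have "card (insert x T) = p" using fT False T(2) p by simp
      ultimately have "crd \<theta> (insert x T) c = 0" using T(1) c(1) S(2) by (intro c(6)) auto
      thus ?thesis using e by auto
    qed (simp add: crd_ctr_mem fT)
  qed
qed

lemma leads_subset:
  assumes C: "C \<subseteq> Pow V" "\<And>S T. S \<in> C \<Longrightarrow> T \<subseteq> S \<Longrightarrow> T \<in> C"
    and S: "S \<in> leads \<theta> C (card S)" "T \<subseteq> S"
  shows "T \<in> leads \<theta> C (card T)"
proof -
  have fS: "finite S" using S(1) unfolding leads_def by (auto intro: finite_subset)
  have "S - D \<in> leads \<theta> C (card (S - D))" if "D \<subseteq> S" for D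
    using finite_subset[OF that fS] that
  proof (induction D rule: finite_induct)
    case (insert x D)
    have "S - D - {x} \<in> leads \<theta> C (card (S - D) - 1)"
      by (rule leads_remove[OF C]) (use insert in auto)
    moreover have "S - insert x D = S - D - {x}" by blast
    moreover have "card (S - D - {x}) = card (S - D) - 1" using insert fS by simp
    ultimately show ?case by simp
  qed (use S(1) in simp)
  from this[of "S - T"] have "S - (S - T) \<in> leads \<theta> C (card (S - (S - T)))" by blast
  moreover have "S - (S - T) = T" using S(2) by blast
  ultimately show ?thesis by simp
qed

lemma crd_degree:
  assumes "c \<in> face_chains (Pow V) p" "finite S" "card S \<noteq> p"
  shows "crd \<theta> S c = 0"
  using assms(2,1,3)
proof (induction S arbitrary: c p rule: finite_induct)
  case empty
  thus ?case unfolding crd_def face_chains_def by auto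
next
  case (insert x S)
  obtain e where e: "crd \<theta> (insert x S) c = e * crd \<theta> S (ctr (\<theta> x) c)"
    using crd_insert[OF insert.hyps, of \<theta>] by blast
  show ?case
  proof (cases p)
    case 0
    hence "ctr (\<theta> x) c = (\<lambda>_. 0)" using ctr_chains_0[of c "Pow V"] insert.prems(1) by simp
    thus ?thesis unfolding e by simp
  next
    case (Suc q)
    have "ctr (\<theta> x) c \<in> face_chains (Pow V) q" by (rule ctr_chains) (use insert.prems(1) Suc in auto)
    moreover have "card S \<noteq> q" using insert Suc by simp
    ultimately show ?thesis unfolding e using insert.IH by simp
  qed
qed

text \<open>Chains leading at different sets that contain 0 stay independent after contraction by
  \<open>\<theta> 0\<close>, and the results are killed by \<open>\<theta> 0\<close>. As this form
  is nonzero at \<open>v\<close>, that relation expresses each value at a set containing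
  \<open>v\<close> by values at sets avoiding it.\<close>

lemma leads_star_card_le:
  assumes C: "C \<subseteq> Pow V" "\<And>S T. S \<in> C \<Longrightarrow> T \<subseteq> S \<Longrightarrow> T \<in> C"
    and \<theta>: "\<And>v. v \<in> V \<Longrightarrow> \<theta> 0 v \<noteq> 0" and v: "v \<in> V"
  shows "card {S\<in>leads \<theta> C r. 0 \<in> S} \<le> card {\<sigma>\<in>C. v \<notin> \<sigma> \<and> card \<sigma> = r - 1}"
proof (rule ccontr)
  let ?N = "{S\<in>leads \<theta> C r. 0 \<in> S}" and ?E = "{\<sigma>\<in>C. v \<notin> \<sigma> \<and> card \<sigma> = r - 1}"
  assume "\<not> ?thesis"
  hence lt: "card ?E < card ?N" by simp
  have finN: "finite ?N" by (rule finite_subset[OF _ finite_leads[of \<theta> C r]]) blast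
  have finE: "finite ?E" by (rule finite_subset[of _ "Pow V"]) (use C(1) finite_V in auto)
  have "\<forall>S. \<exists>c. S \<in> ?N \<longrightarrow> (c \<in> face_chains C r \<and> crd \<theta> S c \<noteq> 0 \<and>
      (\<forall>T\<subseteq>{..<card V}. card T = r \<longrightarrow> wt S < wt T \<longrightarrow> crd \<theta> T c = 0))"
    unfolding leads_def by blast
  from choice[OF this] obtain c where "\<forall>S. S \<in> ?N \<longrightarrow> (c S \<in> face_chains C r \<and> crd \<theta> S (c S) \<noteq> 0 \<and>
      (\<forall>T\<subseteq>{..<card V}. card T = r \<longrightarrow> wt S < wt T \<longrightarrow> crd \<theta> T (c S) = 0))" by (elim exE)
  hence c: "\<And>S. S \<in> ?N \<Longrightarrow> c S \<in> face_chains C r" "\<And>S. S \<in> ?N \<Longrightarrow> crd \<theta> S (c S) \<noteq> 0"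
    "\<And>S T. S \<in> ?N \<Longrightarrow> T \<subseteq> {..<card V} \<Longrightarrow> card T = r \<Longrightarrow> wt S < wt T \<Longrightarrow> crd \<theta> T (c S) = 0"
    by blast+
  obtain a where a: "\<exists>S\<in>?N. a S \<noteq> 0" "\<forall>\<sigma>\<in>?E. (\<Sum>S\<in>?N. ctr (\<theta> 0) (c S) \<sigma> * a S) = 0"
    using underdetermined_system[OF finE finN lt, of "\<lambda>\<sigma> S. ctr (\<theta> 0) (c S) \<sigma>"] by blast
  define y where "y = (\<lambda>\<sigma>. \<Sum>S\<in>?N. a S * c S \<sigma>)"
  have y: "y \<in> face_chains C r" unfolding y_def by (rule chains_sum[OF c(1)])
  define z where "z = ctr (\<theta> 0) y"
  have z: "z \<in> face_chains C (r - 1)" unfolding z_def by (rule ctr_chains_pred[OF y C])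
  have zE: "z \<sigma> = 0" if "v \<notin> \<sigma>" for \<sigma>
  proof (cases "\<sigma> \<in> ?E")
    case True
    thus ?thesis using a(2) unfolding z_def y_def ctr_sum by (simp add: mult.commute)
  next
    case False
    thus ?thesis using z that unfolding face_chains_def by blast
  qed
  have "z = (\<lambda>_. 0)"
  proof (rule chains_zeroI[OF z])
    fix \<sigma> assume \<sigma>: "\<sigma> \<in> C"
    show "z \<sigma> = 0"
    proof (cases "v \<in> \<sigma>")
      case True
      have sub: "\<sigma> - {v} \<subseteq> V" using C(1) \<sigma> by blast
      have "0 = ctr (\<theta> 0) z (\<sigma> - {v})" unfolding z_def by simp
      also have "\<dots> = (\<Sum>u\<in>V - (\<sigma> - {v}). incidence_sign u (\<sigma> - {v}) * \<theta> 0 u * z (insert u (\<sigma> - {v})))"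
        using sub by (simp add: ctr_def)
      also have "\<dots> = (\<Sum>u\<in>V - (\<sigma> - {v}). if u = v then incidence_sign v (\<sigma> - {v}) * \<theta> 0 v * z (insert v (\<sigma> - {v})) else 0)"
        by (rule sum.cong) (auto simp: zE)
      also have "\<dots> = incidence_sign v (\<sigma> - {v}) * \<theta> 0 v * z (insert v (\<sigma> - {v}))"
        using finite_V v by (subst sum.delta) auto
      finally show ?thesis using \<theta>[OF v] True by (simp add: insert_absorb)
    qed (rule zE)
  qed
  have crd_y: "crd \<theta> S y = 0" if "S \<in> ?N" for S
  proof -
    have fS: "finite S" using that unfolding leads_def by (auto intro: finite_subset)
    obtain e where "crd \<theta> (insert 0 (S - {0})) y = e * crd \<theta> (S - {0}) z"
      using crd_insert[of "S - {0}" 0 \<theta>] fS unfolding z_def by blast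
    thus ?thesis using that \<open>z = (\<lambda>_. 0)\<close> by (simp add: insert_absorb)
  qed
  let ?W = "wt ` {S\<in>?N. a S \<noteq> 0}"
  have fW: "finite ?W" by (rule finite_imageI, rule finite_subset[OF _ finN]) blast
  have "Max ?W \<in> ?W" by (rule Max_in[OF fW]) (use a(1) in blast)
  then obtain S where "Max ?W = wt S" "S \<in> {S\<in>?N. a S \<noteq> 0}" by (rule imageE)
  hence S: "S \<in> ?N" "a S \<noteq> 0" "wt S = Max ?W" by simp_all
  have Sn: "S \<subseteq> {..<card V}" "card S = r" using S(1) unfolding leads_def by auto
  have "crd \<theta> S y = (\<Sum>T\<in>?N. a T * crd \<theta> S (c T))" unfolding y_def crd_sum ..
  also have "\<dots> = (\<Sum>T\<in>?N. if T = S then a S * crd \<theta> S (c S) else 0)"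
  proof (rule sum.cong[OF refl])
    fix T assume T: "T \<in> ?N"
    show "a T * crd \<theta> S (c T) = (if T = S then a S * crd \<theta> S (c S) else 0)"
    proof (cases "T = S \<or> a T = 0")
      case False
      hence "wt T \<in> ?W" using T by blast
      hence "wt T \<le> wt S" unfolding S(3) by (rule Max_ge[OF fW])
      moreover have "T \<subseteq> {..<card V}" using T unfolding leads_def by auto
      hence "wt T \<noteq> wt S" using wt_inj[OF _ Sn(1)] False by blast
      ultimately have "crd \<theta> S (c T) = 0" by (intro c(3)[OF T Sn]) simp
      thus ?thesis using False by simp
    qed auto
  qed
  also have "\<dots> = a S * crd \<theta> S (c S)" using finN S(1) by (subst sum.delta) auto
  finally show False using crd_y[OF S(1)] S(2) c(2)[OF S(1)] by simp
qed

section \<open>Intersections and completions of leading sets\<close>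

text \<open>The expansion of a product by repeated use of the Leibniz rule. The signs depend on the
  degree of \<open>x\<close> but not on the chains themselves; it matters below only that they are
  nonzero.\<close>

lemma crd_wedge:
  fixes \<theta> :: "nat \<Rightarrow> 'a \<Rightarrow> 'f::field"
  assumes "finite R"
  shows "\<exists>\<epsilon> :: nat \<Rightarrow> nat set \<Rightarrow> 'f. (\<forall>p S. \<epsilon> p S \<in> {1, -1}) \<and>
    (\<forall>p q. \<forall>x\<in>face_chains (Pow V) p. \<forall>y\<in>face_chains (Pow V) q.
      crd \<theta> R (wedge x y) = (\<Sum>S\<in>Pow R. \<epsilon> p S * crd \<theta> S x * crd \<theta> (R - S) y))"
  using assms
proof (induction R rule: finite_induct)
  case empty
  show ?case by (rule exI[of _ "\<lambda>_ _. 1"]) (simp add: crd_def wedge_def join_sign_def)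
next
  case (insert a R)
  obtain \<epsilon> :: "nat \<Rightarrow> nat set \<Rightarrow> 'f" where \<epsilon>: "\<And>p S. \<epsilon> p S \<in> {1, -1}"
    "\<And>p q x y. x \<in> face_chains (Pow V) p \<Longrightarrow> y \<in> face_chains (Pow V) q \<Longrightarrow>
      crd \<theta> R (wedge x y) = (\<Sum>S\<in>Pow R. \<epsilon> p S * crd \<theta> S x * crd \<theta> (R - S) y)"
    using insert.IH by blast
  have "\<forall>S. \<exists>e. e \<in> {1, -1 :: 'f} \<and> (S \<subseteq> R \<longrightarrow> (\<forall>c. crd \<theta> (insert a S) c = e * crd \<theta> S (ctr (\<theta> a) c)))"
  proof
    fix S
    show "\<exists>e. e \<in> {1, -1 :: 'f} \<and> (S \<subseteq> R \<longrightarrow> (\<forall>c. crd \<theta> (insert a S) c = e * crd \<theta> S (ctr (\<theta> a) c)))"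
    proof (cases "S \<subseteq> R")
      case True
      hence "finite S" "a \<notin> S" using insert.hyps finite_subset by auto
      thus ?thesis using crd_insert[of S a \<theta>] by blast
    qed auto
  qed
  from choice[OF this] obtain g where "\<forall>S. g S \<in> {1, -1 :: 'f} \<and>
      (S \<subseteq> R \<longrightarrow> (\<forall>c. crd \<theta> (insert a S) c = g S * crd \<theta> S (ctr (\<theta> a) c)))" by (elim exE)
  hence g: "\<And>S. g S \<in> {1, -1 :: 'f}"
    "\<And>S c. S \<subseteq> R \<Longrightarrow> crd \<theta> (insert a S) c = g S * crd \<theta> S (ctr (\<theta> a) c)"
    by blast+
  have gg: "g S * g S = 1" for S using g(1)[of S] by auto
  have gg': "g S * (g S * z) = z" for S z using gg[of S] by (simp flip: mult.assoc)
  \<comment> \<open>The two cases are the two Leibniz terms: the form \<open>\<theta> a\<close> is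
    applied either to \<open>x\<close> or to \<open>y\<close>.\<close>
  define \<delta> where "\<delta> = (\<lambda>p S. if a \<in> S then g R * \<epsilon> (p - 1) (S - {a}) * g (S - {a})
    else g R * (-1) ^ p * \<epsilon> p S * g (R - S))"
  have pm: "x * y \<in> {1, -1}" if "x \<in> {1, -1 :: 'f}" "y \<in> {1, -1}" for x y using that by auto
  have "(-1) ^ p \<in> {1, -1 :: 'f}" for p by (cases "even p") simp_all
  hence "\<delta> p S \<in> {1, -1}" for p S
    unfolding \<delta>_def using pm g(1) \<epsilon>(1) by (metis (no_types, lifting))
  moreover have "crd \<theta> (insert a R) (wedge x y) = (\<Sum>S\<in>Pow (insert a R). \<delta> p S * crd \<theta> S x * crd \<theta> (insert a R - S) y)"
    if x: "x \<in> face_chains (Pow V) p" and y: "y \<in> face_chains (Pow V) q" for p q x y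
  proof -
    have x': "ctr (\<theta> a) x \<in> face_chains (Pow V) (p - 1)" and y': "ctr (\<theta> a) y \<in> face_chains (Pow V) (q - 1)"
      using ctr_chains_pred[OF x] ctr_chains_pred[OF y] by auto
    have inj: "inj_on (insert a) (Pow R)" using insert.hyps(2) by (intro inj_onI) (metis PowD insert_ident subsetD)
    have "crd \<theta> (insert a R) (wedge x y) = g R * crd \<theta> R (ctr (\<theta> a) (wedge x y))"
      by (rule g(2)) simp
    also have "crd \<theta> R (ctr (\<theta> a) (wedge x y)) =
        crd \<theta> R (wedge (ctr (\<theta> a) x) y) + (-1) ^ p * crd \<theta> R (wedge x (ctr (\<theta> a) y))"
    proof -
      have "crd \<theta> R (\<lambda>T. c T + e * d T) = crd \<theta> R c + e * crd \<theta> R d" for c d e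
        using crd_sum[where J = "{True, False}" and a = "\<lambda>b. if b then 1 else e" and c = "\<lambda>b. if b then c else d"] by simp
      thus ?thesis unfolding ctr_wedge[OF x y] .
    qed
    also have "crd \<theta> R (wedge (ctr (\<theta> a) x) y) = (\<Sum>S\<in>Pow R. \<epsilon> (p - 1) S * crd \<theta> S (ctr (\<theta> a) x) * crd \<theta> (R - S) y)"
      by (rule \<epsilon>(2)[OF x' y])
    also have "crd \<theta> R (wedge x (ctr (\<theta> a) y)) = (\<Sum>S\<in>Pow R. \<epsilon> p S * crd \<theta> S x * crd \<theta> (R - S) (ctr (\<theta> a) y))"
      by (rule \<epsilon>(2)[OF x y'])
    also have "g R * ((\<Sum>S\<in>Pow R. \<epsilon> (p - 1) S * crd \<theta> S (ctr (\<theta> a) x) * crd \<theta> (R - S) y) +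
          (-1) ^ p * (\<Sum>S\<in>Pow R. \<epsilon> p S * crd \<theta> S x * crd \<theta> (R - S) (ctr (\<theta> a) y))) =
        (\<Sum>S\<in>Pow R. \<delta> p (insert a S) * crd \<theta> (insert a S) x * crd \<theta> (insert a R - insert a S) y) +
        (\<Sum>S\<in>Pow R. \<delta> p S * crd \<theta> S x * crd \<theta> (insert a R - S) y)"
      unfolding distrib_left sum_distrib_left
    proof (rule arg_cong2[where f = "(+)"]; rule sum.cong[OF refl])
      fix S assume S: "S \<in> Pow R"
      hence e: "insert a R - insert a S = R - S" "insert a S - {a} = S" "S \<subseteq> R" using insert.hyps by auto
      have "\<delta> p (insert a S) * crd \<theta> (insert a S) x * crd \<theta> (R - S) y =
          g R * (\<epsilon> (p - 1) S * crd \<theta> S (ctr (\<theta> a) x) * crd \<theta> (R - S) y)"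
        unfolding \<delta>_def g(2)[OF e(3)] by (simp add: e(2) mult_ac gg')
      thus "g R * (\<epsilon> (p - 1) S * crd \<theta> S (ctr (\<theta> a) x) * crd \<theta> (R - S) y) =
          \<delta> p (insert a S) * crd \<theta> (insert a S) x * crd \<theta> (insert a R - insert a S) y"
        unfolding e(1) by (rule sym)
    next
      fix S assume S: "S \<in> Pow R"
      hence e: "insert a R - S = insert a (R - S)" "a \<notin> S" "R - S \<subseteq> R" using insert.hyps by auto
      have "\<delta> p S * crd \<theta> S x * crd \<theta> (insert a (R - S)) y =
          g R * ((-1) ^ p * (\<epsilon> p S * crd \<theta> S x * crd \<theta> (R - S) (ctr (\<theta> a) y)))"
        unfolding \<delta>_def g(2)[OF e(3)] using e(2) by (simp add: mult_ac gg')
      thus "g R * ((-1) ^ p * (\<epsilon> p S * crd \<theta> S x * crd \<theta> (R - S) (ctr (\<theta> a) y))) =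
          \<delta> p S * crd \<theta> S x * crd \<theta> (insert a R - S) y"
        unfolding e(1) by (rule sym)
    qed
    also have "\<dots> = (\<Sum>S\<in>Pow (insert a R). \<delta> p S * crd \<theta> S x * crd \<theta> (insert a R - S) y)"
    proof -
      have "Pow R \<inter> insert a ` Pow R = {}" using insert.hyps(2) by auto
      thus ?thesis unfolding Pow_insert using inj insert.hyps(1)
        by (simp only: sum.union_disjoint finite_Pow_iff finite_imageI sum.reindex comp_def add.commute)
    qed
    finally show ?thesis .
  qed
  ultimately show ?case by blast
qed

text \<open>The product of two chains on an intersecting family is 0. If \<open>S\<close> and
  \<open>T\<close> were disjoint, its coordinate at \<open>S \<union> T\<close> would be the product
  of the leading coordinates up to sign: for any other splitting into \<open>r\<close>-sets the
  total weight is the same, so one part is too heavy and contributes 0.\<close>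

lemma leads_intersecting:
  assumes A: "A \<subseteq> Pow V" "\<And>\<sigma> \<tau>. \<sigma> \<in> A \<Longrightarrow> \<tau> \<in> A \<Longrightarrow> \<sigma> \<inter> \<tau> \<noteq> {}"
  shows "intersecting_family (leads \<theta> A r)"
  unfolding intersecting_family_def
proof (intro ballI notI)
  fix S T assume ST: "S \<in> leads \<theta> A r" "T \<in> leads \<theta> A r" and dis: "S \<inter> T = {}"
  obtain x where S: "S \<subseteq> {..<card V}" "card S = r" and x: "x \<in> face_chains A r" "crd \<theta> S x \<noteq> 0"
    "\<forall>U\<subseteq>{..<card V}. card U = r \<longrightarrow> wt S < wt U \<longrightarrow> crd \<theta> U x = 0"
    using ST(1) unfolding leads_def by blast
  obtain y where T: "T \<subseteq> {..<card V}" "card T = r" and y: "y \<in> face_chains A r" "crd \<theta> T y \<noteq> 0"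
    "\<forall>U\<subseteq>{..<card V}. card U = r \<longrightarrow> wt T < wt U \<longrightarrow> crd \<theta> U y = 0"
    using ST(2) unfolding leads_def by blast
  have fin: "finite S" "finite T" using S(1) T(1) finite_subset by blast+
  have "wedge x y R = 0" for R
    unfolding wedge_def
  proof (rule sum.neutral, rule ballI, rule ccontr)
    fix Q assume "join_sign Q (R - Q) * x Q * y (R - Q) \<noteq> 0"
    hence "Q \<in> A" "R - Q \<in> A" using x(1) y(1) unfolding face_chains_def by auto
    thus False using A(2) by blast
  qed
  hence w0: "wedge x y = (\<lambda>_. 0)" by (rule ext)
  let ?R = "S \<union> T"
  have xV: "x \<in> face_chains (Pow V) r" "y \<in> face_chains (Pow V) r" using x(1) y(1) A(1) chains_mono by blast+
  have fR: "finite ?R" using fin by simp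
  obtain \<epsilon> where \<epsilon>: "\<epsilon> r S \<noteq> 0"
    "crd \<theta> ?R (wedge x y) = (\<Sum>Q\<in>Pow ?R. \<epsilon> r Q * crd \<theta> Q x * crd \<theta> (?R - Q) y)"
  proof -
    obtain \<epsilon> where "\<forall>p S. \<epsilon> p S \<in> {1, -1}"
      "crd \<theta> ?R (wedge x y) = (\<Sum>Q\<in>Pow ?R. \<epsilon> r Q * crd \<theta> Q x * crd \<theta> (?R - Q) y)"
      using crd_wedge[OF fR, of \<theta>] xV by blast
    moreover have "\<epsilon> r S \<noteq> 0" using calculation(1)[rule_format, of r S] by auto
    ultimately show thesis using that by blast
  qed
  have "(\<Sum>Q\<in>Pow ?R. \<epsilon> r Q * crd \<theta> Q x * crd \<theta> (?R - Q) y) =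
      (\<Sum>Q\<in>Pow ?R. if Q = S then \<epsilon> r S * crd \<theta> S x * crd \<theta> T y else 0)"
  proof (rule sum.cong[OF refl])
    fix Q assume Q: "Q \<in> Pow ?R"
    have fQ: "finite Q" using Q fR finite_subset by blast
    have Qn: "Q \<subseteq> {..<card V}" using Q S(1) T(1) by blast
    show "\<epsilon> r Q * crd \<theta> Q x * crd \<theta> (?R - Q) y = (if Q = S then \<epsilon> r S * crd \<theta> S x * crd \<theta> T y else 0)"
    proof (cases "Q = S")
      case True
      moreover have "?R - S = T" using dis by blast
      ultimately show ?thesis by simp
    next
      case False
      have "crd \<theta> Q x = 0 \<or> crd \<theta> (?R - Q) y = 0"
      proof (cases "card Q = r \<and> wt Q < wt S")
        case True
        have "wt ?R = wt S + wt T" by (rule wt_Un[OF fin dis])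
        moreover have "wt (Q \<union> (?R - Q)) = wt Q + wt (?R - Q)" by (rule wt_Un) (use fQ fR in auto)
        moreover have "Q \<union> (?R - Q) = ?R" using Q by blast
        ultimately have "wt T < wt (?R - Q)" using True by simp
        moreover have "card (?R - Q) = r"
          using True Q fQ fin S(2) T(2) dis by (simp add: card_Diff_subset card_Un_disjoint)
        moreover have "?R - Q \<subseteq> {..<card V}" using S(1) T(1) by blast
        ultimately show ?thesis using y(3) by blast
      next
        case f: False
        show ?thesis
        proof (cases "card Q = r")
          case True
          hence "wt S < wt Q" using f wt_inj[OF Qn S(1)] False by force
          thus ?thesis using x(3) Qn True by blast
        next
          case False
          thus ?thesis using crd_degree[OF xV(1) fQ] by blast
        qed
      qed
      thus ?thesis using False by auto
    qed
  qed
  also have "\<dots> = \<epsilon> r S * crd \<theta> S x * crd \<theta> T y" using fR by (subst sum.delta) auto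
  finally show False using \<epsilon> w0 x(2) y(2) by simp
qed

text \<open>A chain leading at \<open>T\<close>, which avoids \<open>{..<t}\<close>, has coordinate
  0 at all sets meeting \<open>{..<t}\<close>, since these are heavier. Hence the first
  \<open>t\<close> forms kill it and it lifts; the lift leads at \<open>T \<union> {..<t}\<close>,
  because heavier sets contain \<open>{..<t}\<close> and removing it preserves the
  comparison.\<close>

lemma leads_pure:
  fixes \<theta> :: "nat \<Rightarrow> 'a \<Rightarrow> 'f::field"
  assumes ex: "exact_links TYPE('f) \<Gamma> m"
    and \<Gamma>: "\<Gamma> \<subseteq> Pow V" "\<And>S T. S \<in> \<Gamma> \<Longrightarrow> T \<subseteq> S \<Longrightarrow> T \<in> \<Gamma>" and \<theta>: "general \<theta>"
    and S: "S \<in> leads \<theta> \<Gamma> p" "t \<le> card V" "card ({..<t} \<union> S) \<le> m"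
  shows "{..<t} \<union> S \<in> leads \<theta> \<Gamma> (card ({..<t} \<union> S))"
proof -
  define T where "T = S - {..<t}"
  define s where "s = card T"
  have fS: "finite S" "S \<subseteq> {..<card V}" using S(1) unfolding leads_def by (auto intro: finite_subset)
  have fT: "finite T" "T \<subseteq> {..<card V}" "T \<inter> {..<t} = {}" unfolding T_def using fS by auto
  have un: "{..<t} \<union> S = T \<union> {..<t}" unfolding T_def by blast
  have c_un: "card (T \<union> {..<t}) = s + t" unfolding s_def using card_Un_disjoint[OF fT(1) _ fT(3)] by simp
  have "card S = p" using S(1) unfolding leads_def by blast
  hence "S \<in> leads \<theta> \<Gamma> (card S)" using S(1) by simp
  moreover have "T \<subseteq> S" unfolding T_def by blast
  ultimately have "T \<in> leads \<theta> \<Gamma> s"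
    unfolding s_def by (rule leads_subset[where S = S, OF \<Gamma>(1), rotated]) (erule (1) \<Gamma>(2))
  then obtain c where c: "c \<in> face_chains \<Gamma> s" "crd \<theta> T c \<noteq> 0"
    "\<forall>U\<subseteq>{..<card V}. card U = s \<longrightarrow> wt T < wt U \<longrightarrow> crd \<theta> U c = 0"
    unfolding leads_def by blast
  have kill: "ctr (\<theta> a) c = (\<lambda>_. 0)" if a: "a < t" for a
  proof (cases s)
    case 0
    thus ?thesis using ctr_chains_0[OF _ \<Gamma>(1), of c] c(1) by simp
  next
    case (Suc s')
    have "ctr (\<theta> a) c \<in> face_chains \<Gamma> s'" by (rule ctr_chains[OF _ \<Gamma>(2)]) (use c(1) Suc in auto)
    show ?thesis
    proof (rule crd_eq_0_imp_zero[OF \<theta> chains_mono[OF \<open>ctr (\<theta> a) c \<in> face_chains \<Gamma> s'\<close> \<Gamma>(1)]])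
      fix U :: "nat set" assume U: "U \<subseteq> {..<card V}" "card U = s'"
      have fU: "finite U" using U(1) finite_subset by blast
      show "crd \<theta> U (ctr (\<theta> a) c) = 0"
      proof (cases "a \<in> U")
        case False
        obtain e where e: "e \<in> {1, -1}" "crd \<theta> (insert a U) c = e * crd \<theta> U (ctr (\<theta> a) c)"
          using crd_insert[OF fU False, of \<theta>] by blast
        have "wt T < wt (insert a U)"
          by (rule wt_less_of_small_element[OF fT(2,3) _ _ a]) (use fU in auto)
        moreover have "insert a U \<subseteq> {..<card V}" "card (insert a U) = s"
          using U a S(2) fU False Suc by auto
        ultimately have "crd \<theta> (insert a U) c = 0" using c(3) by blast
        thus ?thesis using e by auto
      qed (simp add: crd_ctr_mem fU)
    qed
  qed
  have "s + t \<le> m" using S(3) unfolding un c_un .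
  then obtain w where w: "w \<in> face_chains \<Gamma> (s + t)" "ctrs \<theta> [0..<t] w = c"
    using contraction_lift[OF ex \<Gamma>(1) _ \<theta> c(1) kill, of t] \<Gamma>(2) by blast
  have set_t: "set [0..<t] = {..<t}" by (simp add: lessThan_atLeast0)
  have crd_w: "\<exists>e\<in>{1, -1 :: 'f}. crd \<theta> (U \<union> {..<t}) w = e * crd \<theta> U c" if U: "finite U" "U \<inter> {..<t} = {}" for U
  proof -
    have "U \<inter> set [0..<t] = {}" unfolding set_t by (rule U(2))
    then obtain e where e: "e \<in> {1, -1 :: 'f}"
      "\<forall>d. crd \<theta> (U \<union> set [0..<t]) d = e * crd \<theta> U (ctrs \<theta> [0..<t] d)"
      using crd_ctrs[OF U(1) distinct_upt, of 0 t \<theta>] by blast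
    show ?thesis by (rule bexI[OF _ e(1)]) (use e(2)[rule_format, of w] in \<open>simp only: set_t w(2)\<close>)
  qed
  show ?thesis unfolding leads_def un c_un
  proof (intro CollectI conjI bexI[OF _ w(1)] allI impI)
    show "card (T \<union> {..<t}) = s + t" by (rule c_un)
    show "T \<union> {..<t} \<subseteq> {..<card V}" using fT(2) S(2) by auto
    show "crd \<theta> (T \<union> {..<t}) w \<noteq> 0" using crd_w[OF fT(1,3)] c(2) by auto
    fix R assume R: "R \<subseteq> {..<card V}" "card R = s + t" "wt (T \<union> {..<t}) < wt R"
    have fR: "finite R" using R(1) finite_subset by blast
    have "{..<t} \<subseteq> R"
    proof (rule ccontr)
      assume "\<not> {..<t} \<subseteq> R"
      hence "wt R < wt (T \<union> {..<t})" by (rule wt_initial_segment[OF R(1)]) (use fT in auto)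
      thus False using R(3) by simp
    qed
    hence eq: "(R - {..<t}) \<union> {..<t} = R" by blast
    let ?U = "R - {..<t}"
    have U: "finite ?U" "?U \<inter> {..<t} = {}" using fR by auto
    have "card R = card ?U + t" using card_Un_disjoint[OF U(1) _ U(2)] unfolding eq by simp
    moreover have "wt R = wt ?U + wt {..<t}" using wt_Un[OF U(1) _ U(2)] unfolding eq by simp
    moreover have "wt (T \<union> {..<t}) = wt T + wt {..<t}" using wt_Un[OF fT(1) _ fT(3)] by simp
    ultimately have "card ?U = s" "wt T < wt ?U" using R(2,3) by auto
    moreover have "?U \<subseteq> {..<card V}" using R(1) by blast
    ultimately have "crd \<theta> ?U c = 0" using c(3) by blast
    thus "crd \<theta> R w = 0" using crd_w[OF U] unfolding eq by auto
  qed
qed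

section \<open>Changing one of the forms\<close>

lemma ctrs_cong: "(\<And>x. x \<in> set xs \<Longrightarrow> \<theta> x = \<eta> x) \<Longrightarrow> ctrs \<theta> xs c = ctrs \<eta> xs c"
  by (induction xs arbitrary: c) simp_all

lemma ctrs_update:
  assumes "distinct xs" "q \<in> set xs"
  shows "ctrs (\<theta>(q := \<lambda>v. \<theta> q v + t * f v)) xs c S = ctrs \<theta> xs c S + t * ctrs (\<theta>(q := f)) xs c S"
  using assms
proof (induction xs arbitrary: c)
  case (Cons x xs)
  show ?case
  proof (cases "x = q")
    case True
    hence q: "q \<notin> set xs" using Cons.prems by simp
    have e: "ctrs (\<theta>(q := g)) xs d = ctrs \<theta> xs d" for g d by (rule ctrs_cong) (use q in auto)
    have add: "ctrs \<theta> xs (\<lambda>S. c S + t * d S) = (\<lambda>S. ctrs \<theta> xs c S + t * ctrs \<theta> xs d S)" for c d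
      using ctrs_sum[where J = "{True, False}" and a = "\<lambda>b. if b then 1 else t" and c = "\<lambda>b. if b then c else d"] by simp
    have "ctr (\<lambda>v. \<theta> q v + t * f v) c = (\<lambda>S. ctr (\<theta> q) c S + t * ctr f c S)"
      by (rule ext) (rule ctr_form)
    thus ?thesis unfolding True by (simp add: fun_upd_same e add del: fun_upd_apply)
  next
    case False
    thus ?thesis using Cons by simp
  qed
qed simp

text \<open>A coordinate is multilinear and alternating in the forms indexed by \<open>T\<close>,
  like a determinant in its rows. A repeated form gives 0, and putting \<open>\<theta> p\<close> for
  \<open>\<theta> q\<close> moves to the set with \<open>q\<close> exchanged for
  \<open>p\<close>.\<close>

lemma crd_update:
  assumes "finite T" "p \<noteq> q"
  shows "q \<notin> T \<Longrightarrow> crd (\<theta>(q := f)) T c = crd \<theta> T c"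
    and "q \<in> T \<Longrightarrow> crd (\<theta>(q := \<lambda>v. \<theta> q v + t * f v)) T c = crd \<theta> T c + t * crd (\<theta>(q := f)) T c"
    and "q \<in> T \<Longrightarrow> p \<in> T \<Longrightarrow> crd (\<theta>(q := \<theta> p)) T c = 0"
    and "q \<in> T \<Longrightarrow> p \<notin> T \<Longrightarrow> \<exists>e\<in>{1, -1}. \<forall>c. crd (\<theta>(q := \<theta> p)) T c = e * crd \<theta> (insert p (T - {q})) c"
proof -
  have 1: "crd (\<theta>(q := f)) T c = crd \<theta> T c" if "q \<notin> T" "finite T" for \<theta> :: "nat \<Rightarrow> 'a \<Rightarrow> 'b" and T f c
    unfolding crd_def by (rule arg_cong[where f = "\<lambda>d. d {}"], rule ctrs_cong) (use that in auto)
  show "crd (\<theta>(q := f)) T c = crd \<theta> T c" if "q \<notin> T" by (rule 1[OF that assms(1)])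
  show "crd (\<theta>(q := \<lambda>v. \<theta> q v + t * f v)) T c = crd \<theta> T c + t * crd (\<theta>(q := f)) T c" if "q \<in> T"
    unfolding crd_def by (rule ctrs_update) (use that assms in auto)
  let ?\<theta> = "\<theta>(q := \<theta> p)"
  show "crd ?\<theta> T c = 0" if T: "q \<in> T" "p \<in> T"
  proof -
    let ?U = "T - {q} - {p}"
    have U: "T = insert q (insert p ?U)" "q \<notin> insert p ?U" "p \<notin> ?U" "finite (insert p ?U)" "finite ?U"
      using T assms by auto
    obtain e where e: "crd ?\<theta> (insert q (insert p ?U)) c = e * crd ?\<theta> (insert p ?U) (ctr (?\<theta> q) c)"
      using crd_insert[OF U(4,2), of ?\<theta>] by blast
    obtain e' where e': "crd ?\<theta> (insert p ?U) (ctr (?\<theta> q) c) = e' * crd ?\<theta> ?U (ctr (?\<theta> p) (ctr (?\<theta> q) c))"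
      using crd_insert[OF U(5,3), of ?\<theta>] by blast
    have "ctr (?\<theta> p) (ctr (?\<theta> q) c) = (\<lambda>_. 0)" using assms(2) by simp
    thus ?thesis using e e' U(1) by simp
  qed
  show "\<exists>e\<in>{1, -1}. \<forall>c. crd ?\<theta> T c = e * crd \<theta> (insert p (T - {q})) c" if T: "q \<in> T" "p \<notin> T"
  proof -
    let ?U = "T - {q}"
    have U: "insert q ?U = T" "finite ?U" "q \<notin> ?U" "p \<notin> ?U" using T assms by auto
    obtain e where e: "e \<in> {1, -1}" "\<forall>c. crd ?\<theta> (insert q ?U) c = e * crd ?\<theta> ?U (ctr (?\<theta> q) c)"
      using crd_insert[OF U(2,3), of ?\<theta>] by blast
    obtain e' where e': "e' \<in> {1, -1}" "\<forall>c. crd \<theta> (insert p ?U) c = e' * crd \<theta> ?U (ctr (\<theta> p) c)"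
      using crd_insert[OF U(2,4), of \<theta>] by blast
    have ee: "e' * e' = 1" using e'(1) by auto
    show ?thesis
    proof (rule bexI[of _ "e * e'"], rule allI)
      fix c
      have "crd ?\<theta> T c = e * crd ?\<theta> ?U (ctr (\<theta> p) c)" using e(2) unfolding U(1) by simp
      also have "\<dots> = e * crd \<theta> ?U (ctr (\<theta> p) c)" unfolding 1[OF U(3,2)] ..
      also have "\<dots> = e * (e' * e') * crd \<theta> ?U (ctr (\<theta> p) c)" unfolding ee by simp
      also have "\<dots> = e * e' * crd \<theta> (insert p ?U) c" using e'(2) by (simp add: mult.assoc)
      finally show "crd ?\<theta> T c = e * e' * crd \<theta> (insert p ?U) c" .
    qed (use e(1) e'(1) in auto)
  qed
qed

text \<open>The forms are chosen one by one on a moment curve, \<open>v\<close> having coefficient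
  \<open>s ^ g v\<close> with \<open>g\<close> injective. Expanding a new minor along its last row
  gives a polynomial in \<open>s\<close> whose coefficients are, up to sign, smaller minors and so
  nonzero. Only finitely many \<open>s\<close> are bad.\<close>

lemma exists_general:
  assumes inf: "infinite (UNIV :: 'f::field set)"
  shows "\<exists>\<theta> :: nat \<Rightarrow> 'a \<Rightarrow> 'f. general \<theta>"
proof -
  obtain g :: "'a \<Rightarrow> nat" where g: "inj_on g V" using finite_imp_inj_to_nat_seg[OF finite_V] by blast
  have "\<exists>\<theta> :: nat \<Rightarrow> 'a \<Rightarrow> 'f. \<forall>\<sigma>\<subseteq>V. card \<sigma> \<le> j \<longrightarrow> ctrs \<theta> [0..<card \<sigma>] (basis_chain \<sigma>) {} \<noteq> 0" for j
  proof (induction j)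
    case 0
    have "\<sigma> = {}" if "\<sigma> \<subseteq> V" "card \<sigma> = 0" for \<sigma> using that finite_V finite_subset by fastforce
    thus ?case by (auto simp: basis_chain_def)
  next
    case (Suc j)
    then obtain \<theta> :: "nat \<Rightarrow> 'a \<Rightarrow> 'f" where \<theta>: "\<And>\<sigma>. \<sigma> \<subseteq> V \<Longrightarrow> card \<sigma> \<le> j \<Longrightarrow> ctrs \<theta> [0..<card \<sigma>] (basis_chain \<sigma>) {} \<noteq> 0"
      by blast
    define x where "x = (\<lambda>\<sigma>. ctrs \<theta> [0..<j] (basis_chain \<sigma>))"
    have x_nz: "x \<sigma> {v} \<noteq> 0" if \<sigma>: "\<sigma> \<subseteq> V" "card \<sigma> = Suc j" "v \<in> \<sigma>" for \<sigma> v
    proof -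
      \<comment> \<open>Contracting with the coordinate form of \<open>v\<close> identifies
        \<open>x \<sigma> {v}\<close>, up to sign, with the minor on the columns
        \<open>\<sigma> - {v}\<close>.\<close>
      define \<delta> where "\<delta> = (\<lambda>u. if u = v then 1 else 0 :: 'f)"
      have ctr_\<delta>: "ctr \<delta> c T = (if T \<subseteq> V \<and> v \<notin> T then incidence_sign v T * c (insert v T) else 0)" for c T
      proof (cases "T \<subseteq> V")
        case True
        have "ctr \<delta> c T = (\<Sum>u\<in>V - T. if u = v then incidence_sign v T * c (insert v T) else 0)"
          using True unfolding ctr_def \<delta>_def by (auto intro!: sum.cong)
        thus ?thesis using True \<sigma> finite_V by auto
      qed (simp add: ctr_def)
      have eq: "ctr \<delta> (basis_chain \<sigma>) = (\<lambda>T. incidence_sign v (\<sigma> - {v}) * basis_chain (\<sigma> - {v}) T)"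
      proof (rule ext)
        fix T
        have \<sigma>v: "\<sigma> - {v} \<subseteq> V" "insert v (\<sigma> - {v}) = \<sigma>" using \<sigma> by blast+
        show "ctr \<delta> (basis_chain \<sigma>) T = incidence_sign v (\<sigma> - {v}) * basis_chain (\<sigma> - {v}) T"
        proof (cases "T = \<sigma> - {v}")
          case True
          thus ?thesis unfolding ctr_\<delta> basis_chain_def using \<sigma>v by simp
        next
          case False
          hence "v \<notin> T \<Longrightarrow> insert v T \<noteq> \<sigma>" by blast
          thus ?thesis unfolding ctr_\<delta> basis_chain_def using False by simp
        qed
      qed
      have c1: "ctrs \<theta> [0..<j] (ctr \<delta> (basis_chain \<sigma>)) =
          (\<lambda>S. incidence_sign v (\<sigma> - {v}) * ctrs \<theta> [0..<j] (basis_chain (\<sigma> - {v})) S)"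
        by (subst eq) (rule ctrs_scale)
      have c2: "ctrs \<theta> [0..<j] (ctr \<delta> (basis_chain \<sigma>)) {} = (-1) ^ j * x \<sigma> {v}"
        unfolding ctrs_ctr x_def by (simp add: ctr_\<delta>)
      have card: "card (\<sigma> - {v}) = j"
        by (simp only: card_Diff_singleton[OF \<sigma>(3)] \<sigma>(2) diff_Suc_1)
      have "\<sigma> - {v} \<subseteq> V" using \<sigma>(1) by blast
      hence "ctrs \<theta> [0..<j] (basis_chain (\<sigma> - {v})) {} \<noteq> 0" using \<theta>[of "\<sigma> - {v}"] unfolding card by blast
      hence "(-1) ^ j * x \<sigma> {v} \<noteq> 0" unfolding c2[symmetric] c1 by simp
      thus ?thesis by (rule contrapos_nn) simp
    qed
    define P where "P = (\<lambda>\<sigma>. \<Sum>v\<in>V. monom (x \<sigma> {v}) (g v))"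
    define Bad where "Bad = (\<Union>\<sigma>\<in>{\<sigma>. \<sigma> \<subseteq> V \<and> card \<sigma> = Suc j}. {s. poly (P \<sigma>) s = 0})"
    have "finite Bad" unfolding Bad_def
    proof (rule finite_UN_I)
      show "finite {\<sigma>. \<sigma> \<subseteq> V \<and> card \<sigma> = Suc j}" using finite_V by simp
      fix \<sigma> assume "\<sigma> \<in> {\<sigma>. \<sigma> \<subseteq> V \<and> card \<sigma> = Suc j}"
      hence \<sigma>: "\<sigma> \<subseteq> V" "card \<sigma> = Suc j" by auto
      then obtain v where v: "v \<in> \<sigma>" by fastforce
      have "coeff (P \<sigma>) (g v) = (\<Sum>u\<in>V. if u = v then x \<sigma> {v} else 0)"
        unfolding P_def coeff_sum coeff_monom
        by (rule sum.cong) (use g v \<sigma>(1) in \<open>auto dest: inj_onD\<close>)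
      also have "\<dots> = x \<sigma> {v}" using finite_V v \<sigma>(1) by auto
      finally have "P \<sigma> \<noteq> 0" using x_nz[OF \<sigma> v] by auto
      thus "finite {s. poly (P \<sigma>) s = 0}" by (rule poly_roots_finite)
    qed
    then obtain s where s: "s \<notin> Bad" using ex_new_if_finite[OF inf] by blast
    define \<eta> where "\<eta> = \<theta>(j := \<lambda>v. s ^ g v)"
    have \<eta>: "ctrs \<eta> [0..<i] c = ctrs \<theta> [0..<i] c" if "i \<le> j" for i c
      by (rule ctrs_cong) (use that in \<open>auto simp: \<eta>_def\<close>)
    show ?case
    proof (rule exI[of _ \<eta>], intro allI impI)
      fix \<sigma> assume \<sigma>: "\<sigma> \<subseteq> V" "card \<sigma> \<le> Suc j"
      show "ctrs \<eta> [0..<card \<sigma>] (basis_chain \<sigma>) {} \<noteq> 0"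
      proof (cases "card \<sigma> \<le> j")
        case True
        thus ?thesis using \<eta>[OF True] \<theta>[OF \<sigma>(1) True] by simp
      next
        case False
        hence c: "card \<sigma> = Suc j" using \<sigma>(2) by simp
        have "ctrs \<eta> [0..<Suc j] (basis_chain \<sigma>) {} = ctr (\<lambda>v. s ^ g v) (x \<sigma>) {}"
          by (simp add: ctrs_append \<eta> x_def) (simp add: \<eta>_def)
        also have "\<dots> = poly (P \<sigma>) s"
          unfolding P_def by (simp add: ctr_def poly_sum poly_monom mult.commute)
        also have "\<dots> \<noteq> 0" using s \<sigma>(1) c unfolding Bad_def by blast
        finally show ?thesis unfolding c .
      qed
    qed
  qed
  from this[of "card V"] show ?thesis unfolding general_def using card_mono[OF finite_V] by blast
qed

text \<open>Each minor is constant or an affine function of \<open>t\<close>, and its value at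
  \<open>t = 0\<close> is a nonzero minor of the old forms.\<close>

lemma general_update:
  fixes \<theta> :: "nat \<Rightarrow> 'a \<Rightarrow> 'f::field"
  assumes \<theta>: "general \<theta>"
  shows "finite {t. \<not> general (\<theta>(q := \<lambda>v. \<theta> q v + t * f v))}"
proof -
  let ?\<theta> = "\<lambda>t. \<theta>(q := \<lambda>v. \<theta> q v + t * f v)"
  have "finite {t. ctrs (?\<theta> t) [0..<card \<sigma>] (basis_chain \<sigma>) {} = 0}" if "\<sigma> \<subseteq> V" for \<sigma>
  proof (cases "q < card \<sigma>")
    case True
    let ?P = "[:ctrs \<theta> [0..<card \<sigma>] (basis_chain \<sigma>) {}, ctrs (\<theta>(q := f)) [0..<card \<sigma>] (basis_chain \<sigma>) {}:]"
    have "?P \<noteq> 0" using \<theta> that unfolding general_def by simp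
    hence "finite {t. poly ?P t = 0}" by (rule poly_roots_finite)
    moreover have "ctrs (?\<theta> t) [0..<card \<sigma>] (basis_chain \<sigma>) {} = poly ?P t" for t
      using True by (subst ctrs_update) auto
    ultimately show ?thesis by simp
  next
    case False
    have "ctrs (?\<theta> t) [0..<card \<sigma>] (basis_chain \<sigma>) = ctrs \<theta> [0..<card \<sigma>] (basis_chain \<sigma>)" for t
      by (rule ctrs_cong) (use False in auto)
    thus ?thesis using \<theta> that unfolding general_def by simp
  qed
  hence "finite (\<Union>\<sigma>\<in>Pow V. {t. ctrs (?\<theta> t) [0..<card \<sigma>] (basis_chain \<sigma>) {} = 0})"
    using finite_V by blast
  thus ?thesis by (rule rev_finite_subset) (auto simp: general_def)
qed

lemma triangular_injective:
  fixes M :: "nat set \<Rightarrow> nat set \<Rightarrow> 'f::field"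
  assumes J: "finite J" "J \<subseteq> Pow {..<card V}" and diag: "\<And>S. S \<in> J \<Longrightarrow> M S S \<noteq> 0"
    and upper: "\<And>S T. S \<in> J \<Longrightarrow> T \<in> J \<Longrightarrow> wt T < wt S \<Longrightarrow> M S T = 0"
    and a: "\<forall>S\<in>J. (\<Sum>T\<in>J. M S T * a T) = 0"
  shows "\<forall>S\<in>J. a S = 0"
proof (rule ccontr)
  assume "\<not> ?thesis"
  hence ne: "{S\<in>J. a S \<noteq> 0} \<noteq> {}" by blast
  let ?W = "wt ` {S\<in>J. a S \<noteq> 0}"
  have fW: "finite ?W" using J(1) by simp
  have "Max ?W \<in> ?W" by (rule Max_in[OF fW]) (use ne in blast)
  then obtain S where "Max ?W = wt S" "S \<in> {S\<in>J. a S \<noteq> 0}" by (rule imageE)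
  hence S: "S \<in> J" "a S \<noteq> 0" "wt S = Max ?W" by simp_all
  have "(\<Sum>T\<in>J. M S T * a T) = (\<Sum>T\<in>J. if T = S then M S S * a S else 0)"
  proof (rule sum.cong[OF refl])
    fix T assume T: "T \<in> J"
    show "M S T * a T = (if T = S then M S S * a S else 0)"
    proof (cases "T = S \<or> a T = 0")
      case False
      hence "wt T \<in> ?W" using T by blast
      hence "wt T \<le> wt S" unfolding S(3) by (rule Max_ge[OF fW])
      moreover have "wt T \<noteq> wt S" using wt_inj[of T S] J(2) T S(1) False by blast
      ultimately have "M S T = 0" by (intro upper[OF S(1) T]) simp
      thus ?thesis using False by simp
    qed auto
  qed
  also have "\<dots> = M S S * a S" using J(1) S(1) by (subst sum.delta) auto
  finally show False using a S diag[OF S(1)] by simp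
qed

text \<open>
  Maximizing the weights of the leading sets makes them shifted: if \<open>S\<close> contains \<open>p\<close> and could be
  improved by \<open>q < p\<close>, then replacing \<open>\<theta> q\<close> by \<open>\<theta> q + t \<theta> p\<close> for almost every \<open>t\<close> produces the
  leading set \<open>insert q (S - {p})\<close> and does not make any other leading set lighter.
\<close>

lemma exists_shifted_leads:
  assumes inf: "infinite (UNIV :: 'f::field set)" and A: "A \<subseteq> Pow V"
  shows "\<exists>\<theta> :: nat \<Rightarrow> 'a \<Rightarrow> 'f. general \<theta> \<and> shifted (leads \<theta> A r)"
proof -
  define N where "N = Suc (wt {..<card V})"
  define above where "above = (\<lambda>(\<theta> :: nat \<Rightarrow> 'a \<Rightarrow> 'f) u. {S\<in>leads \<theta> A r. u \<le> wt S})"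
  \<comment> \<open>In effect the sum of \<open>wt S + 1\<close> over the leading sets. Writing it
    by thresholds \<open>u\<close> allows each summand to be compared by a dimension count.\<close>
  define score where "score = (\<lambda>\<theta>. \<Sum>u<N. card (above \<theta> u))"
  have lead_sub: "leads \<theta> A r \<subseteq> Pow {..<card V}" for \<theta> :: "nat \<Rightarrow> 'a \<Rightarrow> 'f" unfolding leads_def by auto
  have fin_above: "finite (above \<theta> u)" for \<theta> u unfolding above_def using finite_leads[of \<theta> A r] by simp
  have "score \<theta> < Suc (N * 2 ^ card V)" for \<theta>
  proof -
    have "card (above \<theta> u) \<le> 2 ^ card V" for u
    proof -
      have "above \<theta> u \<subseteq> Pow {..<card V}" using lead_sub[of \<theta>] unfolding above_def by blast
      hence "card (above \<theta> u) \<le> card (Pow {..<card V})" by (intro card_mono) simp_all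
      thus ?thesis by (simp add: card_Pow)
    qed
    hence "score \<theta> \<le> (\<Sum>u<N. 2 ^ card V)" unfolding score_def by (intro sum_mono)
    thus ?thesis by simp
  qed
  moreover obtain \<theta>0 :: "nat \<Rightarrow> 'a \<Rightarrow> 'f" where "general \<theta>0" using exists_general[OF inf] by blast
  ultimately obtain \<theta> :: "nat \<Rightarrow> 'a \<Rightarrow> 'f" where \<theta>: "general \<theta>" and
    max: "\<And>\<eta>. general \<eta> \<Longrightarrow> score \<eta> \<le> score \<theta>"
    using ex_has_greatest_nat[of general \<theta>0 score "Suc (N * 2 ^ card V)"] by blast
  let ?L = "leads \<theta> A r"
  have finL: "finite ?L" by (rule finite_leads)
  have "shifted ?L"
    unfolding shifted_def
  proof (intro ballI allI impI, rule ccontr)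
    fix S p q assume S: "S \<in> ?L" "p \<in> S" and q: "q < p" "q \<notin> S" and nin: "insert q (S - {p}) \<notin> ?L"
    define S' where "S' = insert q (S - {p})"
    have Sn: "S \<subseteq> {..<card V}" "card S = r" using S(1) unfolding leads_def by auto
    have fS: "finite S" using Sn(1) finite_subset by blast
    have S'n: "S' \<subseteq> {..<card V}" using Sn(1) S(2) q(1) unfolding S'_def by auto
    have pV: "p < card V" using Sn(1) S(2) by blast
    have c_exch: "card (insert b (T - {a})) = card T" and w_exch: "wt (insert b (T - {a})) + 2 ^ (card V - a) = wt T + 2 ^ (card V - b)"
      if "finite T" "a \<in> T" "b \<notin> T" for a b T
    proof -
      have "finite (T - {a})" "b \<notin> T - {a}" "T = insert a (T - {a})" using that by auto
      thus "wt (insert b (T - {a})) + 2 ^ (card V - a) = wt T + 2 ^ (card V - b)"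
        using wt_insert[of "T - {a}" b] wt_insert[of "T - {a}" a] by simp
      show "card (insert b (T - {a})) = card T" using that by (metis card_insert_disjoint card_Suc_Diff1 finite_Diff DiffE)
    qed
    have S'r: "card S' = r" unfolding S'_def using c_exch[OF fS S(2) q(2)] Sn(2) by simp
    have heavier: "wt S < wt S'"
    proof -
      have "(2 :: nat) ^ (card V - p) < 2 ^ (card V - q)" using q(1) pV by simp
      thus ?thesis using w_exch[OF fS S(2) q(2)] unfolding S'_def by linarith
    qed
    have "\<forall>T. \<exists>c. T \<in> ?L \<longrightarrow> (c \<in> face_chains A r \<and> crd \<theta> T c \<noteq> 0 \<and>
        (\<forall>U\<subseteq>{..<card V}. card U = r \<longrightarrow> wt T < wt U \<longrightarrow> crd \<theta> U c = 0))"
      unfolding leads_def by blast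
    from choice[OF this] obtain c where "\<forall>T. T \<in> ?L \<longrightarrow> (c T \<in> face_chains A r \<and> crd \<theta> T (c T) \<noteq> 0 \<and>
        (\<forall>U\<subseteq>{..<card V}. card U = r \<longrightarrow> wt T < wt U \<longrightarrow> crd \<theta> U (c T) = 0))" by (elim exE)
    hence c: "\<And>T. T \<in> ?L \<Longrightarrow> c T \<in> face_chains A r" "\<And>T. T \<in> ?L \<Longrightarrow> crd \<theta> T (c T) \<noteq> 0"
      "\<And>T U. T \<in> ?L \<Longrightarrow> U \<subseteq> {..<card V} \<Longrightarrow> card U = r \<Longrightarrow> wt T < wt U \<Longrightarrow> crd \<theta> U (c T) = 0"
      by blast+
    define \<eta> where "\<eta> = (\<lambda>t. \<theta>(q := \<lambda>v. \<theta> q v + t * \<theta> p v))"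
    define M1 where "M1 = (\<lambda>T d. if q \<in> T then crd (\<theta>(q := \<theta> p)) T d else 0)"
    have pq: "p \<noteq> q" using q(1) by simp
    have crd_\<eta>: "crd (\<eta> t) T d = crd \<theta> T d + t * M1 T d" if "finite T" for t T d
      unfolding \<eta>_def M1_def using crd_update(1,2)[OF that pq] by auto
    define singular where "singular = (\<lambda>J t. \<exists>a. (\<forall>T\<in>J. (\<Sum>U\<in>J. crd (\<eta> t) T (c U) * a U) = 0) \<and> (\<exists>U\<in>J. a U \<noteq> 0))"
    \<comment> \<open>At \<open>t = 0\<close> the matrix is triangular for the order by weight,
      since \<open>c U\<close> has no coordinate heavier than \<open>U\<close>, and its diagonal is
      nonzero.\<close>
    have fin_singular: "finite {t. singular J t}" if J: "J \<subseteq> ?L" for J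
    proof -
      have fJ: "finite J" using J finL finite_subset by blast
      have JP: "J \<subseteq> Pow {..<card V}" using J lead_sub by blast
      have "finite {t. \<exists>a. (\<forall>T\<in>J. (\<Sum>U\<in>J. (crd \<theta> T (c U) + t * M1 T (c U)) * a U) = 0) \<and> (\<exists>U\<in>J. a U \<noteq> 0)}"
      proof (rule finite_singular_parameters[OF fJ])
        fix a assume "\<forall>T\<in>J. (\<Sum>U\<in>J. crd \<theta> T (c U) * a U) = 0"
        moreover have "crd \<theta> T (c U) = 0" if "T \<in> J" "U \<in> J" "wt U < wt T" for T U
          by (rule c(3)) (use that J in \<open>auto simp: leads_def\<close>)
        ultimately show "\<forall>U\<in>J. a U = 0"
          using triangular_injective[OF fJ JP, of "\<lambda>T U. crd \<theta> T (c U)" a] c(2) J by blast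
      qed
      moreover have "finite T" if "T \<in> J" for T using that JP finite_subset by blast
      ultimately show ?thesis unfolding singular_def by (simp add: crd_\<eta>)
    qed
    \<comment> \<open>One \<open>t\<close> has to serve all thresholds, so every subset
      \<open>J\<close> of the leading sets is tested. Excluding 0 is what makes the new coordinate
      at \<open>S'\<close> nonzero.\<close>
    define Bad where "Bad = {0} \<union> {t. \<not> general (\<eta> t)} \<union> (\<Union>J\<in>Pow ?L. {t. singular J t})"
    have "finite {t. \<not> general (\<eta> t)}" unfolding \<eta>_def by (rule general_update[OF \<theta>])
    hence "finite Bad" unfolding Bad_def using finL fin_singular by simp
    then obtain t where t: "t \<notin> Bad" using ex_new_if_finite[OF inf] by blast
    have t0: "t \<noteq> 0" and gen: "general (\<eta> t)" and nonsing: "\<And>J. J \<subseteq> ?L \<Longrightarrow> \<not> singular J t"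
      using t unfolding Bad_def by auto
    \<comment> \<open>The heaviest nonzero coordinate of \<open>d\<close> would sit at a leading
      set, so vanishing at the leading sets above the threshold already means vanishing everywhere
      above it.\<close>
    have vanish: "crd (\<eta> t) T d = 0" if d: "d \<in> face_chains A r" "\<forall>U\<in>above (\<eta> t) u. crd (\<eta> t) U d = 0"
      and T: "T \<subseteq> {..<card V}" "card T = r" "u \<le> wt T" for d u T
    proof (rule ccontr)
      assume "crd (\<eta> t) T d \<noteq> 0"
      then obtain U where "U \<in> leads (\<eta> t) A r" "wt T \<le> wt U" "crd (\<eta> t) U d \<noteq> 0"
        using exists_lead[OF d(1) T(1,2)] by blast
      thus False using d(2) T(3) unfolding above_def by auto
    qed
    have above_L: "above \<theta> u \<subseteq> ?L" for u unfolding above_def by blast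
    have mono: "card (above \<theta> u) \<le> card (above (\<eta> t) u)" for u
    proof (rule ccontr)
      assume "\<not> ?thesis"
      hence lt: "card (above (\<eta> t) u) < card (above \<theta> u)" by simp
      let ?J = "above \<theta> u"
      obtain a where a: "\<exists>U\<in>?J. a U \<noteq> 0" "\<forall>T\<in>above (\<eta> t) u. (\<Sum>U\<in>?J. crd (\<eta> t) T (c U) * a U) = 0"
        using underdetermined_system[OF fin_above fin_above lt, of "\<lambda>T U. crd (\<eta> t) T (c U)"] by blast
      define d where "d = (\<lambda>\<sigma>. \<Sum>U\<in>?J. a U * c U \<sigma>)"
      have d: "d \<in> face_chains A r" unfolding d_def by (rule chains_sum) (use c(1) above_L in blast)
      have crd_d: "crd (\<eta> t) T d = (\<Sum>U\<in>?J. crd (\<eta> t) T (c U) * a U)" for T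
        unfolding d_def crd_sum by (simp add: mult.commute)
      have "crd (\<eta> t) T d = 0" if "T \<in> ?J" for T
        by (rule vanish[OF d, of u]) (use a(2) crd_d that in \<open>auto simp: above_def leads_def\<close>)
      hence "singular ?J t" unfolding singular_def crd_d using a(1) by blast
      thus False using nonsing[OF above_L] by blast
    qed
    \<comment> \<open>With the new forms \<open>c S\<close> acquires a coordinate at
      \<open>S'\<close>: up to sign, \<open>t\<close> times its old coordinate at \<open>S\<close>.
      It has none at other sets of at least that weight, so it adds a dimension above the threshold
      \<open>wt S'\<close>.\<close>
    have strict: "card (above \<theta> (wt S')) < card (above (\<eta> t) (wt S'))"
    proof (rule ccontr)
      let ?J = "above \<theta> (wt S')"
      assume "\<not> ?thesis"
      moreover have SJ: "S \<notin> ?J" using heavier unfolding above_def by simp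
      ultimately have lt: "card (above (\<eta> t) (wt S')) < card (insert S ?J)" using fin_above by simp
      have fJ: "finite (insert S ?J)" using fin_above by simp
      obtain a where a: "\<exists>U\<in>insert S ?J. a U \<noteq> 0"
        "\<forall>T\<in>above (\<eta> t) (wt S'). (\<Sum>U\<in>insert S ?J. crd (\<eta> t) T (c U) * a U) = 0"
        using underdetermined_system[OF fin_above fJ lt, of "\<lambda>T U. crd (\<eta> t) T (c U)"] by blast
      define d where "d = (\<lambda>\<sigma>. \<Sum>U\<in>insert S ?J. a U * c U \<sigma>)"
      have d: "d \<in> face_chains A r" unfolding d_def by (rule chains_sum) (use c(1) above_L S(1) in blast)
      have crd_d: "crd (\<eta> t) T d = (\<Sum>U\<in>insert S ?J. crd (\<eta> t) T (c U) * a U)" for T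
        unfolding d_def crd_sum by (simp add: mult.commute)
      have crd_d': "crd (\<eta> t) T d = crd (\<eta> t) T (c S) * a S + (\<Sum>U\<in>?J. crd (\<eta> t) T (c U) * a U)" for T
        unfolding crd_d using fin_above SJ by simp
      have d0: "crd (\<eta> t) T d = 0" if "T \<subseteq> {..<card V}" "card T = r" "wt S' \<le> wt T" for T
        by (rule vanish[OF d _ that]) (use a(2) crd_d in simp)
      \<comment> \<open>The added term at \<open>T\<close> is the old coordinate of
        \<open>c S\<close> at \<open>T\<close> with \<open>q\<close> exchanged for \<open>p\<close>.
        That exchange lowers the weight of \<open>T\<close> by as much as it lowers
        \<open>S'\<close> to \<open>S\<close>, so the result is still heavier than
        \<open>S\<close>.\<close>
      have S0: "crd (\<eta> t) T (c S) = 0" if T: "T \<subseteq> {..<card V}" "card T = r" "wt S' \<le> wt T" "T \<noteq> S'" for T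
      proof -
        have fT: "finite T" using T(1) finite_subset by blast
        have "crd \<theta> T (c S) = 0" by (rule c(3)[OF S(1) T(1,2)]) (use heavier T(3) in simp)
        moreover have "M1 T (c S) = 0"
        proof (cases "q \<in> T \<and> p \<notin> T")
          case True
          let ?T = "insert p (T - {q})"
          obtain e where e: "crd (\<theta>(q := \<theta> p)) T (c S) = e * crd \<theta> ?T (c S)"
            using crd_update(4)[OF fT pq, of \<theta>] True by blast
          have "wt S' < wt T" using T(3,4) wt_inj[OF T(1) S'n] by force
          moreover have "wt ?T + 2 ^ (card V - q) = wt T + 2 ^ (card V - p)" using w_exch[OF fT, of q p] True by blast
          moreover have "wt S' + 2 ^ (card V - p) = wt S + 2 ^ (card V - q)"
            using w_exch[OF fS S(2) q(2)] unfolding S'_def by simp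
          ultimately have "wt S < wt ?T" by linarith
          moreover have "?T \<subseteq> {..<card V}" using T(1) pV by auto
          moreover have "card ?T = r" using c_exch[OF fT, of q p] True T(2) by simp
          ultimately have "crd \<theta> ?T (c S) = 0" by (intro c(3)[OF S(1)])
          thus ?thesis unfolding M1_def e by simp
        next
          case False
          thus ?thesis unfolding M1_def using crd_update(3)[OF fT pq, of \<theta> "c S"] by auto
        qed
        ultimately show ?thesis unfolding crd_\<eta>[OF fT] by simp
      qed
      have "\<forall>T\<in>?J. (\<Sum>U\<in>?J. crd (\<eta> t) T (c U) * a U) = 0"
      proof
        fix T assume T: "T \<in> ?J"
        hence Tn: "T \<subseteq> {..<card V}" "card T = r" "wt S' \<le> wt T" unfolding above_def leads_def by auto
        have "T \<noteq> S'" using T nin unfolding above_def S'_def by blast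
        thus "(\<Sum>U\<in>?J. crd (\<eta> t) T (c U) * a U) = 0" using d0[OF Tn] S0[OF Tn] unfolding crd_d' by simp
      qed
      hence aJ: "\<forall>U\<in>?J. a U = 0" using nonsing[OF above_L] unfolding singular_def by blast
      hence aS: "a S \<noteq> 0" using a(1) by auto
      have fS': "finite S'" using S'n finite_subset by blast
      have "crd (\<eta> t) S' (c S) * a S = 0" using d0[OF S'n S'r] aJ unfolding crd_d' by simp
      hence "crd (\<eta> t) S' (c S) = 0" using aS by simp
      moreover have "crd \<theta> S' (c S) = 0" by (rule c(3)[OF S(1) S'n S'r heavier])
      ultimately have "M1 S' (c S) = 0" using t0 unfolding crd_\<eta>[OF fS'] by simp
      moreover have "q \<in> S'" "p \<notin> S'" unfolding S'_def using pq by auto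
      moreover obtain e where "e \<in> {1, -1}" "crd (\<theta>(q := \<theta> p)) S' (c S) = e * crd \<theta> (insert p (S' - {q})) (c S)"
        using crd_update(4)[OF fS' pq, of \<theta>] calculation(2,3) by blast
      moreover have "insert p (S' - {q}) = S" unfolding S'_def using S(2) q(2) by auto
      ultimately show False using c(2)[OF S(1)] unfolding M1_def by auto
    qed
    have "wt S' < N" unfolding N_def using wt_mono[OF _ S'n] by (simp add: le_imp_less_Suc)
    hence "score \<theta> < score (\<eta> t)" unfolding score_def
      by (intro sum_strict_mono_ex1) (use mono strict in auto)
    thus False using max[OF gen] by simp
  qed
  thus ?thesis using \<theta> by blast
qed

end

section \<open>Extension of scalars and reduced homology\<close>

lemma infinite_UNIV_fls: "infinite (UNIV :: 'f::field fls set)"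
proof
  assume "finite (UNIV :: 'f fls set)"
  hence "finite (range (\<lambda>n. fls_X_intpow n :: 'f fls))" by (rule rev_finite_subset) simp
  moreover have "inj (\<lambda>n. fls_X_intpow n :: 'f fls)"
  proof (rule injI)
    fix m n assume "(fls_X_intpow m :: 'f fls) = fls_X_intpow n"
    hence "fls_nth (fls_X_intpow m :: 'f fls) m = fls_nth (fls_X_intpow n) m" by simp
    thus "m = n" by (simp split: if_splits)
  qed
  ultimately have "finite (UNIV :: int set)" by (rule finite_imageD)
  thus False by simp
qed

lemma fls_nth_incidence_sign:
  fixes x :: "'f::field fls"
  shows "fls_nth (incidence_sign v T * x) i = incidence_sign v T * fls_nth x i"
proof (cases "even (card {u \<in> T. u \<noteq> v \<and> (u, v) \<in> vertex_order})")
  case True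
  hence "incidence_sign v T = (1 :: 'f fls)" "incidence_sign v T = (1 :: 'f)"
    unfolding incidence_sign_def by simp_all
  thus ?thesis by simp
next
  case False
  hence "incidence_sign v T = (- 1 :: 'f fls)" "incidence_sign v T = (- 1 :: 'f)"
    unfolding incidence_sign_def by simp_all
  thus ?thesis by simp
qed

context vertex_set
begin

lemma fls_nth_ctr: "fls_nth (ctr (\<lambda>_. 1) c T) i = ctr (\<lambda>_. 1) (\<lambda>S. fls_nth (c S) i) T"
  unfolding ctr_def by (simp add: fls_nth_sum fls_nth_incidence_sign)

text \<open>
  The scalars are enlarged to Laurent series only to have an infinite field. Exactness is
  inherited coefficientwise.
\<close>

lemma exact_links_fls:
  assumes ex: "exact_links TYPE('f::field) \<Gamma> m" and \<Gamma>: "\<Gamma> \<subseteq> Pow V"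
  shows "exact_links TYPE('f fls) \<Gamma> m"
  unfolding exact_links_def
proof (intro ballI allI impI)
  fix \<sigma> k and z :: "'a set \<Rightarrow> 'f fls"
  assume \<sigma>: "\<sigma> \<in> \<Gamma>" and z: "z \<in> face_chains (face_link \<Gamma> \<sigma>) k" and k: "Suc k + card \<sigma> \<le> m"
    and z0: "ctr (\<lambda>_. 1) z = (\<lambda>_. 0)"
  \<comment> \<open>A zero coefficient gets the preimage zero. Hence \<open>B i\<close> vanishes
    below the least order \<open>N\<close> occurring in \<open>z\<close>, as is required for the
    \<open>B i\<close> to be the coefficients of Laurent series.\<close>
  have ex_b: "\<exists>b. b \<in> face_chains (face_link \<Gamma> \<sigma>) (Suc k) \<and> ctr (\<lambda>_. 1) b = (\<lambda>S. fls_nth (z S) i) \<and>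
      ((\<lambda>S. fls_nth (z S) i) = (\<lambda>_. 0) \<longrightarrow> b = (\<lambda>_. 0))" for i
  proof (cases "(\<lambda>S. fls_nth (z S) i) = (\<lambda>_. 0)")
    case True
    thus ?thesis by (intro exI[of _ "\<lambda>_. 0"]) simp
  next
    case False
    have "(\<lambda>S. fls_nth (z S) i) \<in> face_chains (face_link \<Gamma> \<sigma>) k"
      unfolding face_chains_def
    proof (intro CollectI allI impI)
      fix S assume "fls_nth (z S) i \<noteq> 0"
      hence "z S \<noteq> 0" by auto
      thus "S \<in> face_link \<Gamma> \<sigma> \<and> card S = k" using z unfolding face_chains_def by blast
    qed
    moreover have "ctr (\<lambda>_. 1) (\<lambda>S. fls_nth (z S) i) = (\<lambda>_. 0)"
      unfolding fls_nth_ctr[symmetric] z0 by simp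
    ultimately show ?thesis using ex \<sigma> k False unfolding exact_links_def by blast
  qed
  hence "\<forall>i. \<exists>b. b \<in> face_chains (face_link \<Gamma> \<sigma>) (Suc k) \<and> ctr (\<lambda>_. 1) b = (\<lambda>S. fls_nth (z S) i) \<and>
      ((\<lambda>S. fls_nth (z S) i) = (\<lambda>_. 0) \<longrightarrow> b = (\<lambda>_. 0))" by (rule allI)
  from choice[OF this] obtain B where "\<forall>i. B i \<in> face_chains (face_link \<Gamma> \<sigma>) (Suc k) \<and>
      ctr (\<lambda>_. 1) (B i) = (\<lambda>S. fls_nth (z S) i) \<and> ((\<lambda>S. fls_nth (z S) i) = (\<lambda>_. 0) \<longrightarrow> B i = (\<lambda>_. 0))"
    by (elim exE)
  hence B: "\<And>i. B i \<in> face_chains (face_link \<Gamma> \<sigma>) (Suc k)" "\<And>i. ctr (\<lambda>_. 1) (B i) = (\<lambda>S. fls_nth (z S) i)"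
    "\<And>i. (\<lambda>S. fls_nth (z S) i) = (\<lambda>_. 0) \<Longrightarrow> B i = (\<lambda>_. 0)" by simp_all
  have link: "face_link \<Gamma> \<sigma> \<subseteq> Pow V" using \<Gamma> unfolding face_link_def by blast
  define N where "N = Min (fls_subdegree ` z ` Pow V)"
  have low: "B i = (\<lambda>_. 0)" if "i < N" for i
  proof (rule B(3), rule ext)
    fix S
    show "fls_nth (z S) i = 0"
    proof (cases "S \<subseteq> V")
      case True
      have "N \<le> fls_subdegree (z S)" unfolding N_def by (rule Min_le) (use True finite_V in auto)
      thus ?thesis using that by (intro fls_eq0_below_subdegree) simp
    next
      case False
      hence "z S = 0" using z link unfolding face_chains_def by blast
      thus ?thesis by simp
    qed
  qed
  define b where "b = (\<lambda>S. Abs_fls (\<lambda>i. B i S))"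
  have nth_b: "fls_nth (b S) i = B i S" for S i
  proof -
    have "\<forall>n<N. B n S = 0" using low by simp
    thus ?thesis unfolding b_def by (rule nth_Abs_fls_lower_bound)
  qed
  have "ctr (\<lambda>_. 1) b = z"
    by (rule ext, rule fls_eqI) (simp add: fls_nth_ctr nth_b B(2))
  moreover have "b \<in> face_chains (face_link \<Gamma> \<sigma>) (Suc k)" unfolding face_chains_def
  proof (intro CollectI allI impI)
    fix S assume "b S \<noteq> 0"
    have "\<exists>i. fls_nth (b S) i \<noteq> 0"
    proof (rule ccontr)
      assume "\<nexists>i. fls_nth (b S) i \<noteq> 0"
      hence "b S = 0" by (intro fls_eqI) simp
      thus False using \<open>b S \<noteq> 0\<close> by simp
    qed
    then obtain i where "fls_nth (b S) i \<noteq> 0" by blast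
    thus "S \<in> face_link \<Gamma> \<sigma> \<and> card S = Suc k" using B(1)[of i] unfolding nth_b face_chains_def by blast
  qed
  ultimately show "\<exists>b\<in>face_chains (face_link \<Gamma> \<sigma>) (Suc k). ctr (\<lambda>_. 1) b = z" by blast
qed

end

section \<open>From reduced homology to exact chains\<close>

lemma trivial_homology_exact:
  assumes triv: "trivial_group (reduced_face_homology \<Delta> i :: ('a set \<Rightarrow> 'f::field) set monoid)"
    and c: "c \<in> carrier (face_chain_group \<Delta> i)" "face_boundary \<Delta> c = (\<lambda>_. 0 :: 'f)"
  shows "\<exists>b\<in>carrier (face_chain_group \<Delta> (i + 1)). face_boundary \<Delta> b = c"
proof -
  let ?C = "face_chain_group \<Delta> :: int \<Rightarrow> ('a set \<Rightarrow> 'f) monoid"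
  let ?Z = "(?C i)\<lparr>carrier := kernel (?C i) (?C (i - 1)) (face_boundary \<Delta>)\<rparr>"
  let ?H = "face_boundary \<Delta> ` carrier (?C (i + 1))"
  have cZ: "c \<in> carrier ?Z" using c unfolding kernel_def by (simp add: face_chain_group_def)
  have "(\<lambda>_. 0) \<in> carrier (?C (i + 1))" by (simp add: face_chain_group_def)
  moreover have "face_boundary \<Delta> (\<lambda>_. 0) = (\<lambda>_. 0 :: 'f)" by (auto simp: face_boundary_def)
  ultimately have z: "(\<lambda>_. 0) \<in> ?H" by (metis imageI)
  have "?H #>\<^bsub>?Z\<^esub> c \<in> carrier (?Z Mod ?H)" using cZ unfolding FactGroup_def RCOSETS_def by auto
  moreover have "carrier (?Z Mod ?H) = {\<one>\<^bsub>?Z Mod ?H\<^esub>}"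
    using triv unfolding reduced_face_homology_def trivial_group_def by blast
  moreover have "\<one>\<^bsub>?Z Mod ?H\<^esub> = ?H" unfolding FactGroup_def by simp
  ultimately have "?H #>\<^bsub>?Z\<^esub> c = ?H" by blast
  moreover have "(\<lambda>S. 0 + c S) \<in> ?H #>\<^bsub>?Z\<^esub> c"
    unfolding r_coset_def by (rule UN_I[OF z]) (simp add: face_chain_group_def)
  ultimately have "c \<in> ?H" by simp
  thus ?thesis by blast
qed

text \<open>Purity supplies the dimension of the link: a face with \<open>m\<close> vertices over
  \<open>\<sigma>\<close> leaves a face of the link with \<open>m - card \<sigma>\<close> vertices,
  so \<open>Suc k + card \<sigma> \<le> m\<close> puts the cycle below the top degree.\<close>

lemma cohen_macaulay_exact_links:
  assumes V: "vertex_set V" and \<Gamma>: "\<Gamma> \<subseteq> Pow V" "\<And>S T. S \<in> \<Gamma> \<Longrightarrow> T \<subseteq> S \<Longrightarrow> T \<in> \<Gamma>"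
    and pure: "\<And>\<sigma>. \<sigma> \<in> \<Gamma> \<Longrightarrow> \<exists>\<tau>\<in>\<Gamma>. \<sigma> \<subseteq> \<tau> \<and> card \<tau> = m"
    and cm: "cohen_macaulay TYPE('f::field) \<Gamma>"
  shows "vertex_set.exact_links V TYPE('f) \<Gamma> m"
proof -
  interpret vertex_set V by (rule V)
  show ?thesis unfolding exact_links_def
  proof (intro ballI allI impI)
    fix \<sigma> k and z :: "'a set \<Rightarrow> 'f"
    assume \<sigma>: "\<sigma> \<in> \<Gamma>" and z: "z \<in> face_chains (face_link \<Gamma> \<sigma>) k" "ctr (\<lambda>_. 1) z = (\<lambda>_. 0)"
      and k: "Suc k + card \<sigma> \<le> m"
    let ?L = "face_link \<Gamma> \<sigma>"
    have LV: "?L \<subseteq> Pow V" using \<Gamma>(1) unfolding face_link_def by blast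
    have finL: "finite ?L" using LV finite_V by (auto intro: finite_subset)
    have down: "T \<in> ?L" if "S \<in> ?L" "T \<subseteq> S" for S T
      using that \<Gamma>(2)[of "S \<union> \<sigma>" "T \<union> \<sigma>"] unfolding face_link_def by blast
    have vL: "vertices ?L \<subseteq> V" using LV unfolding vertices_def by blast
    \<comment> \<open>\<open>face_boundary\<close> sums over the vertices of the link and
      \<open>ctr\<close> over all of \<open>V\<close>; the extra terms vanish because the chain is
      supported on the link.\<close>
    have bdry: "face_boundary ?L c = ctr (\<lambda>_. 1) c" if c: "c \<in> face_chains ?L p" for c :: "'a set \<Rightarrow> 'f" and p
    proof (rule ext)
      fix T
      have c0: "c (insert v T) = 0" if "v \<notin> vertices ?L \<or> \<not> T \<subseteq> V" for v
      proof (rule ccontr)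
        assume "c (insert v T) \<noteq> 0"
        hence "insert v T \<in> ?L" using c unfolding face_chains_def by blast
        thus False using that LV unfolding vertices_def by blast
      qed
      show "face_boundary ?L c T = ctr (\<lambda>_. 1) c T"
      proof (cases "T \<subseteq> V")
        case True
        have "(\<Sum>v\<in>vertices ?L - T. incidence_sign v T * c (insert v T)) = (\<Sum>v\<in>V - T. incidence_sign v T * c (insert v T))"
          by (rule sum.mono_neutral_left) (use finite_V vL c0 in auto)
        thus ?thesis using True by (simp add: face_boundary_def ctr_def)
      qed (simp add: face_boundary_def ctr_def c0)
    qed
    have grp: "carrier (face_chain_group ?L (int p - 1)) = (face_chains ?L p :: ('a set \<Rightarrow> 'f) set)" for p
      unfolding face_chain_group_def face_chains_def face_dim_def by auto
    obtain \<tau> where \<tau>: "\<tau> \<in> \<Gamma>" "\<sigma> \<subseteq> \<tau>" "card \<tau> = m" using pure[OF \<sigma>] by blast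
    have f\<tau>: "finite \<tau>" using \<tau>(1) \<Gamma>(1) finite_V finite_subset by blast
    have "\<tau> - \<sigma> \<in> ?L" using \<tau>(1,2) unfolding face_link_def by (auto simp: Un_absorb2)
    moreover have "card (\<tau> - \<sigma>) = m - card \<sigma>" using \<tau> f\<tau> by (simp add: card_Diff_subset finite_subset)
    hence "face_dim (\<tau> - \<sigma>) = int m - int (card \<sigma>) - 1" using k unfolding face_dim_def by simp
    ultimately have "int m - int (card \<sigma>) - 1 \<le> complex_dim ?L"
      unfolding complex_dim_def using Max_ge[OF finite_imageI[OF finL] imageI[of "\<tau> - \<sigma>" ?L face_dim]] by simp
    hence "int k - 1 < complex_dim ?L" using k by simp
    hence "trivial_group (reduced_face_homology ?L (int k - 1) :: ('a set \<Rightarrow> 'f) set monoid)"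
      using cm \<sigma> unfolding cohen_macaulay_def by blast
    moreover have "z \<in> carrier (face_chain_group ?L (int k - 1))" unfolding grp by (rule z(1))
    moreover have "face_boundary ?L z = (\<lambda>_. 0)" unfolding bdry[OF z(1)] by (rule z(2))
    ultimately obtain b where b: "b \<in> carrier (face_chain_group ?L (int k - 1 + 1))" "face_boundary ?L b = z"
      using trivial_homology_exact by blast
    have "int k - 1 + 1 = int (Suc k) - 1" by simp
    hence bL: "b \<in> face_chains ?L (Suc k)" using b(1) unfolding grp[symmetric] by simp
    show "\<exists>b\<in>face_chains ?L (Suc k). ctr (\<lambda>_. 1) b = z"
      by (rule bexI[OF _ bL]) (simp only: bdry[OF bL, symmetric] b(2))
  qed
qed

text \<open>Here \<open>\<Gamma>\<close> is the pure skeleton of dimension \<open>2 r - 1\<close>.\<close>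

lemma intersecting_card_le_star:
  fixes \<Gamma> A :: "'a set set"
  assumes V: "vertex_set V" and \<Gamma>: "\<Gamma> \<subseteq> Pow V" "\<And>S T. S \<in> \<Gamma> \<Longrightarrow> T \<subseteq> S \<Longrightarrow> T \<in> \<Gamma>" "\<Gamma> \<noteq> {}"
    and pure: "\<And>\<sigma>. \<sigma> \<in> \<Gamma> \<Longrightarrow> \<exists>\<tau>\<in>\<Gamma>. \<sigma> \<subseteq> \<tau> \<and> card \<tau> = 2 * r"
    and cm: "cohen_macaulay TYPE('f::field) \<Gamma>"
    and A: "A \<subseteq> \<Gamma>" "\<And>\<sigma>. \<sigma> \<in> A \<Longrightarrow> card \<sigma> = r" "\<And>\<sigma> \<tau>. \<sigma> \<in> A \<Longrightarrow> \<tau> \<in> A \<Longrightarrow> \<sigma> \<inter> \<tau> \<noteq> {}"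
    and r: "r \<ge> 1" and v: "v \<in> V"
  shows "card A \<le> card {\<sigma>\<in>\<Gamma>. v \<notin> \<sigma> \<and> card \<sigma> = r - 1}"
proof -
  interpret vertex_set V by (rule V)
  have AV: "A \<subseteq> Pow V" using A(1) \<Gamma>(1) by blast
  have ex: "exact_links TYPE('f fls) \<Gamma> (2 * r)"
    using exact_links_fls[OF cohen_macaulay_exact_links[OF V \<Gamma>(1) _ pure cm] \<Gamma>(1)] \<Gamma>(2) by blast
  obtain \<theta> :: "nat \<Rightarrow> 'a \<Rightarrow> 'f fls" where \<theta>: "general \<theta>" and sh: "shifted (leads \<theta> A r)"
    using exists_shifted_leads[OF infinite_UNIV_fls AV] by blast
  define G where "G = {S. S \<in> leads \<theta> \<Gamma> (card S)}"
  have AG: "leads \<theta> A r \<subseteq> leads \<theta> \<Gamma> r"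
    unfolding leads_def using chains_mono[OF _ A(1)] by blast
  have card_leads: "card S = p" if "S \<in> leads \<theta> \<Gamma> p" for S p using that unfolding leads_def by blast
  have n: "2 * r \<le> card V"
  proof -
    obtain \<sigma> where "\<sigma> \<in> \<Gamma>" using \<Gamma>(3) by blast
    then obtain \<tau> where "\<tau> \<in> \<Gamma>" "card \<tau> = 2 * r" using pure by blast
    thus ?thesis using \<Gamma>(1) card_mono[OF finite_V, of \<tau>] by auto
  qed
  have "card A \<le> card (leads \<theta> A r)" by (rule card_le_card_leads[OF \<theta> AV A(2)])
  also have "\<dots> \<le> card {S\<in>G. card S = r \<and> 0 \<in> S}"
  proof (rule shifted_intersecting_card_le[of _ "card V"])
    show "leads \<theta> A r \<subseteq> {S. S \<subseteq> {..<card V} \<and> card S = r}" unfolding leads_def by blast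
    show "intersecting_family (leads \<theta> A r)" by (rule leads_intersecting[OF AV A(3)])
    show "shifted (leads \<theta> A r)" by (rule sh)
    show "G \<subseteq> Pow {..<card V}" unfolding G_def leads_def by blast
    show "T \<in> G" if "S \<in> G" "T \<subseteq> S" for S T
    proof -
      have "T \<in> leads \<theta> \<Gamma> (card T)"
        by (rule leads_subset[OF \<Gamma>(1) _ _ that(2)]) (use \<Gamma>(2) that(1) G_def in auto)
      thus ?thesis unfolding G_def by simp
    qed
    show "{..<t} \<union> S \<in> G" if "S \<in> leads \<theta> A r" "t \<le> card V" "card ({..<t} \<union> S) \<le> 2 * r" for S t
    proof -
      have "{..<t} \<union> S \<in> leads \<theta> \<Gamma> (card ({..<t} \<union> S))"
        by (rule leads_pure[OF ex \<Gamma>(1) _ \<theta> subsetD[OF AG that(1)] that(2,3)]) (rule \<Gamma>(2))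
      thus ?thesis unfolding G_def by simp
    qed
  qed (use r n in auto)
  also have "{S\<in>G. card S = r \<and> 0 \<in> S} = {S\<in>leads \<theta> \<Gamma> r. 0 \<in> S}"
    unfolding G_def using card_leads by blast
  also have "card \<dots> \<le> card {\<sigma>\<in>\<Gamma>. v \<notin> \<sigma> \<and> card \<sigma> = r - 1}"
  proof (rule leads_star_card_le[OF \<Gamma>(1) _ _ v])
    fix u assume u: "u \<in> V"
    have "ctr (\<theta> 0) (basis_chain {u}) {} \<noteq> 0"
      using \<theta>[unfolded general_def, rule_format, of "{u}"] u by simp
    moreover have "ctr (\<theta> 0) (basis_chain {u}) {} = (\<Sum>w\<in>V. if w = u then \<theta> 0 u else 0)"
      unfolding ctr_def basis_chain_def by (auto intro!: sum.cong)
    ultimately show "\<theta> 0 u \<noteq> 0" using u finite_V by simp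
  qed (rule \<Gamma>(2))
  finally show ?thesis .
qed

theorem corollary3p4:
  fixes \<Delta> :: "'a set set" and k r :: nat
  assumes "abstract_complex \<Delta>"
    and "\<exists>v. near_cone \<Delta> v"
    and "sequentially_cohen_macaulay TYPE('f::field) \<Delta>"
    and "min_facet_card \<Delta> = k"
    and "r > 0"
    and "real r \<le> real k / 2"
  shows "EKR r \<Delta>"
  unfolding EKR_def
proof (intro allI impI, elim conjE)
  fix A assume A: "A \<subseteq> \<Delta>" "\<forall>\<sigma>\<in>A. card \<sigma> = r" "intersecting_family A"
  let ?V = "\<Union>\<Delta>"
  have V: "vertex_set ?V" using assms(1) unfolding abstract_complex_def vertex_set_def by blast
  have down: "T \<in> \<Delta>" if "S \<in> \<Delta>" "T \<subseteq> S" for S T using assms(1) that unfolding abstract_complex_def by blast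
  have fin: "finite \<Delta>" using V unfolding vertex_set_def by (rule finite_UnionD)
  have finF: "finite \<sigma>" if "\<sigma> \<in> \<Delta>" for \<sigma> using V that unfolding vertex_set_def by (auto intro: finite_subset)
  obtain v where v: "v \<in> ?V" "\<And>\<sigma> w. \<sigma> \<in> \<Delta> \<Longrightarrow> w \<in> \<sigma> \<Longrightarrow> (\<sigma> - {w}) \<union> {v} \<in> \<Delta>"
    using assms(2) unfolding near_cone_def vertices_def by blast
  have "\<exists>\<tau>\<in>facets \<Delta>. \<sigma> \<subseteq> \<tau>" if \<sigma>: "\<sigma> \<in> \<Delta>" for \<sigma>
  proof -
    obtain \<tau> where \<tau>: "\<tau> \<in> \<Delta>" "\<sigma> \<subseteq> \<tau>" "\<forall>\<rho>\<in>\<Delta>. \<tau> \<subseteq> \<rho> \<longrightarrow> \<tau> = \<rho>"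
      using finite_has_maximal2[OF fin \<sigma>] by blast
    hence "\<tau> \<in> facets \<Delta>" unfolding facets_def by auto
    thus ?thesis using \<tau>(2) by blast
  qed
  moreover have "k \<le> card \<tau>" if "\<tau> \<in> facets \<Delta>" for \<tau>
  proof -
    have "finite (facets \<Delta>)" using fin unfolding facets_def by simp
    thus ?thesis using that unfolding assms(4)[symmetric] min_facet_card_def by simp
  qed
  moreover have "2 * r \<le> k" using assms(6) by linarith
  ultimately have large: "\<exists>\<tau>\<in>\<Delta>. \<sigma> \<subseteq> \<tau> \<and> 2 * r \<le> card \<tau>" if "\<sigma> \<in> \<Delta>" for \<sigma>
    using that unfolding facets_def by (metis (no_types, lifting) mem_Collect_eq order_trans)
  \<comment> \<open>A facet over \<open>\<sigma>\<close> has at least \<open>k\<close> and so at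
    least \<open>2 * r\<close> vertices; cutting it down to \<open>2 * r\<close> identifies the pure
    skeleton below with the set of all faces of cardinality at most \<open>2 * r\<close>.\<close>
  have large': "\<exists>\<tau>\<in>\<Delta>. \<sigma> \<subseteq> \<tau> \<and> card \<tau> = 2 * r" if \<sigma>: "\<sigma> \<in> \<Delta>" "card \<sigma> \<le> 2 * r" for \<sigma>
  proof -
    obtain \<tau> where \<tau>: "\<tau> \<in> \<Delta>" "\<sigma> \<subseteq> \<tau>" "2 * r \<le> card \<tau>" using large[OF \<sigma>(1)] by blast
    obtain \<rho> where "\<sigma> \<subseteq> \<rho>" "\<rho> \<subseteq> \<tau>" "card \<rho> = 2 * r"
      using exists_subset_between[OF \<sigma>(2) \<tau>(3,2) finF[OF \<tau>(1)]] by blast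
    thus ?thesis using down \<tau>(1) by blast
  qed
  define \<Gamma> where "\<Gamma> = pure_skeleton (int (2 * r) - 1) \<Delta>"
  have \<Gamma>: "\<Gamma> = {\<sigma>\<in>\<Delta>. card \<sigma> \<le> 2 * r}"
  proof (intro equalityI subsetI)
    fix \<tau> assume "\<tau> \<in> \<Gamma>"
    then obtain \<sigma> where \<sigma>: "\<sigma> \<in> \<Delta>" "card \<sigma> = 2 * r" "\<tau> \<subseteq> \<sigma>"
      unfolding \<Gamma>_def pure_skeleton_def face_dim_def by auto
    thus "\<tau> \<in> {\<sigma>\<in>\<Delta>. card \<sigma> \<le> 2 * r}" using down card_mono[OF finF[OF \<sigma>(1)] \<sigma>(3)] by auto
  next
    fix \<tau> assume "\<tau> \<in> {\<sigma>\<in>\<Delta>. card \<sigma> \<le> 2 * r}"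
    then obtain \<sigma> where \<sigma>: "\<sigma> \<in> \<Delta>" "\<tau> \<subseteq> \<sigma>" "card \<sigma> = 2 * r" using large' by blast
    thus "\<tau> \<in> \<Gamma>" unfolding \<Gamma>_def pure_skeleton_def face_dim_def
      by (intro CollectI bexI[OF _ \<sigma>(1)]) simp
  qed
  have e\<Delta>: "{} \<in> \<Delta>" using v(1) down by blast
  have "int (2 * r) - 1 \<le> complex_dim \<Delta>"
  proof -
    obtain \<tau> where \<tau>: "\<tau> \<in> \<Delta>" "card \<tau> = 2 * r" using large'[OF e\<Delta>] by auto
    have "face_dim \<tau> \<le> complex_dim \<Delta>" unfolding complex_dim_def using fin \<tau>(1) by simp
    thus ?thesis using \<tau>(2) unfolding face_dim_def by simp
  qed
  hence cm: "cohen_macaulay TYPE('f) \<Gamma>"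
    using assms(3) unfolding sequentially_cohen_macaulay_def \<Gamma>_def by blast
  have "card A \<le> card {\<sigma>\<in>\<Gamma>. v \<notin> \<sigma> \<and> card \<sigma> = r - 1}"
  proof (rule intersecting_card_le_star[OF V _ _ _ _ cm _ _ _ _ v(1)])
    show "\<Gamma> \<subseteq> Pow ?V" unfolding \<Gamma> by blast
    show "T \<in> \<Gamma>" if "S \<in> \<Gamma>" "T \<subseteq> S" for S T
      using that down card_mono[OF finF, of S T] unfolding \<Gamma> by auto
    show "\<Gamma> \<noteq> {}" using e\<Delta> unfolding \<Gamma> by auto
    show "\<exists>\<tau>\<in>\<Gamma>. \<sigma> \<subseteq> \<tau> \<and> card \<tau> = 2 * r" if "\<sigma> \<in> \<Gamma>" for \<sigma> using large'[of \<sigma>] that unfolding \<Gamma> by auto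
    show "A \<subseteq> \<Gamma>" using A(1,2) unfolding \<Gamma> by auto
    show "card \<sigma> = r" if "\<sigma> \<in> A" for \<sigma> using A(2) that by blast
    show "\<sigma> \<inter> \<tau> \<noteq> {}" if "\<sigma> \<in> A" "\<tau> \<in> A" for \<sigma> \<tau>
      using A(3) that unfolding intersecting_family_def by blast
    show "1 \<le> r" using assms(5) by simp
  qed
  also have "\<dots> \<le> face_number (r - 1) (face_link \<Delta> {v})"
    unfolding face_number_def
  proof (rule card_mono)
    have "face_link \<Delta> {v} \<subseteq> \<Delta>" unfolding face_link_def using down by blast
    thus "finite {\<sigma> \<in> face_link \<Delta> {v}. card \<sigma> = r - 1}" using fin by (simp add: finite_subset)
    show "{\<sigma> \<in> \<Gamma>. v \<notin> \<sigma> \<and> card \<sigma> = r - 1} \<subseteq> {\<sigma> \<in> face_link \<Delta> {v}. card \<sigma> = r - 1}"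
    proof
      fix \<sigma> assume "\<sigma> \<in> {\<sigma> \<in> \<Gamma>. v \<notin> \<sigma> \<and> card \<sigma> = r - 1}"
      hence \<sigma>: "\<sigma> \<in> \<Delta>" "v \<notin> \<sigma>" "card \<sigma> = r - 1" unfolding \<Gamma> by auto
      have "card \<sigma> \<le> 2 * r" using \<sigma>(3) by simp
      from large'[OF \<sigma>(1) this] obtain \<tau> where \<tau>: "\<tau> \<in> \<Delta>" "\<sigma> \<subseteq> \<tau>" "card \<tau> = 2 * r" by blast
      \<comment> \<open>A face with \<open>r - 1\<close> vertices is properly contained in one with
        \<open>2 * r\<close>. A vertex \<open>w\<close> of the difference can be exchanged for the
        apex \<open>v\<close>, which shows that \<open>\<sigma> \<union> {v}\<close> is a
        face.\<close>
      have "\<sigma> \<noteq> \<tau>"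
      proof
        assume "\<sigma> = \<tau>"
        hence "r - 1 = 2 * r" using \<sigma>(3) \<tau>(3) by (metis (no_types))
        thus False using assms(5) by linarith
      qed
      then obtain w where w: "w \<in> \<tau>" "w \<notin> \<sigma>" using \<tau>(2) by blast
      have "\<sigma> \<union> {v} \<in> \<Delta>" by (rule down[OF v(2)[OF \<tau>(1) w(1)]]) (use \<tau>(2) w(2) in blast)
      thus "\<sigma> \<in> {\<sigma> \<in> face_link \<Delta> {v}. card \<sigma> = r - 1}" using \<sigma> unfolding face_link_def by simp
    qed
  qed
  also have "\<dots> \<le> Max ((\<lambda>v. face_number (r - 1) (face_link \<Delta> {v})) ` vertices \<Delta>)"
    by (rule Max_ge) (use V v(1) in \<open>auto simp: vertices_def vertex_set_def\<close>)
  finally show "card A \<le> Max ((\<lambda>v. face_number (r - 1) (face_link \<Delta> {v})) ` vertices \<Delta>)" .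
qed

end
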